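(* Let $\varphi$ be a measure on $(\mathrm{Lip}(\mathcal{L}_{\mathbb{N}:k}),\mathcal{F})$ satisfying $\varphi(\{\mathbf{Id}_\infty\})=0$ and $\varphi_n(\mathrm{Lip}(\mathcal{L}_{[n]:k})\setminus\{\mathbf{Id}_n\})<\infty$ for every $n\in\mathbb{N}$. Let $\mathbf{F}=\{(t,F^t)\}\subset\mathbb{R}^+\times\mathrm{Lip}(\mathcal{L}_{\mathbb{N}:k})$ be a Poisson point process with intensity $\mathrm{d}t\otimes\varphi$, and let $\lambda_0\in\mathcal{L}_{\mathbb{N}:k}$ be some (possibly random) initial state. For each $n\in\mathbb{N}$ define $\boldsymbol{\Lambda}^{[n]}=(\Lambda^{[n]}_t,t\ge 0)$ on $\mathcal{L}_{[n]:k}$ by $\Lambda^{[n]}_0=\lambda_{0|[n]}$ and, for $t>0$: if $t$ is an atom time of $\mathbf{F}$ such that $F^t_{[n]}\ne\mathbf{Id}_n$, put $\Lambda^{[n]}_t=F^t_{[n]}(\Lambda^{[n]}_{t-})$; otherwise, put $\Lambda^{[n]}_t=\Lambda^{[n]}_{t-}$. Then for every $n\in\mathbb{N}$, $\boldsymbol{\Lambda}^{[n]}$ is a càdlàg finite state space Markov process, and $(\boldsymbol{\Lambda}^{[n]},n\in\mathbb{N})$ determines a unique consistent Markov process $\boldsymbol{\Lambda}$ on $\mathcal{L}_{\mathbb{N}:k}$.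
   Context: Fix $k\in\mathbb{N}$. Write $[n]=\{1,\dots,n\}$. For $A\subseteq\mathbb{N}$, a $k$-partition of $A$ is a vector $\lambda=(\lambda_1,\dots,\lambda_k)$ of pairwise disjoint (possibly empty) subsets of $A$ with union $A$; equivalently a map $\lambda:A\to[k]$ with $\lambda(i)=j$ iff $i\in\lambda_j$. $\mathcal{L}_{A:k}$ is the set of $k$-partitions of $A$. The restriction of $\lambda$ to $[n]$ is $\lambda_{|[n]}=(\lambda_1\cap[n],\dots,\lambda_k\cap[n])$. $\mathcal{L}_{\mathbb{N}:k}$ carries the ultrametric $d(\lambda,\lambda')=2^{-\mathbf{n}(\lambda,\lambda')}$, $\mathbf{n}(\lambda,\lambda')=\max\{n:\lambda_{|[n]}=\lambda'_{|[n]}\}$ (equal to $0$ if the restrictions to $[1]$ differ, and $\infty$ if $\lambda=\lambda'$, with $2^{-\infty}=0$), and the $\sigma$-field generated by the restriction maps to $\mathcal{L}_{[n]:k}$, $n\in\mathbb{N}$. $\mathcal{L}_{[n]:k}$ carries the analogous metric. $\mathrm{Lip}(\mathcal{L}_{\mathbb{N}:k})$ is the set of maps $F:\mathcal{L}_{\mathbb{N}:k}\to\mathcal{L}_{\mathbb{N}:k}$ with $d(F(\lambda),F(\lambda'))\le d(\lambda,\lambda')$ for all $\lambda,\lambda'$; $\mathrm{Lip}(\mathcal{L}_{[n]:k})$ is defined likewise. For $F\in\mathrm{Lip}(\mathcal{L}_{\mathbb{N}:k})$, its restriction $F_{[n]}\in\mathrm{Lip}(\mathcal{L}_{[n]:k})$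 is $F_{[n]}(\lambda)=F(\lambda^* )_{|[n]}$ for any $\lambda^*\in\mathcal{L}_{\mathbb{N}:k}$ with $\lambda^*_{|[n]}=\lambda$. $\mathcal{F}$ is the $\sigma$-field on $\mathrm{Lip}(\mathcal{L}_{\mathbb{N}:k})$ generated by the restriction maps $F\mapsto F_{[n]}$, $n\in\mathbb{N}$. For a measure $\varphi$ on $(\mathrm{Lip}(\mathcal{L}_{\mathbb{N}:k}),\mathcal{F})$, $\varphi_n$ is its image on $\mathrm{Lip}(\mathcal{L}_{[n]:k})$ under $F\mapsto F_{[n]}$. $\mathbf{Id}_n$ and $\mathbf{Id}_\infty$ are the identity maps on $\mathcal{L}_{[n]:k}$ and $\mathcal{L}_{\mathbb{N}:k}$. A Markov process $\boldsymbol{\Lambda}=(\Lambda_t,t\ge0)$ on $\mathcal{L}_{\mathbb{N}:k}$ is consistent if for each $n$ the restriction $\boldsymbol{\Lambda}_{|[n]}=(\Lambda_{t|[n]},t\ge0)$ is a Markov chain on $\mathcal{L}_{[n]:k}$. That $(\boldsymbol{\Lambda}^{[n]})_n$ determines $\boldsymbol{\Lambda}$ means $\Lambda_{t|[n]}=\Lambda^{[n]}_t$ for all $t\ge0$ and $n\in\mathbb{N}$.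
   Formalization: The possibly random initial state λ_0 is assumed independent of the Poisson point process F; without this the Markov property can fail. *)

theory Defs
  imports "HOL-Probability.Probability"
begin

text \<open>
  The natural numbers of the text are the positive ones, i.e. \<open>{1..}\<close>, and \<open>[n]\<close> is \<open>{1..n}\<close>.
  A \<open>k\<close>-partition of \<open>A\<close> is encoded by its colouring \<open>A \<rightarrow> [k]\<close>, extended by \<open>undefined\<close> outside
  \<open>A\<close> (and likewise for maps between sets of partitions), so that equality of functions is the
  intended equality. The restriction to \<open>[n]\<close> is then \<open>restrict l {1..n}\<close>.
\<close>

type_synonym colouring = "nat \<Rightarrow> nat"
type_synonym colouring_map = "colouring \<Rightarrow> colouring"

definition partitions :: "nat \<Rightarrow> nat set \<Rightarrow> colouring set" where
  "partitions k A = A \<rightarrow>\<^sub>E {1..k}"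

text \<open>
  One formula serves both for \<open>A = {1..}\<close> and for \<open>A = {1..m}\<close>: for distinct partitions of the same
  such \<open>A\<close> the set below is finite, and it contains \<open>0\<close>.
\<close>

definition pdist :: "colouring \<Rightarrow> colouring \<Rightarrow> real" where
  "pdist l l' = (if l = l' then 0
     else (1 / 2) ^ Max {n. restrict l {1..n} = restrict l' {1..n}})"

definition partition_space :: "nat \<Rightarrow> colouring measure" where
  "partition_space k = sigma (partitions k {1..})
     {(\<lambda>l. restrict l {1..n}) -` B \<inter> partitions k {1..} | n B.
        1 \<le> n \<and> B \<subseteq> partitions k {1..n}}"

definition Lip :: "nat \<Rightarrow> nat set \<Rightarrow> colouring_map set" where
  "Lip k A = {F \<in> partitions k A \<rightarrow>\<^sub>E partitions k A.
     \<forall>l\<in>partitions k A. \<forall>l'\<in>partitions k A. pdist (F l) (F l') \<le> pdist l l'}"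

definition Id_map :: "nat \<Rightarrow> nat set \<Rightarrow> colouring_map" where
  "Id_map k A = (\<lambda>l\<in>partitions k A. l)"

definition map_restr :: "nat \<Rightarrow> nat \<Rightarrow> colouring_map \<Rightarrow> colouring_map" where
  "map_restr k n F = (\<lambda>l\<in>partitions k {1..n}.
     restrict (F (SOME l'. l' \<in> partitions k {1..} \<and> restrict l' {1..n} = l)) {1..n})"

definition Lip_space :: "nat \<Rightarrow> colouring_map measure" where
  "Lip_space k = sigma (Lip k {1..})
     {map_restr k n -` B \<inter> Lip k {1..} | n B. 1 \<le> n \<and> B \<subseteq> Lip k {1..n}}"

definition image_measure :: "nat \<Rightarrow> colouring_map measure \<Rightarrow> nat \<Rightarrow> colouring_map measure" where
  "image_measure k \<phi> n = distr \<phi> (count_space (Lip k {1..n})) (map_restr k n)"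


definition points_in :: "('w \<Rightarrow> 'b set) \<Rightarrow> 'b set \<Rightarrow> 'w \<Rightarrow> ennreal" where
  "points_in X B \<omega> = emeasure (count_space UNIV) (X \<omega> \<inter> B)"

text \<open>
  A Poisson point process is a random countable set. Recording no multiplicities is adequate
  because the intensity it is used for, \<open>dt \<otimes> \<phi>\<close>, has no atoms.
\<close>

definition poisson_point_process ::
    "'w measure \<Rightarrow> 'b measure \<Rightarrow> ('w \<Rightarrow> 'b set) \<Rightarrow> bool" where
  "poisson_point_process M \<mu> X \<longleftrightarrow>
     (\<forall>\<omega>\<in>space M. countable (X \<omega>) \<and> X \<omega> \<subseteq> space \<mu>) \<and>
     (\<forall>B\<in>sets \<mu>. points_in X B \<in> borel_measurable M) \<and>
     (\<forall>B\<in>sets \<mu>. emeasure \<mu> B < \<infinity> \<longrightarrow>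
        (\<forall>j::nat. measure M {\<omega> \<in> space M. points_in X B \<omega> = of_nat j} =
           measure \<mu> B ^ j / fact j * exp (- measure \<mu> B))) \<and>
     (\<forall>B\<in>sets \<mu>. emeasure \<mu> B = \<infinity> \<longrightarrow> (AE \<omega> in M. points_in X B \<omega> = \<infinity>)) \<and>
     (\<forall>B :: nat \<Rightarrow> 'b set. range B \<subseteq> sets \<mu> \<longrightarrow> disjoint_family B \<longrightarrow>
        prob_space.indep_vars M (\<lambda>_. borel) (\<lambda>i. points_in X (B i)) UNIV)"

definition point_process_events ::
    "'w measure \<Rightarrow> 'b measure \<Rightarrow> ('w \<Rightarrow> 'b set) \<Rightarrow> 'w set set" where
  "point_process_events M \<mu> X = sigma_sets (space M)
     {points_in X B -` C \<inter> space M | B C. B \<in> sets \<mu> \<and> C \<in> sets borel}"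


text \<open>
  Markov processes are time-homogeneous: there is a transition function, and the Markov property
  is taken with respect to the natural filtration.
\<close>

definition natural_filtration ::
    "'w measure \<Rightarrow> 's measure \<Rightarrow> (real \<Rightarrow> 'w \<Rightarrow> 's) \<Rightarrow> real \<Rightarrow> 'w measure" where
  "natural_filtration M S Y s =
     sigma (space M) {Y u -` A \<inter> space M | u A. 0 \<le> u \<and> u \<le> s \<and> A \<in> sets S}"

definition transition_function :: "'s measure \<Rightarrow> (real \<Rightarrow> 's \<Rightarrow> 's measure) \<Rightarrow> bool" where
  "transition_function S p \<longleftrightarrow>
     (\<forall>t\<ge>0. p t \<in> S \<rightarrow>\<^sub>M prob_algebra S) \<and>
     (\<forall>x\<in>space S. p 0 x = return S x) \<and>
     (\<forall>s\<ge>0. \<forall>t\<ge>0. \<forall>x\<in>space S. p (s + t) x = p s x \<bind> p t)"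

definition markov_process ::
    "'w measure \<Rightarrow> 's measure \<Rightarrow> (real \<Rightarrow> 'w \<Rightarrow> 's) \<Rightarrow> bool" where
  "markov_process M S Y \<longleftrightarrow>
     (\<forall>t\<ge>0. Y t \<in> M \<rightarrow>\<^sub>M S) \<and>
     (\<exists>p. transition_function S p \<and>
       (\<forall>s\<ge>0. \<forall>t\<ge>0. \<forall>A\<in>sets S. AE \<omega> in M.
          real_cond_exp M (natural_filtration M S Y s)
            (indicator {\<omega>' \<in> space M. Y (s + t) \<omega>' \<in> A}) \<omega> = measure (p t (Y s \<omega>)) A))"

definition consistent_markov_process ::
    "'w measure \<Rightarrow> nat \<Rightarrow> (real \<Rightarrow> 'w \<Rightarrow> colouring) \<Rightarrow> bool" where
  "consistent_markov_process M k Y \<longleftrightarrow>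
     markov_process M (partition_space k) Y \<and>
     (\<forall>n\<ge>1. markov_process M (count_space (partitions k {1..n}))
        (\<lambda>t \<omega>. restrict (Y t \<omega>) {1..n}))"


definition has_left_limit :: "(real \<Rightarrow> colouring) \<Rightarrow> real \<Rightarrow> colouring \<Rightarrow> bool" where
  "has_left_limit x t l \<longleftrightarrow> ((\<lambda>s. pdist (x s) l) \<longlongrightarrow> 0) (at_left t)"

definition cadlag :: "colouring set \<Rightarrow> (real \<Rightarrow> colouring) \<Rightarrow> bool" where
  "cadlag S x \<longleftrightarrow>
     (\<forall>t\<ge>0. x t \<in> S \<and> ((\<lambda>s. pdist (x s) (x t)) \<longlongrightarrow> 0) (at_right t)) \<and>
     (\<forall>t>0. \<exists>l\<in>S. has_left_limit x t l)"


definition atom_at :: "(real \<times> colouring_map) set \<Rightarrow> real \<Rightarrow> colouring_map" where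
  "atom_at X t = (THE F. (t, F) \<in> X)"

definition jump_times :: "nat \<Rightarrow> nat \<Rightarrow> (real \<times> colouring_map) set \<Rightarrow> real set" where
  "jump_times k n X =
     {t. 0 < t \<and> (\<exists>F. (t, F) \<in> X \<and> map_restr k n F \<noteq> Id_map k {1..n})}"

text \<open>
  The configurations for which the description of the processes \<open>\<Lambda>\<^sup>[\<^sup>n\<^sup>]\<close> makes sense. The Poisson
  point process is almost surely of this kind (this is part of the theorem).
\<close>

definition regular_points :: "nat \<Rightarrow> (real \<times> colouring_map) set \<Rightarrow> bool" where
  "regular_points k X \<longleftrightarrow>
     (\<forall>t F G. (t, F) \<in> X \<longrightarrow> (t, G) \<in> X \<longrightarrow> F = G) \<and>
     (\<forall>t. (t, Id_map k {1..}) \<notin> X) \<and>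
     (\<forall>n\<ge>1. \<forall>t. finite (jump_times k n X \<inter> {..t}))"

text \<open>
  The paths of \<open>\<Lambda>\<^sup>[\<^sup>n\<^sup>]\<close>: start from the restricted initial state, stay put between the jump times and
  apply \<open>F\<^sup>s\<close>, restricted to \<open>[n]\<close>, at each jump time \<open>s\<close>. That this solves the rule \<open>jump_rule\<close> below,
  which mentions the left limits, is part of the theorem. Irregular configurations (a null event)
  get a constant path.
\<close>

definition Lambda_fin ::
    "nat \<Rightarrow> nat \<Rightarrow> (real \<times> colouring_map) set \<Rightarrow> colouring \<Rightarrow> real \<Rightarrow> colouring" where
  "Lambda_fin k n X l0 t =
     (if regular_points k X
      then fold (\<lambda>s. map_restr k n (atom_at X s))
             (sorted_list_of_set (jump_times k n X \<inter> {..t})) (restrict l0 {1..n})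
      else restrict l0 {1..n})"

definition jump_rule ::
    "nat \<Rightarrow> nat \<Rightarrow> (real \<times> colouring_map) set \<Rightarrow> colouring \<Rightarrow> (real \<Rightarrow> colouring) \<Rightarrow> bool" where
  "jump_rule k n X l0 x \<longleftrightarrow>
     x 0 = restrict l0 {1..n} \<and>
     (\<forall>t>0. \<exists>l\<in>partitions k {1..n}. has_left_limit x t l \<and>
        x t = (if t \<in> jump_times k n X then map_restr k n (atom_at X t) l else l))"

definition determines :: "nat \<Rightarrow> (nat \<Rightarrow> real \<Rightarrow> colouring) \<Rightarrow> (real \<Rightarrow> colouring) \<Rightarrow> bool" where
  "determines k xs x \<longleftrightarrow>
     (\<forall>t\<ge>0. x t \<in> partitions k {1..} \<and> (\<forall>n\<ge>1. restrict (x t) {1..n} = xs n t))"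

end

theory Submission
  imports Defs
begin

text \<open>
  A Lipschitz map is one whose value on \<open>[n]\<close> depends on the argument on \<open>[n]\<close> only, so the finite
  paths are consistent in \<open>n\<close> and glue to a path of partitions of \<open>\<nat>\<close>.

  For the Markov property, cut time into small cells and let the first mark found in a cell act as
  a map of the finite state space. The marks of disjoint cells are independent and their law depends
  on the length of the cell only, so the discretised process is a product of independent random maps,
  identically distributed as long as the mesh is constant. With cells of length \<open>s / m\<close> up to time
  \<open>s\<close> and \<open>t / m\<close> from then on, both the independence of the increment from the past and its
  stationarity are exact for every \<open>m\<close>. On a regular configuration the discretised path agrees
  with the true one for all large \<open>m\<close>, and the identities pass to the limit.
\<close>

text \<open>The Poisson hypothesis speaks only of numbers of points in measurable sets, so the law
  of the paths, their measurability and the regularity of the configuration must all be read off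
  from such numbers; this is what the cells are for. The mesh changes at \<open>s\<close> because a
  uniform grid from \<open>0\<close> cannot contain both \<open>s\<close> and \<open>s + t\<close>
  when their ratio is irrational, whereas with two meshes both are grid points for every
  \<open>m\<close>. Past times need not be grid points; they are rounded up, which is harmless in
  the limit because the paths are constant just after every time.

  The transition kernel is not built from jump rates: \<open>p t x\<close> is the law of the path
  that starts at \<open>x\<close> and is driven by the same points. The semigroup property and the
  Markov property then become one identity, applied to a constant start and to the random start. On
  the space of partitions of all positive integers, finitely many cylinder events live at one common
  finite level, so the identity is checked there and extended by uniqueness of measures on
  intersection-stable generators.\<close>

declare One_nat_def [simp del]

section \<open>Partitions and Lipschitz maps\<close>

lemma finite_partitions: "finite (partitions k {1..n::nat})"
  unfolding partitions_def by (intro finite_PiE) auto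

lemma finite_Lip: "finite (Lip k {1..n})"
proof -
  have "Lip k {1..n} \<subseteq> partitions k {1..n} \<rightarrow>\<^sub>E partitions k {1..n}"
    by (auto simp: Lip_def)
  then show ?thesis
    by (rule finite_subset) (intro finite_PiE finite_partitions)
qed

lemma restrict_in_partitions:
  "l \<in> partitions k A \<Longrightarrow> B \<subseteq> A \<Longrightarrow> restrict l B \<in> partitions k B"
  unfolding partitions_def by (auto simp: PiE_iff)

lemma partitions_restrict_same: "l \<in> partitions k A \<Longrightarrow> restrict l A = l"
  unfolding partitions_def by (auto simp: PiE_iff extensional_restrict)

text \<open>Missing elements get the colour \<open>1\<close>, which is available because
  \<open>1 \<le> k\<close>. This lifts arguments of maps from a finite level to a larger
  one.\<close>

lemma partitions_extend:
  assumes "1 \<le> k" "B \<subseteq> A" "y \<in> partitions k B"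
  obtains l where "l \<in> partitions k A" "restrict l B = y"
proof
  show "(\<lambda>i\<in>A. if i \<in> B then y i else 1) \<in> partitions k A"
    using assms by (auto simp: partitions_def PiE_iff)
  show "restrict (\<lambda>i\<in>A. if i \<in> B then y i else 1) B = y"
    using assms by (auto simp: partitions_def PiE_iff fun_eq_iff extensional_def)
qed

lemma restrict_eq_mono:
  "restrict f A = restrict g A \<Longrightarrow> B \<subseteq> A \<Longrightarrow> restrict f B = restrict g B"
  by (metis Int_absorb1 restrict_restrict)

text \<open>The levels of agreement form a finite initial segment: agreement passes to smaller sets,
  and a point \<open>i\<close> where the colourings differ bounds the levels. Hence the exponent in
  \<open>pdist\<close> is at least \<open>j\<close> exactly when \<open>j\<close> is itself such a
  level. The inclusion \<open>A \<subseteq> {1..}\<close> makes \<open>i\<close> visible in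
  \<open>{1..i}\<close>.\<close>

lemma pdist_le_iff:
  assumes l: "l \<in> partitions k A" and l': "l' \<in> partitions k A" and A: "A \<subseteq> {1..}"
  shows "pdist l l' \<le> (1/2)^j \<longleftrightarrow> restrict l {1..j} = restrict l' {1..j}"
proof (cases "l = l'")
  case True
  then show ?thesis by (simp add: pdist_def)
next
  case False
  then obtain i where i: "l i \<noteq> l' i" by auto
  have "i \<in> A" using l l' i by (metis PiE_E partitions_def)
  with A have i1: "1 \<le> i" by auto
  let ?D = "{n. restrict l {1..n} = restrict l' {1..n}}"
  have bnd: "?D \<subseteq> {..<i}"
  proof
    fix n assume "n \<in> ?D"
    then have "restrict l {1..n} i = restrict l' {1..n} i" by simp
    with i i1 show "n \<in> {..<i}" by (auto simp: restrict_def split: if_splits)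
  qed
  then have fin: "finite ?D" by (rule finite_subset) simp
  have zero: "0 \<in> ?D" by (auto simp: restrict_def)
  have "pdist l l' \<le> (1/2)^j \<longleftrightarrow> j \<le> Max ?D"
    using False by (simp add: pdist_def del: power_divide)
  also have "\<dots> \<longleftrightarrow> j \<in> ?D"
  proof
    assume "j \<le> Max ?D"
    moreover have "Max ?D \<in> ?D" using Max_in[OF fin] zero by blast
    ultimately show "j \<in> ?D"
      using restrict_eq_mono[of l "{1..Max ?D}" l' "{1..j}"] by auto
  qed (use fin in simp)
  finally show ?thesis by simp
qed

lemma pdist_eqI_small:
  assumes "l \<in> partitions k {1..n}" "l' \<in> partitions k {1..n}" "pdist l l' \<le> (1/2)^n"
  shows "l = l'"
  using assms pdist_le_iff[of l k "{1..n}" l' n] partitions_restrict_same by fastforce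

text \<open>Nonzero distances are powers of \<open>1/2\<close>, so the Lipschitz inequality only has
  to be tested against the thresholds \<open>(1/2)^j\<close>, and \<open>pdist_le_iff\<close> turns
  each test into agreement on \<open>[j]\<close>.\<close>

lemma Lip_iff:
  assumes A: "A \<subseteq> {1..}"
  shows "F \<in> Lip k A \<longleftrightarrow> F \<in> partitions k A \<rightarrow>\<^sub>E partitions k A \<and>
    (\<forall>l\<in>partitions k A. \<forall>l'\<in>partitions k A. \<forall>j.
       restrict l {1..j} = restrict l' {1..j} \<longrightarrow> restrict (F l) {1..j} = restrict (F l') {1..j})"
    (is "_ \<longleftrightarrow> _ \<and> ?R")
proof (cases "F \<in> partitions k A \<rightarrow>\<^sub>E partitions k A")
  case False
  then show ?thesis by (auto simp: Lip_def)
next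
  case True
  have eq: "pdist (F l) (F l') \<le> (1/2)^j \<longleftrightarrow> restrict (F l) {1..j} = restrict (F l') {1..j}"
    "pdist l l' \<le> (1/2)^j \<longleftrightarrow> restrict l {1..j} = restrict l' {1..j}"
    if "l \<in> partitions k A" "l' \<in> partitions k A" for l l' j
    using pdist_le_iff[OF _ _ A] that PiE_mem[OF True] by blast+
  have "F \<in> Lip k A" if R: ?R
    unfolding Lip_def
  proof (intro CollectI conjI ballI True)
    fix l l' assume ll: "l \<in> partitions k A" "l' \<in> partitions k A"
    show "pdist (F l) (F l') \<le> pdist l l'"
    proof (cases "l = l'")
      case True then show ?thesis by (simp add: pdist_def)
    next
      case False
      then obtain j where j: "pdist l l' = (1/2)^j" by (auto simp: pdist_def)
      then have "pdist (F l) (F l') \<le> (1/2)^j"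
        using R ll eq[OF ll] by (metis order_refl)
      with j show ?thesis by simp
    qed
  qed
  moreover have ?R if "F \<in> Lip k A"
  proof (intro ballI allI impI)
    fix l l' j assume "l \<in> partitions k A" "l' \<in> partitions k A"
      "restrict l {1..j} = restrict l' {1..j}"
    then show "restrict (F l) {1..j} = restrict (F l') {1..j}"
      using that eq[of l l' j] order_trans unfolding Lip_def by blast
  qed
  ultimately show ?thesis using True by blast
qed

lemma Lip_in: "F \<in> Lip k A \<Longrightarrow> l \<in> partitions k A \<Longrightarrow> F l \<in> partitions k A"
  unfolding Lip_def by (auto simp: PiE_iff)

lemma Lip_restrict_cong:
  "F \<in> Lip k {1..} \<Longrightarrow> l \<in> partitions k {1..} \<Longrightarrow> l' \<in> partitions k {1..} \<Longrightarrow>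
    restrict l {1..j} = restrict l' {1..j} \<Longrightarrow> restrict (F l) {1..j} = restrict (F l') {1..j}"
  unfolding Lip_iff[OF order_refl] by blast

text \<open>A Lipschitz map cannot distinguish on \<open>[n]\<close> between extensions that agree
  on \<open>[n]\<close>, so the choice made by \<open>SOME\<close> in \<open>map_restr\<close> is
  immaterial and may be replaced by \<open>l\<close>.\<close>

lemma map_restr_restrict:
  assumes F: "F \<in> Lip k {1..}" and l: "l \<in> partitions k {1..}"
  shows "map_restr k n F (restrict l {1..n}) = restrict (F l) {1..n}"
proof -
  let ?P = "\<lambda>l'. l' \<in> partitions k {1..} \<and> restrict l' {1..n} = restrict l {1..n}"
  have "?P (SOME l'. ?P l')" using l by (intro someI[of ?P l]) simp
  then have "restrict (F (SOME l'. ?P l')) {1..n} = restrict (F l) {1..n}"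
    using Lip_restrict_cong[OF F _ l] by blast
  then show ?thesis
    using l restrict_in_partitions[OF l, of "{1..n}"] by (simp add: map_restr_def)
qed

lemma partitions_extendN:
  assumes "1 \<le> k" "y \<in> partitions k {1..n}"
  obtains l where "l \<in> partitions k {1..}" "restrict l {1..n} = y"
  using partitions_extend[of k "{1..n}" "{1..}" y] assms by auto

text \<open>Lift both arguments to partitions of \<open>{1..}\<close>: agreement on
  \<open>[j]\<close> at level \<open>n\<close> is agreement of the lifts on
  \<open>[min n j]\<close>, which \<open>F\<close> preserves.\<close>

lemma map_restr_in_Lip:
  assumes k: "1 \<le> k" and F: "F \<in> Lip k {1..}"
  shows "map_restr k n F \<in> Lip k {1..n}"
proof -
  have sub: "{1..n} \<subseteq> {1..}" by auto
  show ?thesis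
    unfolding Lip_iff[OF sub]
  proof (safe intro!: PiE_I)
    fix y assume "y \<in> partitions k {1..n}"
    then obtain l where "l \<in> partitions k {1..}" "restrict l {1..n} = y"
      using partitions_extendN[OF k] by blast
    then show "map_restr k n F y \<in> partitions k {1..n}"
      using map_restr_restrict[OF F] Lip_in[OF F] restrict_in_partitions[of _ k "{1..}" "{1..n}"]
      by auto
  next
    fix y assume "y \<notin> partitions k {1..n}"
    then show "map_restr k n F y = undefined" by (simp add: map_restr_def)
  next
    fix y y' j assume y: "y \<in> partitions k {1..n}" "y' \<in> partitions k {1..n}"
      and j: "restrict y {1..j} = restrict y' {1..j}"
    obtain l l' where l: "l \<in> partitions k {1..}" "restrict l {1..n} = y"
      "l' \<in> partitions k {1..}" "restrict l' {1..n} = y'"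
      using partitions_extendN[OF k y(1)] partitions_extendN[OF k y(2)] by metis
    have i: "{1..n} \<inter> {1..j} = {1..min n j}" by auto
    have "restrict l {1..min n j} = restrict l' {1..min n j}"
      using j l by (metis i restrict_restrict)
    then have "restrict (F l) {1..min n j} = restrict (F l') {1..min n j}"
      using Lip_restrict_cong[OF F] l by blast
    then show "restrict (map_restr k n F y) {1..j} = restrict (map_restr k n F y') {1..j}"
      using map_restr_restrict[OF F] l by (metis i restrict_restrict)
  qed
qed

lemma map_restr_in:
  "1 \<le> k \<Longrightarrow> F \<in> Lip k {1..} \<Longrightarrow> y \<in> partitions k {1..n} \<Longrightarrow> map_restr k n F y \<in> partitions k {1..n}"
  using Lip_in[OF map_restr_in_Lip] .

text \<open>Both sides are the restriction to \<open>[m]\<close> of \<open>F l\<close> for a common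
  extension \<open>l\<close> of \<open>y\<close>. The consistency of the paths across levels comes
  from here.\<close>

lemma map_restr_mono:
  assumes k: "1 \<le> k" and F: "F \<in> Lip k {1..}" and "m \<le> n" and y: "y \<in> partitions k {1..n}"
  shows "map_restr k m F (restrict y {1..m}) = restrict (map_restr k n F y) {1..m}"
proof -
  obtain l where l: "l \<in> partitions k {1..}" "restrict l {1..n} = y"
    using partitions_extendN[OF k y] by blast
  have i: "{1..n} \<inter> {1..m} = {1..m}" using \<open>m \<le> n\<close> by auto
  have "restrict y {1..m} = restrict l {1..m}" using l by (metis i restrict_restrict)
  then show ?thesis
    using map_restr_restrict[OF F l(1)] l by (metis i restrict_restrict)
qed

text \<open>Read contrapositively: a map that acts nontrivially at level \<open>m\<close> also does
  so at level \<open>n\<close>, so raising the level can only add jump times.\<close>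

lemma map_restr_eq_Id_mono:
  assumes k: "1 \<le> k" and F: "F \<in> Lip k {1..}" and "m \<le> n"
    and Id: "map_restr k n F = Id_map k {1..n}"
  shows "map_restr k m F = Id_map k {1..m}"
proof
  fix y show "map_restr k m F y = Id_map k {1..m} y"
  proof (cases "y \<in> partitions k {1..m}")
    case True
    then obtain l where "l \<in> partitions k {1..n}" "restrict l {1..m} = y"
      using partitions_extend[OF k, of "{1..m}" "{1..n}"] \<open>m \<le> n\<close> by auto
    then show ?thesis
      using map_restr_mono[OF k F \<open>m \<le> n\<close>, of l] Id True by (simp add: Id_map_def)
  qed (simp add: map_restr_def Id_map_def)
qed

lemma partitions_eqI:
  assumes "l \<in> partitions k {1..}" "l' \<in> partitions k {1..}"
    and "\<And>n. 1 \<le> n \<Longrightarrow> restrict l {1..n} = restrict l' {1..n}"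
  shows "l = l'"
proof
  fix i show "l i = l' i"
  proof (cases "1 \<le> i")
    case True
    from assms(3)[OF this] have "restrict l {1..i} i = restrict l' {1..i} i" by simp
    with True show ?thesis by simp
  next
    case False
    then show ?thesis using assms(1,2) by (metis PiE_E atLeast_iff partitions_def)
  qed
qed

text \<open>Every map other than the identity is detected at some finite level, where
  \<open>\<phi>\<close> is controlled. Both the sigma-finiteness of \<open>\<phi>\<close> and the
  regularity of configurations depend on this.\<close>

lemma Lip_eq_IdI:
  assumes F: "F \<in> Lip k {1..}" and Id: "\<And>n. 1 \<le> n \<Longrightarrow> map_restr k n F = Id_map k {1..n}"
  shows "F = Id_map k {1..}"
proof
  fix l show "F l = Id_map k {1..} l"
  proof (cases "l \<in> partitions k {1..}")
    case True
    have "restrict (F l) {1..n} = restrict l {1..n}" if "1 \<le> n" for n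
      using map_restr_restrict[OF F True, of n] Id[OF that] restrict_in_partitions[OF True, of "{1..n}"]
      by (simp add: Id_map_def)
    then have "F l = l" by (intro partitions_eqI[OF Lip_in[OF F True] True])
    then show ?thesis using True by (simp add: Id_map_def)
  next
    case False
    then show ?thesis using F by (auto simp: Id_map_def Lip_def PiE_iff extensional_def)
  qed
qed

lemma Id_map_in_Lip: "Id_map k A \<in> Lip k A"
  by (auto simp: Id_map_def Lip_def)

lemma map_restr_Id:
  assumes k: "1 \<le> k" shows "map_restr k n (Id_map k {1..}) = Id_map k {1..n}"
proof
  fix y show "map_restr k n (Id_map k {1..}) y = Id_map k {1..n} y"
  proof (cases "y \<in> partitions k {1..n}")
    case True
    then obtain l where "l \<in> partitions k {1..}" "restrict l {1..n} = y"
      using partitions_extendN[OF k] by blast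
    then show ?thesis using map_restr_restrict[OF Id_map_in_Lip, of l k n] True
      by (simp add: Id_map_def)
  qed (simp add: map_restr_def Id_map_def)
qed

section \<open>Paths driven by a fixed configuration of points\<close>

lemma atom_at_eq: "regular_points k X \<Longrightarrow> (t, F) \<in> X \<Longrightarrow> atom_at X t = F"
  unfolding atom_at_def regular_points_def by (intro the_equality) blast+

lemma jump_times_iff:
  "regular_points k X \<Longrightarrow> (t, F) \<in> X \<Longrightarrow>
    t \<in> jump_times k n X \<longleftrightarrow> 0 < t \<and> map_restr k n F \<noteq> Id_map k {1..n}"
  unfolding jump_times_def regular_points_def by blast

lemma jump_timesE:
  assumes "regular_points k X" "t \<in> jump_times k n X"
  obtains F where "(t, F) \<in> X" "atom_at X t = F" "0 < t" "map_restr k n F \<noteq> Id_map k {1..n}"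
  using assms atom_at_eq unfolding jump_times_def by blast

lemma finite_jump_times: "regular_points k X \<Longrightarrow> 1 \<le> n \<Longrightarrow> finite (jump_times k n X \<inter> {..t})"
  unfolding regular_points_def by blast

lemma Lambda_fin_restrict: "Lambda_fin k n X (restrict l {1..n}) = Lambda_fin k n X l"
  by (simp add: Lambda_fin_def fun_eq_iff)

lemma Lambda_fin_irregular: "\<not> regular_points k X \<Longrightarrow> Lambda_fin k n X l t = restrict l {1..n}"
  by (simp add: Lambda_fin_def)

lemma Lambda_fin_0: "Lambda_fin k n X l 0 = restrict l {1..n}"
proof -
  have "jump_times k n X \<inter> {..0} = {}" by (auto simp: jump_times_def)
  then show ?thesis by (simp add: Lambda_fin_def)
qed

lemma Lambda_fin_no_jump:
  assumes "s \<le> t" "jump_times k n X \<inter> {s<..t} = {}"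
  shows "Lambda_fin k n X l t = Lambda_fin k n X l s"
proof -
  have "jump_times k n X \<inter> {..t} = jump_times k n X \<inter> {..s}"
    using assms by (auto simp: set_eq_iff) (meson linorder_not_le)
  then show ?thesis by (simp add: Lambda_fin_def)
qed

text \<open>Since \<open>r\<close> exceeds every jump time up to \<open>s\<close>, the sorted list
  up to \<open>t\<close> is the earlier list with \<open>r\<close> appended, and \<open>fold\<close>
  applies the map of \<open>r\<close> last.\<close>

lemma Lambda_fin_jump:
  assumes reg: "regular_points k X" and n: "1 \<le> n"
    and r: "jump_times k n X \<inter> {s<..t} = {r}"
  shows "Lambda_fin k n X l t = map_restr k n (atom_at X r) (Lambda_fin k n X l s)"
proof -
  let ?J = "\<lambda>t. jump_times k n X \<inter> {..t}"
  have rJ: "r \<in> jump_times k n X" "s < r" "r \<le> t" using r by auto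
  have "?J t = ?J s \<union> (jump_times k n X \<inter> {s<..t})" using rJ by auto
  then have Jt: "?J t = insert r (?J s)" using r by simp
  have fin: "finite (?J s)" "finite (?J t)" using finite_jump_times[OF reg n] by auto
  have "sorted_list_of_set (?J t) = sorted_list_of_set (?J s) @ [r]"
  proof (rule sorted_distinct_set_unique)
    show "sorted (sorted_list_of_set (?J s) @ [r])"
      using fin rJ by (auto simp: sorted_append)
    show "distinct (sorted_list_of_set (?J s) @ [r])"
      using fin rJ by auto
    show "set (sorted_list_of_set (?J t)) = set (sorted_list_of_set (?J s) @ [r])"
      using fin Jt by (simp del: sorted_list_of_set_insert_remove)
  qed simp_all
  then show ?thesis using reg by (simp add: Lambda_fin_def)
qed

lemma fold_map_restr_in:
  assumes "1 \<le> k" "\<And>s. s \<in> set xs \<Longrightarrow> h s \<in> Lip k {1..}" "y \<in> partitions k {1..n}"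
  shows "fold (\<lambda>s. map_restr k n (h s)) xs y \<in> partitions k {1..n}"
  using assms by (induction xs arbitrary: y) (simp_all add: map_restr_in)

lemma fold_map_restr_restrict:
  assumes "1 \<le> k" "m \<le> n" "\<And>s. s \<in> set xs \<Longrightarrow> h s \<in> Lip k {1..}" "y \<in> partitions k {1..n}"
  shows "restrict (fold (\<lambda>s. map_restr k n (h s)) xs y) {1..m} =
    fold (\<lambda>s. map_restr k m (h s)) (filter (\<lambda>s. map_restr k m (h s) \<noteq> Id_map k {1..m}) xs)
      (restrict y {1..m})"
  using assms
proof (induction xs arbitrary: y)
  case (Cons a xs)
  have h: "\<And>s. s \<in> set xs \<Longrightarrow> h s \<in> Lip k {1..}" using Cons.prems(3) by simp
  have a: "h a \<in> Lip k {1..}" using Cons.prems by simp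
  have ya: "map_restr k n (h a) y \<in> partitions k {1..n}"
    using Cons.prems map_restr_in a by blast
  have "restrict y {1..m} \<in> partitions k {1..m}"
    using restrict_in_partitions[OF Cons.prems(4)] \<open>m \<le> n\<close> by auto
  then have "map_restr k m (h a) (restrict y {1..m}) = restrict y {1..m}"
    if "map_restr k m (h a) = Id_map k {1..m}"
    using that by (simp add: Id_map_def)
  moreover have "restrict (fold (\<lambda>s. map_restr k n (h s)) xs (map_restr k n (h a) y)) {1..m} =
      fold (\<lambda>s. map_restr k m (h s)) (filter (\<lambda>s. map_restr k m (h s) \<noteq> Id_map k {1..m}) xs)
        (map_restr k m (h a) (restrict y {1..m}))"
    using Cons.IH[OF Cons.prems(1,2) h ya]
    unfolding map_restr_mono[OF Cons.prems(1) a \<open>m \<le> n\<close> Cons.prems(4)] .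
  ultimately show ?case by (simp del: restrict_apply)
qed simp

lemma Lip_atom_at:
  "regular_points k X \<Longrightarrow> X \<subseteq> T \<times> Lip k {1..} \<Longrightarrow> t \<in> jump_times k n X \<Longrightarrow> atom_at X t \<in> Lip k {1..}"
  by (erule (1) jump_timesE) auto

lemma Lambda_fin_in:
  assumes k: "1 \<le> k" and n: "1 \<le> n" and X: "X \<subseteq> T \<times> Lip k {1..}"
    and l: "restrict l {1..n} \<in> partitions k {1..n}"
  shows "Lambda_fin k n X l t \<in> partitions k {1..n}"
proof (cases "regular_points k X")
  case True
  then show ?thesis
    using fold_map_restr_in[OF k _ l, of "sorted_list_of_set (jump_times k n X \<inter> {..t})" "atom_at X"]
      Lip_atom_at[OF True X, of _ n] finite_jump_times[OF True n, of t]
    by (simp add: Lambda_fin_def)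
qed (simp add: Lambda_fin_def l)

text \<open>The sorted jump times at level \<open>m\<close> are those at level \<open>n\<close> with
  the times deleted whose map is trivial on \<open>[m]\<close>, so
  \<open>fold_map_restr_restrict\<close> applies. For irregular configurations both paths are
  constant.\<close>

lemma Lambda_fin_mono:
  assumes k: "1 \<le> k" and m: "1 \<le> m" "m \<le> n" and X: "X \<subseteq> T \<times> Lip k {1..}"
    and l: "restrict l {1..n} \<in> partitions k {1..n}"
  shows "restrict (Lambda_fin k n X l t) {1..m} = Lambda_fin k m X l t"
proof -
  have i: "{1..n} \<inter> {1..m} = {1..m}" using m by auto
  have lm: "restrict (restrict l {1..n}) {1..m} = restrict l {1..m}"
    by (metis i restrict_restrict)
  show ?thesis
  proof (cases "regular_points k X")
    case False
    then show ?thesis using lm by (simp add: Lambda_fin_def)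
  next
    case reg: True
    let ?J = "\<lambda>n. jump_times k n X \<inter> {..t}"
    let ?P = "\<lambda>s. map_restr k m (atom_at X s) \<noteq> Id_map k {1..m}"
    have fin: "finite (?J n)" "finite (?J m)" using finite_jump_times[OF reg] m by auto
    have "s \<in> jump_times k m X \<longleftrightarrow> s \<in> jump_times k n X \<and> ?P s" for s
    proof
      assume "s \<in> jump_times k m X"
      then obtain F where F: "(s, F) \<in> X" "atom_at X s = F" "0 < s"
        "map_restr k m F \<noteq> Id_map k {1..m}"
        by (rule jump_timesE[OF reg])
      then have "map_restr k n F \<noteq> Id_map k {1..n}"
        using map_restr_eq_Id_mono[OF k _ \<open>m \<le> n\<close>] X by blast
      with F show "s \<in> jump_times k n X \<and> ?P s"
        by (simp add: jump_times_iff[OF reg])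
    next
      assume "s \<in> jump_times k n X \<and> ?P s"
      then show "s \<in> jump_times k m X"
        by (metis jump_timesE[OF reg] jump_times_iff[OF reg])
    qed
    then have "?J m = {s \<in> ?J n. ?P s}" by auto
    then have "sorted_list_of_set (?J m) = filter ?P (sorted_list_of_set (?J n))"
      using fin by (intro sorted_distinct_set_unique) (auto intro: sorted_wrt_filter)
    then show ?thesis
      unfolding Lambda_fin_def
      using fold_map_restr_restrict[OF k \<open>m \<le> n\<close> _ l, of "sorted_list_of_set (?J n)" "atom_at X"]
        Lip_atom_at[OF reg X, of _ n] fin reg lm by simp
  qed
qed

text \<open>At level \<open>n\<close> a distance of at most \<open>(1/2)^n\<close> is already
  \<open>0\<close>, so convergence is eventual equality and one-sided limits of paths are statements
  about constancy near a time.\<close>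

lemma tendsto_pdist_iff:
  assumes x: "eventually (\<lambda>s. x s \<in> partitions k {1..n}) F" and l: "l \<in> partitions k {1..n}"
  shows "((\<lambda>s. pdist (x s) l) \<longlongrightarrow> 0) F \<longleftrightarrow> eventually (\<lambda>s. x s = l) F"
proof
  assume "((\<lambda>s. pdist (x s) l) \<longlongrightarrow> 0) F"
  then have "eventually (\<lambda>s. pdist (x s) l < (1/2)^n) F"
    by (rule order_tendstoD(2)) simp
  with x show "eventually (\<lambda>s. x s = l) F"
    by eventually_elim (auto intro: pdist_eqI_small[OF _ l])
next
  assume "eventually (\<lambda>s. x s = l) F"
  then show "((\<lambda>s. pdist (x s) l) \<longlongrightarrow> 0) F"
    by (intro tendsto_eventually) (auto simp: pdist_def elim: eventually_mono)
qed

lemma eventually_no_jump_right: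
  assumes "finite (J \<inter> {..t + 1::real})"
  shows "eventually (\<lambda>s. J \<inter> {t<..s} = {}) (at_right t)"
proof -
  have "finite (J \<inter> {t<..t+1})" by (rule finite_subset[OF _ assms]) auto
  then have "eventually (\<lambda>s. \<forall>j\<in>J \<inter> {t<..t+1}. s < j) (at_right t)"
    by (simp add: eventually_ball_finite_distrib eventually_at_right_less)
       (auto simp: eventually_at_right_field intro: exI)
  moreover have "eventually (\<lambda>s. s < t + 1) (at_right t)"
    by (auto simp: eventually_at_right_field intro: exI[of _ "t + 1"])
  ultimately show ?thesis
  proof eventually_elim
    case (elim s)
    have "j \<notin> {t<..s}" if "j \<in> J" for j
    proof
      assume j: "j \<in> {t<..s}"
      then have "j \<in> J \<inter> {t<..t + 1}" using that elim by simp
      with elim have "s < j" by blast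
      with j show False by simp
    qed
    then show ?case by blast
  qed
qed

lemma eventually_no_jump_left:
  assumes "finite (J \<inter> {..t::real})"
  shows "eventually (\<lambda>s. s < t \<and> J \<inter> {s<..<t} = {}) (at_left t)"
proof -
  have "finite (J \<inter> {..<t})" by (rule finite_subset[OF _ assms]) auto
  then have "eventually (\<lambda>s. \<forall>j\<in>J \<inter> {..<t}. j < s) (at_left t)"
    by (simp add: eventually_ball_finite_distrib)
       (auto simp: eventually_at_left_field intro: exI)
  moreover have "eventually (\<lambda>s. s < t) (at_left t)"
    by (auto simp: eventually_at_left_field intro: exI[of _ "t - 1"])
  ultimately show ?thesis
  proof eventually_elim
    case (elim s)
    have "j \<notin> {s<..<t}" if "j \<in> J" for j
    proof
      assume j: "j \<in> {s<..<t}"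
      then have "j \<in> J \<inter> {..<t}" using that by simp
      with elim have "j < s" by blast
      with j show False by simp
    qed
    with elim show ?case by blast
  qed
qed

lemma eventually_at_left_nonneg: "0 < (t::real) \<Longrightarrow> eventually (\<lambda>s. 0 \<le> s) (at_left t)"
  by (auto simp: eventually_at_left_field intro: exI[of _ 0])

lemma eventually_at_right_nonneg: "0 \<le> (t::real) \<Longrightarrow> eventually (\<lambda>s. 0 \<le> s) (at_right t)"
  by (auto simp: eventually_at_right_field intro: exI[of _ "t + 1"])

text \<open>Only finitely many jump times lie below any bound, so the path is constant just after
  and just before each time. Irregular configurations are covered by their constant path, so the
  property holds for every outcome.\<close>

lemma cadlag_Lambda_fin:
  assumes k: "1 \<le> k" and n: "1 \<le> n" and X: "X \<subseteq> T \<times> Lip k {1..}"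
    and l: "restrict l {1..n} \<in> partitions k {1..n}"
  shows "cadlag (partitions k {1..n}) (Lambda_fin k n X l)"
proof -
  note S = Lambda_fin_in[OF k n X l]
  have irr: ?thesis if "\<not> regular_points k X"
    using S unfolding cadlag_def has_left_limit_def
    by (auto simp: Lambda_fin_irregular[OF that] pdist_def intro!: bexI[OF _ l])
  have "cadlag (partitions k {1..n}) (Lambda_fin k n X l)" if reg: "regular_points k X"
    unfolding cadlag_def has_left_limit_def
  proof (intro conjI allI impI S)
    note fin = finite_jump_times[OF reg n]
    fix t :: real
    have "eventually (\<lambda>s. Lambda_fin k n X l s = Lambda_fin k n X l t) (at_right t)"
      using eventually_no_jump_right[OF fin] eventually_at_right_less[of t]
      by eventually_elim (auto intro: Lambda_fin_no_jump)
    then show "((\<lambda>s. pdist (Lambda_fin k n X l s) (Lambda_fin k n X l t)) \<longlongrightarrow> 0) (at_right t)"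
      using S by (subst tendsto_pdist_iff) auto
    obtain b where b: "b < t" "jump_times k n X \<inter> {b<..<t} = {}"
      using eventually_happens[OF eventually_no_jump_left[OF fin, of t]] by auto
    have "eventually (\<lambda>s. b < s \<and> s < t) (at_left t)"
      using b by (auto simp: eventually_at_left_field)
    then have "eventually (\<lambda>s. Lambda_fin k n X l s = Lambda_fin k n X l b) (at_left t)"
    proof eventually_elim
      case (elim s)
      then have "{b<..s} \<subseteq> {b<..<t}" by auto
      with b elim show ?case by (intro Lambda_fin_no_jump) auto
    qed
    then show "\<exists>y\<in>partitions k {1..n}. ((\<lambda>s. pdist (Lambda_fin k n X l s) y) \<longlongrightarrow> 0) (at_left t)"
      using S by (intro bexI[of _ "Lambda_fin k n X l b"]) (subst tendsto_pdist_iff, auto)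
  qed
  with irr show ?thesis by blast
qed

lemma jump_rule_Lambda_fin:
  assumes k: "1 \<le> k" and n: "1 \<le> n" and X: "X \<subseteq> T \<times> Lip k {1..}"
    and l: "restrict l {1..n} \<in> partitions k {1..n}" and reg: "regular_points k X"
  shows "jump_rule k n X l (Lambda_fin k n X l)"
  unfolding jump_rule_def
proof (intro conjI allI impI Lambda_fin_0)
  note S = Lambda_fin_in[OF k n X l]
  fix t :: real assume t: "0 < t"
  let ?J = "jump_times k n X"
  \<comment> \<open>No jump lies strictly between \<open>b\<close> and \<open>t\<close>, so the
    value at \<open>b\<close> is the left limit at \<open>t\<close>; a jump at \<open>t\<close>
    itself is then the only one in \<open>{b<..t}\<close>.\<close>
  obtain b where b: "b < t" "?J \<inter> {b<..<t} = {}"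
    using eventually_happens[OF eventually_no_jump_left[OF finite_jump_times[OF reg n], of t]] by auto
  let ?y = "Lambda_fin k n X l b"
  have "eventually (\<lambda>s. b < s \<and> s < t) (at_left t)"
    using b by (auto simp: eventually_at_left_field)
  then have "eventually (\<lambda>s. Lambda_fin k n X l s = ?y) (at_left t)"
  proof eventually_elim
    case (elim s)
    then have "{b<..s} \<subseteq> {b<..<t}" by auto
    with b elim show ?case by (intro Lambda_fin_no_jump) auto
  qed
  then have "has_left_limit (Lambda_fin k n X l) t ?y"
    using S unfolding has_left_limit_def by (subst tendsto_pdist_iff) auto
  moreover have "Lambda_fin k n X l t = (if t \<in> ?J then map_restr k n (atom_at X t) ?y else ?y)"
  proof (cases "t \<in> ?J")
    case True
    then have "?J \<inter> {b<..t} = {t}" using b by fastforce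
    from Lambda_fin_jump[OF reg n this] True show ?thesis by simp
  next
    case False
    then have "?J \<inter> {b<..t} = {}" using b by (fastforce simp: order_less_le)
    with b False show ?thesis using Lambda_fin_no_jump[of b t] by simp
  qed
  ultimately show "\<exists>y\<in>partitions k {1..n}. has_left_limit (Lambda_fin k n X l) t y \<and>
      Lambda_fin k n X l t = (if t \<in> ?J then map_restr k n (atom_at X t) y else y)"
    using S by blast
qed

text \<open>Two solutions cannot separate for the first time: not at a jump, because their left limits
  agree there, and not right after a time of agreement, because both are constant for a while.\<close>

lemma jump_rule_unique:
  assumes x: "cadlag (partitions k {1..n}) x" "jump_rule k n X l x"
    and y: "cadlag (partitions k {1..n}) y" "jump_rule k n X l y"
    and t: "0 \<le> t"
  shows "x t = y t"
proof (rule ccontr)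
  assume neq: "x t \<noteq> y t"
  let ?P = "partitions k {1..n}"
  let ?E = "{s. 0 \<le> s \<and> x s \<noteq> y s}"
  define T where "T = Inf ?E"
  have ne: "?E \<noteq> {}" using t neq by auto
  have bdd: "bdd_below ?E" by (rule bdd_belowI[of _ 0]) simp
  have T0: "0 \<le> T" unfolding T_def by (rule cInf_greatest[OF ne]) simp
  have agree: "x s = y s" if "0 \<le> s" "s < T" for s
    using that cInf_lower[OF _ bdd, of s] unfolding T_def by force
  have "x T = y T"
  proof (cases "T = 0")
    case True
    then show ?thesis using x(2) y(2) by (simp add: jump_rule_def)
  next
    case False
    with T0 have T: "0 < T" by simp
    have lim: "eventually (\<lambda>s. z s = l) (at_left T)"
      if "cadlag ?P z" "l \<in> ?P" "has_left_limit z T l" for z l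
    proof -
      have "eventually (\<lambda>s. z s \<in> ?P) (at_left T)"
        using eventually_at_left_nonneg[OF T] that(1) unfolding cadlag_def
        by (auto elim: eventually_mono)
      from tendsto_pdist_iff[OF this that(2)] that(3) show ?thesis
        by (simp add: has_left_limit_def)
    qed
    obtain lx where lx: "lx \<in> ?P" "has_left_limit x T lx"
      "x T = (if T \<in> jump_times k n X then map_restr k n (atom_at X T) lx else lx)"
      using x(2) T unfolding jump_rule_def by blast
    obtain ly where ly: "ly \<in> ?P" "has_left_limit y T ly"
      "y T = (if T \<in> jump_times k n X then map_restr k n (atom_at X T) ly else ly)"
      using y(2) T unfolding jump_rule_def by blast
    have "eventually (\<lambda>s. s < T) (at_left T)"
      by (auto simp: eventually_at_left_field intro: exI[of _ "T - 1"])
    with lim[OF x(1) lx(1,2)] lim[OF y(1) ly(1,2)] eventually_at_left_nonneg[OF T]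
    have "eventually (\<lambda>s. lx = ly) (at_left T)"
      by eventually_elim (use agree in auto)
    then have "lx = ly" by simp
    then show ?thesis using lx ly by simp
  qed
  have right: "eventually (\<lambda>s. z s = z T) (at_right T)" if "cadlag ?P z" for z
  proof -
    have "eventually (\<lambda>s. z s \<in> ?P) (at_right T)"
      using eventually_at_right_nonneg[OF T0] that unfolding cadlag_def
      by (auto elim: eventually_mono)
    from tendsto_pdist_iff[OF this, of "z T"] that T0 show ?thesis
      by (auto simp: cadlag_def)
  qed
  have "eventually (\<lambda>s. x s = y s) (at_right T)"
    using right[OF x(1)] right[OF y(1)] by eventually_elim (use \<open>x T = y T\<close> in simp)
  then obtain b where b: "T < b" "\<And>s. T < s \<Longrightarrow> s < b \<Longrightarrow> x s = y s"
    by (auto simp: eventually_at_right_field)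
  have "b \<le> T"
    unfolding T_def
  proof (rule cInf_greatest[OF ne])
    fix s assume "s \<in> ?E"
    then have "\<not> s < T" "s \<noteq> T" "\<not> (T < s \<and> s < b)"
      using agree \<open>x T = y T\<close> b by auto
    then show "b \<le> s" by linarith
  qed
  with b show False by simp
qed

section \<open>Markov processes from finite-dimensional distributions\<close>

text \<open>The kernel is the law of \<open>Z t x\<close>, a family of processes with deterministic
  starts on the same space; in the hypotheses \<open>Z\<close> is evaluated at a separate outcome
  \<open>\<omega>'\<close>, so only its laws enter. It suffices to test finitely many past times and
  sets of the generator \<open>G\<close>. The extension to all sets goes in two rounds: first in the
  future set with a past event fixed, then in the past event with the future set fixed.\<close>

lemma (in prob_space) markov_processI:
  fixes S :: "'s measure" and Y :: "real \<Rightarrow> 'a \<Rightarrow> 's" and Z :: "real \<Rightarrow> 's \<Rightarrow> 'a \<Rightarrow> 's"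
  assumes G: "sets S = sigma_sets (space S) G" "Int_stable G" "G \<subseteq> Pow (space S)" "space S \<in> G"
    and Z: "\<And>t x. 0 \<le> t \<Longrightarrow> x \<in> space S \<Longrightarrow> Z t x \<in> M \<rightarrow>\<^sub>M S"
    and Z_kernel: "\<And>t A. 0 \<le> t \<Longrightarrow> A \<in> G \<Longrightarrow>
      (\<lambda>x. emeasure M {\<omega>\<in>space M. Z t x \<omega> \<in> A}) \<in> borel_measurable S"
    and Z_0: "\<And>x \<omega>. x \<in> space S \<Longrightarrow> \<omega> \<in> space M \<Longrightarrow> Z 0 x \<omega> = x"
    and Z_flow: "\<And>s t x A. 0 \<le> s \<Longrightarrow> 0 \<le> t \<Longrightarrow> x \<in> space S \<Longrightarrow> A \<in> G \<Longrightarrow>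
      emeasure M {\<omega>\<in>space M. Z (s + t) x \<omega> \<in> A} =
      (\<integral>\<^sup>+\<omega>. emeasure M {\<omega>'\<in>space M. Z t (Z s x \<omega>) \<omega>' \<in> A} \<partial>M)"
    and Y: "\<And>t. 0 \<le> t \<Longrightarrow> Y t \<in> M \<rightarrow>\<^sub>M S"
    and Y_markov: "\<And>s t U B A. 0 \<le> s \<Longrightarrow> 0 \<le> t \<Longrightarrow> finite U \<Longrightarrow> U \<subseteq> {0..s} \<Longrightarrow>
      (\<And>u. u \<in> U \<Longrightarrow> B u \<in> G) \<Longrightarrow> A \<in> G \<Longrightarrow>
      emeasure M {\<omega>\<in>space M. (\<forall>u\<in>U. Y u \<omega> \<in> B u) \<and> Y (s + t) \<omega> \<in> A} =
      (\<integral>\<^sup>+\<omega>. indicator {\<omega>\<in>space M. \<forall>u\<in>U. Y u \<omega> \<in> B u} \<omega> *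
         emeasure M {\<omega>'\<in>space M. Z t (Y s \<omega>) \<omega>' \<in> A} \<partial>M)"
  shows "markov_process M S Y"
proof -
  define p where "p = (\<lambda>t x. distr M S (Z t x))"
  have GS: "A \<in> sets S" if "A \<in> G" for A using that G(1) by auto
  have p_emeasure: "emeasure (p t x) A = emeasure M {\<omega>\<in>space M. Z t x \<omega> \<in> A}"
    if "0 \<le> t" "x \<in> space S" "A \<in> sets S" for t x A
    using that Z[of t x] by (simp add: p_def emeasure_distr vimage_def Int_def conj_commute)
  have p_prob: "p t \<in> S \<rightarrow>\<^sub>M prob_algebra S" if t: "0 \<le> t" for t
  proof (rule measurable_prob_algebra_generated[OF G(1-3)])
    show "(\<lambda>x. emeasure (p t x) A) \<in> borel_measurable S" if "A \<in> G" for A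
      using Z_kernel[OF t that] p_emeasure[OF t _ GS[OF that]] by (simp cong: measurable_cong)
  qed (use t Z in \<open>auto simp: p_def intro: prob_space_distr\<close>)
  have p_subprob: "p t \<in> S \<rightarrow>\<^sub>M subprob_algebra S" if "0 \<le> t" for t
    using p_prob[OF that] by (rule measurable_prob_algebraD)
  have p_meas: "(\<lambda>x. emeasure (p t x) A) \<in> borel_measurable S" if "0 \<le> t" "A \<in> sets S" for t A
    using measurable_emeasure_subprob_algebra[OF that(2)] p_subprob[OF that(1)]
    by (rule measurable_compose[rotated])
  have p_psp: "prob_space (p t x)" if "0 \<le> t" "x \<in> space S" for t x
    using Z[OF that] unfolding p_def by (rule prob_space_distr)
  have sets_p[simp]: "sets (p t x) = sets S" "space (p t x) = space S" for t x
    by (simp_all add: p_def)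

  have transition: "transition_function S p"
    unfolding transition_function_def
  proof (intro conjI allI impI ballI p_prob)
    fix x assume x: "x \<in> space S"
    show "p 0 x = return S x"
    proof (rule measure_eqI)
      fix A assume "A \<in> sets (p 0 x)"
      then have A: "A \<in> sets S" by simp
      have "{\<omega>\<in>space M. Z 0 x \<omega> \<in> A} = (if x \<in> A then space M else {})"
        using Z_0[OF x] by auto
      then show "emeasure (p 0 x) A = emeasure (return S x) A"
        using p_emeasure[OF order_refl x A] A by (simp add: emeasure_space_1)
    qed simp
  next
    fix s t :: real and x assume s: "0 \<le> s" and t: "0 \<le> t" and x: "x \<in> space S"
    have ne: "space (p s x) \<noteq> {}" using x by auto
    have K: "p t \<in> measurable (p s x) (subprob_algebra S)"
      using p_subprob[OF t] by (simp cong: measurable_cong_sets)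
    show "p (s + t) x = p s x \<bind> p t"
    proof (rule measure_eqI_generator_eq[OF G(2,3), where A = "\<lambda>_. space S"])
      fix A assume A: "A \<in> G"
      have "emeasure (p s x \<bind> p t) A = (\<integral>\<^sup>+y. emeasure (p t y) A \<partial>p s x)"
        by (rule emeasure_bind[OF ne K GS[OF A]])
      also have "\<dots> = (\<integral>\<^sup>+\<omega>. emeasure (p t (Z s x \<omega>)) A \<partial>M)"
        using Z[OF s x] p_meas[OF t GS[OF A]] by (simp add: p_def[of ] nn_integral_distr)
      also have "\<dots> = (\<integral>\<^sup>+\<omega>. emeasure M {\<omega>'\<in>space M. Z t (Z s x \<omega>) \<omega>' \<in> A} \<partial>M)"
        using measurable_space[OF Z[OF s x]] p_emeasure[OF t _ GS[OF A]]
        by (intro nn_integral_cong) auto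
      also have "\<dots> = emeasure (p (s + t) x) A"
        using Z_flow[OF s t x A] p_emeasure[OF _ x GS[OF A]] s t by simp
      finally show "emeasure (p (s + t) x) A = emeasure (p s x \<bind> p t) A" ..
    next
      show "sets (p s x \<bind> p t) = sigma_sets (space S) G"
        using ne G(1) by (subst sets_bind[where N = S]) auto
      show "emeasure (p (s + t) x) (space S) \<noteq> \<infinity>" for i :: nat
        using prob_space.emeasure_space_1[OF p_psp[OF _ x, of "s + t"]] s t by simp
    qed (use G in auto)
  qed

  have cond: "AE \<omega> in M. real_cond_exp M (natural_filtration M S Y s)
      (indicator {\<omega>' \<in> space M. Y (s + t) \<omega>' \<in> A}) \<omega> = measure (p t (Y s \<omega>)) A"
    if s: "0 \<le> s" and t: "0 \<le> t" and A: "A \<in> sets S" for s t A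
  proof -
    define F where "F = natural_filtration M S Y s"
    \<comment> \<open>The generator \<open>Q\<close> of the filtration constrains one time only and
      need not be closed under intersection. \<open>P\<close> allows finitely many times, generates
      the same sigma-field and is intersection-stable.\<close>
    define P where "P = {{\<omega>\<in>space M. \<forall>u\<in>U. Y u \<omega> \<in> B u} | U B.
      finite U \<and> U \<subseteq> {0..s} \<and> (\<forall>u\<in>U. B u \<in> G)}"
    define Q where "Q = {Y u -` A \<inter> space M | u A. 0 \<le> u \<and> u \<le> s \<and> A \<in> sets S}"
    have Q_pow: "Q \<subseteq> Pow (space M)" and P_pow: "P \<subseteq> Pow (space M)" by (auto simp: Q_def P_def)
    have F: "sets F = sigma_sets (space M) Q" "space F = space M"
      using Q_pow unfolding F_def natural_filtration_def Q_def[symmetric] by auto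
    have QM: "Q \<subseteq> sets M"
      using Y by (auto simp: Q_def)
    have Y_F: "Y u \<in> F \<rightarrow>\<^sub>M S" if "0 \<le> u" "u \<le> s" for u
    proof (rule measurableI)
      show "Y u \<omega> \<in> space S" if "\<omega> \<in> space F" for \<omega>
        using measurable_space[OF Y[OF \<open>0 \<le> u\<close>]] that F by simp
      show "Y u -` B \<inter> space F \<in> sets F" if "B \<in> sets S" for B
        using that \<open>0 \<le> u\<close> \<open>u \<le> s\<close> unfolding F by (intro sigma_sets.Basic) (auto simp: Q_def)
    qed
    have PF: "P \<subseteq> sets F"
    proof
      fix E assume "E \<in> P"
      then obtain U B where E: "E = {\<omega>\<in>space M. \<forall>u\<in>U. Y u \<omega> \<in> B u}" "finite U" "U \<subseteq> {0..s}"
        "\<forall>u\<in>U. B u \<in> G" by (auto simp: P_def)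
      have "{\<omega>\<in>space F. Y u \<omega> \<in> B u} \<in> sets F" if "u \<in> U" for u
      proof -
        have "u \<in> {0..s}" "B u \<in> G" using E that by auto
        then show ?thesis
          using measurable_sets[OF Y_F, of u "B u"] GS by (simp add: vimage_def Int_def conj_commute)
      qed
      then show "E \<in> sets F"
        unfolding E(1) F(2)[symmetric] using E(2) by (intro sets.sets_Collect_finite_All) auto
    qed
    have sets_F: "sets F = sigma_sets (space M) P"
    proof
      show "sigma_sets (space M) P \<subseteq> sets F"
        using sets.sigma_sets_subset[OF PF] F(2) by simp
      let ?N = "sigma (space M) P"
      have N: "sets ?N = sigma_sets (space M) P" "space ?N = space M" using P_pow by auto
      have "Q \<subseteq> sets ?N"
      proof
        fix E assume "E \<in> Q"
        then obtain u B where E: "E = Y u -` B \<inter> space M" "0 \<le> u" "u \<le> s" "B \<in> sets S"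
          by (auto simp: Q_def)
        have "Y u \<in> ?N \<rightarrow>\<^sub>M S"
        proof (rule measurable_sigma_sets[OF G(1,3)])
          show "Y u \<in> space ?N \<rightarrow> space S" using measurable_space[OF Y[OF E(2)]] N by auto
          show "Y u -` A \<inter> space ?N \<in> sets ?N" if "A \<in> G" for A
            unfolding N using that E
            by (intro sigma_sets.Basic) (auto simp: P_def intro!: exI[of _ "{u}"] exI[of _ "\<lambda>_. A"])
        qed
        then show "E \<in> sets ?N" using E(1,4) N(2) by (metis measurable_sets)
      qed
      then show "sets F \<subseteq> sigma_sets (space M) P"
        unfolding F(1) N(1)[symmetric] using sets.sigma_sets_subset[of Q ?N] N(2) by simp
    qed
    have P_stable: "Int_stable P"
      unfolding Int_stable_def
    proof safe
      fix E E' assume "E \<in> P" "E' \<in> P"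
      then obtain U B U' B' where E: "E = {\<omega>\<in>space M. \<forall>u\<in>U. Y u \<omega> \<in> B u}" "finite U" "U \<subseteq> {0..s}"
        "\<forall>u\<in>U. B u \<in> G" "E' = {\<omega>\<in>space M. \<forall>u\<in>U'. Y u \<omega> \<in> B' u}" "finite U'" "U' \<subseteq> {0..s}"
        "\<forall>u\<in>U'. B' u \<in> G" by (auto simp: P_def)
      \<comment> \<open>Times constrained by only one of the two events get the full space from the
        other; this is where \<open>space S \<in> G\<close> enters.\<close>
      define C where "C = (\<lambda>u. (if u \<in> U then B u else space S) \<inter> (if u \<in> U' then B' u else space S))"
      have "C u \<in> G" for u
        unfolding C_def using E G(4) G(2) by (auto simp: Int_stable_def)
      moreover have "E \<inter> E' = {\<omega>\<in>space M. \<forall>u\<in>U\<union>U'. Y u \<omega> \<in> C u}"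
      proof -
        have "Y u \<omega> \<in> space S" if "\<omega> \<in> space M" "u \<in> U \<union> U'" for u \<omega>
          using measurable_space[OF Y] that E by (meson UnE atLeastAtMost_iff subsetD)
        then show ?thesis by (auto simp: E C_def)
      qed
      ultimately show "E \<inter> E' \<in> P"
        unfolding P_def using E by (intro CollectI exI[of _ "U \<union> U'"] exI[of _ C]) auto
    qed
    have FM: "subalgebra M F"
      unfolding subalgebra_def F using sets.sigma_sets_subset[OF QM] by simp
    have id_F: "(\<lambda>x. x) \<in> M \<rightarrow>\<^sub>M F"
      using FM by (auto simp: subalgebra_def measurable_def) 
    interpret F: sigma_finite_subalgebra M F
      by (rule finite_measure_subalgebra_is_sigma_finite) (unfold_locales, rule FM)
    have Ys: "Y s \<in> M \<rightarrow>\<^sub>M S" and Yst: "Y (s + t) \<in> M \<rightarrow>\<^sub>M S" using Y s t by auto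
    have A_M: "{\<omega>\<in>space M. Y (s + t) \<omega> \<in> A} \<in> sets M"
      using measurable_sets[OF Yst A] by (simp add: vimage_def Int_def conj_commute)
    have kernel_M: "(\<lambda>\<omega>. emeasure (p t (Y s \<omega>)) A) \<in> borel_measurable M" if "A \<in> sets S" for A
      using p_meas[OF t that] Ys by (rule measurable_compose[rotated])
    have kernel_le: "emeasure (p t (Y s \<omega>)) A \<le> 1" if "\<omega> \<in> space M" for \<omega> A
      using prob_space.emeasure_le_1[OF p_psp[OF t]] measurable_space[OF Ys that] by blast

    have step1: "emeasure M {\<omega>\<in>space M. \<omega> \<in> E \<and> Y (s + t) \<omega> \<in> A} =
      (\<integral>\<^sup>+\<omega>. indicator E \<omega> * emeasure (p t (Y s \<omega>)) A \<partial>M)" if "E \<in> P" for E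
    proof -
      have E: "E \<in> sets M" using that PF FM by (auto simp: subalgebra_def)
      let ?D = "density M (indicator E)"
      \<comment> \<open>With \<open>E\<close> fixed, both sides are finite measures in the future
        set \<open>A\<close>: the law of \<open>Y (s + t)\<close> on \<open>E\<close>, and the law
        of \<open>Y s\<close> on \<open>E\<close> pushed through the kernel. The hypothesis
        \<open>Y_markov\<close> says that they agree on \<open>G\<close>.\<close>
      let ?N1 = "distr ?D S (Y (s + t))" and ?N2 = "distr ?D S (Y s) \<bind> p t"
      have Ne: "space S \<noteq> {}" using not_empty measurable_space[OF Ys] by blast
      have N1: "emeasure ?N1 A = emeasure M {\<omega>\<in>space M. \<omega> \<in> E \<and> Y (s + t) \<omega> \<in> A}"
        if "A \<in> sets S" for A
      proof -
        have "emeasure ?N1 A = (\<integral>\<^sup>+\<omega>. indicator E \<omega> * indicator (Y (s + t) -` A \<inter> space M) \<omega> \<partial>M)"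
          using that Yst E measurable_sets[OF Yst that]
          by (simp add: emeasure_distr emeasure_density)
        also have "\<dots> = (\<integral>\<^sup>+\<omega>. indicator (E \<inter> (Y (s + t) -` A \<inter> space M)) \<omega> \<partial>M)"
          by (simp add: indicator_inter_arith)
        also have "\<dots> = emeasure M (E \<inter> (Y (s + t) -` A \<inter> space M))"
          using E measurable_sets[OF Yst that] by (intro nn_integral_indicator) auto
        also have "E \<inter> (Y (s + t) -` A \<inter> space M) = {\<omega>\<in>space M. \<omega> \<in> E \<and> Y (s + t) \<omega> \<in> A}"
          by auto
        finally show ?thesis .
      qed
      have N2: "emeasure ?N2 A = (\<integral>\<^sup>+\<omega>. indicator E \<omega> * emeasure (p t (Y s \<omega>)) A \<partial>M)"
        if "A \<in> sets S" for A
      proof -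
        have "emeasure ?N2 A = (\<integral>\<^sup>+x. emeasure (p t x) A \<partial>distr ?D S (Y s))"
          using p_subprob[OF t] Ne that by (intro emeasure_bind) (simp_all cong: measurable_cong_sets)
        also have "\<dots> = (\<integral>\<^sup>+\<omega>. emeasure (p t (Y s \<omega>)) A \<partial>?D)"
          using Ys p_meas[OF t that] by (intro nn_integral_distr) (simp_all cong: measurable_cong_sets)
        also have "\<dots> = (\<integral>\<^sup>+\<omega>. indicator E \<omega> * emeasure (p t (Y s \<omega>)) A \<partial>M)"
          using E kernel_M[OF that] by (intro nn_integral_density) auto
        finally show ?thesis .
      qed
      have "?N1 = ?N2"
      proof (rule measure_eqI_generator_eq[OF G(2,3), where A = "\<lambda>_. space S"])
        fix A assume A: "A \<in> G"
        obtain U B where UB: "E = {\<omega>\<in>space M. \<forall>u\<in>U. Y u \<omega> \<in> B u}" "finite U" "U \<subseteq> {0..s}"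
          "\<And>u. u \<in> U \<Longrightarrow> B u \<in> G" using \<open>E \<in> P\<close> unfolding P_def by blast
        have "emeasure ?N2 A = (\<integral>\<^sup>+\<omega>. indicator E \<omega> * emeasure M {\<omega>'\<in>space M. Z t (Y s \<omega>) \<omega>' \<in> A} \<partial>M)"
          unfolding N2[OF GS[OF A]]
          using measurable_space[OF Ys] p_emeasure[OF t _ GS[OF A]] by (intro nn_integral_cong) auto
        also have "\<dots> = emeasure M {\<omega>\<in>space M. (\<forall>u\<in>U. Y u \<omega> \<in> B u) \<and> Y (s + t) \<omega> \<in> A}"
          unfolding UB(1) by (rule Y_markov[OF s t UB(2-4) A, symmetric])
        also have "\<dots> = emeasure ?N1 A"
          unfolding N1[OF GS[OF A]] by (rule arg_cong[where f = "emeasure M"]) (auto simp: UB)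
        finally show "emeasure ?N1 A = emeasure ?N2 A" ..
      next
        show "sets ?N2 = sigma_sets (space S) G"
          using Ne G(1) by (subst sets_bind[where N = S]) auto
        show "emeasure ?N1 (space S) \<noteq> \<infinity>" for i :: nat
          unfolding N1[OF sets.top] by simp
      qed (use G in auto)
      with N1[OF A] N2[OF A] show ?thesis by simp
    qed

    have step2: "emeasure M {\<omega>\<in>space M. \<omega> \<in> E \<and> Y (s + t) \<omega> \<in> A} =
      (\<integral>\<^sup>+\<omega>. indicator E \<omega> * emeasure (p t (Y s \<omega>)) A \<partial>M)" if "E \<in> sets F" for E
    proof -
      let ?A = "{\<omega>\<in>space M. Y (s + t) \<omega> \<in> A}"
      \<comment> \<open>Now \<open>A\<close> is fixed and the past event varies. Pushing forward
        along the identity restricts the two densities to the sub-sigma-field \<open>F\<close>, on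
        whose generator \<open>P\<close> they agree by \<open>step1\<close>.\<close>
      let ?N1 = "distr (density M (indicator ?A)) F (\<lambda>x. x)"
      let ?N2 = "distr (density M (\<lambda>\<omega>. emeasure (p t (Y s \<omega>)) A)) F (\<lambda>x. x)"
      have EM: "E \<in> sets M" if "E \<in> sets F" for E using that FM by (auto simp: subalgebra_def)
      have N1: "emeasure ?N1 E = emeasure M {\<omega>\<in>space M. \<omega> \<in> E \<and> Y (s + t) \<omega> \<in> A}"
        if "E \<in> sets F" for E
      proof -
        have sub: "E \<inter> space M = E" using sets.sets_into_space[OF that] F by auto
        have "emeasure ?N1 E = (\<integral>\<^sup>+\<omega>. indicator ?A \<omega> * indicator E \<omega> \<partial>M)"
          using that id_F A_M EM[OF that] sub by (simp add: emeasure_distr emeasure_density)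
        also have "\<dots> = (\<integral>\<^sup>+\<omega>. indicator (?A \<inter> E) \<omega> \<partial>M)"
          by (simp add: indicator_inter_arith)
        also have "\<dots> = emeasure M (?A \<inter> E)"
          using EM[OF that] A_M by (intro nn_integral_indicator) auto
        also have "?A \<inter> E = {\<omega>\<in>space M. \<omega> \<in> E \<and> Y (s + t) \<omega> \<in> A}"
          by auto
        finally show ?thesis .
      qed
      have N2: "emeasure ?N2 E = (\<integral>\<^sup>+\<omega>. indicator E \<omega> * emeasure (p t (Y s \<omega>)) A \<partial>M)"
        if "E \<in> sets F" for E
      proof -
        have sub: "E \<inter> space M = E" using sets.sets_into_space[OF that] F by auto
        show ?thesis
          using that id_F kernel_M[OF A] EM[OF that] sub
          by (simp add: emeasure_distr emeasure_density mult.commute)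
      qed
      have "space M \<in> P" unfolding P_def by (intro CollectI exI[of _ "{}"]) auto
      have "?N1 = ?N2"
      proof (rule measure_eqI_generator_eq[OF P_stable P_pow, where A = "\<lambda>_. space M"])
        fix E assume E: "E \<in> P"
        then have EF: "E \<in> sets F" using PF by blast
        show "emeasure ?N1 E = emeasure ?N2 E"
          unfolding N1[OF EF] N2[OF EF] by (rule step1[OF E])
      next
        have "space M \<in> sets F" using \<open>space M \<in> P\<close> PF by blast
        from N1[OF this] show "emeasure ?N1 (space M) \<noteq> \<infinity>" for i :: nat
          by simp
      qed (use sets_F \<open>space M \<in> P\<close> in auto)
      with N1[OF that] N2[OF that] show ?thesis by simp
    qed

    show ?thesis
      unfolding F_def[symmetric]
    proof (rule F.real_cond_exp_charact)
      have mp: "measure (p t (Y s \<omega>)) A = enn2real (emeasure (p t (Y s \<omega>)) A)" for \<omega>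
        by (simp add: measure_def)
      have g_F: "(\<lambda>\<omega>. measure (p t (Y s \<omega>)) A) \<in> borel_measurable F"
        unfolding mp
        by (intro borel_measurable_enn2real measurable_compose[OF Y_F p_meas] s t A) simp
      have g_M: "(\<lambda>\<omega>. measure (p t (Y s \<omega>)) A) \<in> borel_measurable M"
        by (rule measurable_from_subalg[OF FM g_F])
      show "(\<lambda>\<omega>. measure (p t (Y s \<omega>)) A) \<in> borel_measurable F" by (rule g_F)
      have le1: "measure (p t (Y s \<omega>)) A \<le> 1" if "\<omega> \<in> space M" for \<omega>
        using prob_space.prob_le_1[OF p_psp[OF t]] measurable_space[OF Ys that] by blast
      show "integrable M (\<lambda>\<omega>. measure (p t (Y s \<omega>)) A)"
        by (rule integrable_const_bound[where B = 1, OF _ g_M]) (auto intro!: AE_I2 le1)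
      show "integrable M (indicator {\<omega>' \<in> space M. Y (s + t) \<omega>' \<in> A} :: _ \<Rightarrow> real)"
        using A_M by (auto intro!: integrable_real_indicator emeasure_finite simp: less_top[symmetric])
      fix E assume E: "E \<in> sets F"
      then have EM: "E \<in> sets M" using FM by (auto simp: subalgebra_def)
      let ?A = "{\<omega>' \<in> space M. Y (s + t) \<omega>' \<in> A}"
      have "(\<integral>\<omega>\<in>E. indicat_real ?A \<omega> \<partial>M) = (\<integral>\<omega>. indicat_real (E \<inter> ?A) \<omega> \<partial>M)"
        by (simp add: set_lebesgue_integral_def indicator_inter_arith)
      also have "\<dots> = measure M (E \<inter> ?A)"
        using EM A_M by simp
      also have "E \<inter> ?A = {\<omega>\<in>space M. \<omega> \<in> E \<and> Y (s + t) \<omega> \<in> A}" by auto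
      also have "measure M \<dots> = enn2real (\<integral>\<^sup>+\<omega>. indicator E \<omega> * emeasure (p t (Y s \<omega>)) A \<partial>M)"
        using step2[OF E] by (simp add: measure_def)
      also have "(\<integral>\<^sup>+\<omega>. indicator E \<omega> * emeasure (p t (Y s \<omega>)) A \<partial>M) =
          (\<integral>\<^sup>+\<omega>. ennreal (indicator E \<omega> * measure (p t (Y s \<omega>)) A) \<partial>M)"
      proof (intro nn_integral_cong)
        fix \<omega> assume "\<omega> \<in> space M"
        from kernel_le[OF this, of A] have "emeasure (p t (Y s \<omega>)) A < \<top>"
          using ennreal_one_less_top order_le_less_trans by blast
        then show "indicator E \<omega> * emeasure (p t (Y s \<omega>)) A =
            ennreal (indicator E \<omega> * measure (p t (Y s \<omega>)) A)"
          by (simp add: mp indicator_def)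
      qed
      also have "enn2real \<dots> = (\<integral>\<omega>\<in>E. measure (p t (Y s \<omega>)) A \<partial>M)"
        unfolding set_lebesgue_integral_def real_scaleR_def
        using EM g_M by (intro integral_eq_nn_integral[symmetric]) auto
      finally show "(\<integral>\<omega>\<in>E. indicat_real ?A \<omega> \<partial>M) = (\<integral>\<omega>\<in>E. measure (p t (Y s \<omega>)) A \<partial>M)" .
    qed
  qed
  show ?thesis
    unfolding markov_process_def
    using Y transition cond by blast
qed

section \<open>Discretisation of the paths\<close>

text \<open>The hypothesis on \<open>image_measure\<close> says that \<open>\<phi>\<close> has
  finite mass on this set, hence that only finitely many points with such marks are expected in
  bounded time.\<close>

definition moving :: "nat \<Rightarrow> nat \<Rightarrow> colouring_map set" where
  "moving k n = {F \<in> Lip k {1..}. map_restr k n F \<noteq> Id_map k {1..n}}"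

lemma moving_mono: "1 \<le> k \<Longrightarrow> m \<le> n \<Longrightarrow> moving k m \<subseteq> moving k n"
  unfolding moving_def using map_restr_eq_Id_mono by blast

lemma finite_separated:
  assumes "finite (D :: real set)"
  obtains d where "0 < d" "\<And>s t. s \<in> D \<Longrightarrow> t \<in> D \<Longrightarrow> \<bar>s - t\<bar> < d \<Longrightarrow> s = t"
proof
  \<comment> \<open>The extra \<open>1\<close> keeps \<open>Min\<close> meaningful and positive when
    \<open>D\<close> has at most one element.\<close>
  let ?G = "insert 1 ((\<lambda>(s, t). \<bar>s - t\<bar>) ` {(s, t). s \<in> D \<and> t \<in> D \<and> s \<noteq> t})"
  have "finite {(s, t). s \<in> D \<and> t \<in> D \<and> s \<noteq> t}"
    by (rule finite_subset[of _ "D \<times> D"]) (use assms in auto)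
  then have fin: "finite ?G" by simp
  show "0 < Min ?G" using fin by (subst Min_gr_iff) auto
  show "s = t" if st: "s \<in> D" "t \<in> D" "\<bar>s - t\<bar> < Min ?G" for s t
  proof (rule ccontr)
    assume "s \<noteq> t"
    then have "\<bar>s - t\<bar> \<in> ?G" using st by (intro insertI2 image_eqI[of _ _ "(s, t)"]) auto
    from Min_le[OF fin this] st(3) show False by simp
  qed
qed

lemma ex_grid_cell:
  assumes "0 \<le> t" "t < T"
  obtains i where "i \<le> m" "real i * T / real (Suc m) \<le> t" "t < real (Suc i) * T / real (Suc m)"
proof -
  define i where "i = nat \<lfloor>t * real (Suc m) / T\<rfloor>"
  have T: "0 < T" using assms by linarith
  have nn: "0 \<le> t * real (Suc m) / T" using assms T by simp
  then have i: "real i \<le> t * real (Suc m) / T" "t * real (Suc m) / T < real i + 1"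
    unfolding i_def by linarith+
  have "t * real (Suc m) / T < real (Suc m)" using assms T by (simp add: divide_less_eq)
  then have "real i < real (Suc m)" using i by linarith
  then have "i \<le> m" by simp
  moreover have "real i * T / real (Suc m) \<le> t" "t < real (Suc i) * T / real (Suc m)"
    using i T by (auto simp: field_simps)
  ultimately show ?thesis using that by blast
qed

text \<open>These cells are closed on the left, because regularity also concerns points at time
  \<open>0\<close>. The cells for the dynamics are \<open>{a<..b}\<close> instead: a jump at
  \<open>b\<close> is already performed at time \<open>b\<close>, and a point at time
  \<open>0\<close> causes no jump.\<close>

definition grid_cell :: "nat \<Rightarrow> nat \<Rightarrow> nat \<Rightarrow> real set" where
  "grid_cell T m i = {real i * real T / real (Suc m) ..< real (Suc i) * real T / real (Suc m)}"

text \<open>This description of regularity only mentions the numbers of points in countably many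
  measurable sets.\<close>

lemma regular_points_iff:
  assumes k: "1 \<le> k" and X: "X \<subseteq> {0..} \<times> Lip k {1..}"
  shows "regular_points k X \<longleftrightarrow> X \<inter> {0..} \<times> {Id_map k {1..}} = {} \<and>
    (\<forall>n\<ge>1. \<forall>T. \<exists>m. \<forall>i\<le>m. \<forall>p\<in>X \<inter> grid_cell T m i \<times> moving k n.
      \<forall>q\<in>X \<inter> grid_cell T m i \<times> moving k n. p = q)" (is "_ \<longleftrightarrow> ?I \<and> ?G")
proof
  assume reg: "regular_points k X"
  have ?I using reg unfolding regular_points_def by auto
  moreover have ?G
  proof (intro allI impI)
    fix n T :: nat assume n: "1 \<le> n"
    \<comment> \<open>Points at time \<open>0\<close> are not jump times but may lie in the first
      cell, so \<open>0\<close> must be separated from the jump times as well.\<close>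
    let ?D = "insert 0 (jump_times k n X \<inter> {..real T})"
    obtain d where d: "0 < d" "\<And>s t. s \<in> ?D \<Longrightarrow> t \<in> ?D \<Longrightarrow> \<bar>s - t\<bar> < d \<Longrightarrow> s = t"
      using finite_separated[of ?D] finite_jump_times[OF reg n] by auto
    obtain m where m: "real T / d < real m" using reals_Archimedean2 by blast
    then have "real T / d < real (Suc m)" by simp
    then have m: "real T / real (Suc m) < d"
      using d by (simp add: field_simps)
    show "\<exists>m. \<forall>i\<le>m. \<forall>p\<in>X \<inter> grid_cell T m i \<times> moving k n.
      \<forall>q\<in>X \<inter> grid_cell T m i \<times> moving k n. p = q"
    proof (intro exI[of _ m] allI impI ballI)
      fix i p q assume i: "i \<le> m" and p: "p \<in> X \<inter> grid_cell T m i \<times> moving k n"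
        and q: "q \<in> X \<inter> grid_cell T m i \<times> moving k n"
      have D: "fst p \<in> ?D" if p: "p \<in> X \<inter> grid_cell T m i \<times> moving k n" for p
      proof -
        obtain s F where sF: "p = (s, F)" "(s, F) \<in> X" "s \<in> grid_cell T m i" "F \<in> moving k n"
          using p by auto
        have "real (Suc i) * real T / real (Suc m) \<le> real T"
          using mult_right_mono[of "real (Suc i)" "real (Suc m)" "real T"] i
          by (simp add: divide_le_eq mult.commute del: of_nat_Suc)
        then have "s \<le> real T" using sF(3) by (simp add: grid_cell_def)
        moreover have "0 \<le> s" using X sF by auto
        ultimately show ?thesis
          using sF by (cases "s = 0") (auto simp: jump_times_def moving_def)
      qed
      have "\<bar>fst p - fst q\<bar> < real (Suc i) * real T / real (Suc m) - real i * real T / real (Suc m)"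
        using p q by (auto simp: grid_cell_def)
      also have "\<dots> = real T / real (Suc m)"
        by (simp add: diff_divide_distrib[symmetric] left_diff_distrib[symmetric])
      also have "\<dots> < d" by (rule m)
      finally have "fst p = fst q" using d(2) D p q by blast
      then show "p = q"
        using reg p q unfolding regular_points_def by (cases p, cases q) auto
    qed
  qed
  ultimately show "?I \<and> ?G" ..
next
  assume IG: "?I \<and> ?G"
  show "regular_points k X"
    unfolding regular_points_def
  proof (intro conjI allI impI)
    show nId: "(t, Id_map k {1..}) \<notin> X" for t
    proof
      assume "(t, Id_map k {1..}) \<in> X"
      then have "(t, Id_map k {1..}) \<in> X \<inter> {0..} \<times> {Id_map k {1..}}" using X by auto
      with IG show False by simp
    qed
    have mov: "\<exists>n\<ge>1. F \<in> moving k n" if "(t, F) \<in> X" for t F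
    proof (rule ccontr)
      assume no: "\<not> (\<exists>n\<ge>1. F \<in> moving k n)"
      have F: "F \<in> Lip k {1..}" using that X by auto
      then have "map_restr k n F = Id_map k {1..n}" if "1 \<le> n" for n
        using no that by (auto simp: moving_def)
      then have "F = Id_map k {1..}" by (rule Lip_eq_IdI[OF F])
      with that nId show False by simp
    qed
    show "F = G" if FG: "(t, F) \<in> X" "(t, G) \<in> X" for t F G
    proof -
      obtain n1 n2 where n: "1 \<le> n1" "F \<in> moving k n1" "1 \<le> n2" "G \<in> moving k n2"
        using mov FG by metis
      \<comment> \<open>Each of the two maps moves at its own level. At the larger level both are
        counted in the same cell, which holds at most one point.\<close>
      define n where "n = max n1 n2"
      have n: "1 \<le> n" "F \<in> moving k n" "G \<in> moving k n"
        using n moving_mono[OF k, of n1 n] moving_mono[OF k, of n2 n] by (auto simp: n_def)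
      obtain T where T: "t < real T" using reals_Archimedean2 by blast
      obtain m where m: "\<And>i p q. i \<le> m \<Longrightarrow> p\<in>X \<inter> grid_cell T m i \<times> moving k n \<Longrightarrow>
          q\<in>X \<inter> grid_cell T m i \<times> moving k n \<Longrightarrow> p = q"
        using IG n(1) by meson
      have "0 \<le> t" using X FG by auto
      then obtain i where "i \<le> m" "real i * real T / real (Suc m) \<le> t"
        "t < real (Suc i) * real T / real (Suc m)"
        using T by (rule ex_grid_cell)
      then have "(t, F) = (t, G)"
        using FG n by (intro m[of i]) (auto simp: grid_cell_def)
      then show "F = G" by simp
    qed
    show "finite (jump_times k n X \<inter> {..t})" if n: "1 \<le> n" for n t
    proof -
      obtain T where T: "t < real T" using reals_Archimedean2 by blast
      obtain m where m: "\<And>i p q. i \<le> m \<Longrightarrow> p\<in>X \<inter> grid_cell T m i \<times> moving k n \<Longrightarrow>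
          q\<in>X \<inter> grid_cell T m i \<times> moving k n \<Longrightarrow> p = q"
        using IG n(1) by meson
      let ?C = "\<lambda>i. X \<inter> grid_cell T m i \<times> moving k n"
      have "finite (?C i)" if "i \<le> m" for i
      proof (cases "?C i = {}")
        case False
        then obtain p where "p \<in> ?C i" by blast
        then have "?C i \<subseteq> {p}" using m[OF that] by blast
        then show ?thesis by (rule finite_subset) simp
      qed simp
      then have "finite (\<Union>i\<le>m. fst ` ?C i)" by simp
      moreover have "jump_times k n X \<inter> {..t} \<subseteq> (\<Union>i\<le>m. fst ` ?C i)"
      proof
        fix s assume s: "s \<in> jump_times k n X \<inter> {..t}"
        then obtain F where F: "(s, F) \<in> X" "map_restr k n F \<noteq> Id_map k {1..n}" "0 < s"
          by (auto simp: jump_times_def)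
        have "s < real T" using s T by auto
        with F(3) obtain i where i: "i \<le> m" "real i * real T / real (Suc m) \<le> s"
          "s < real (Suc i) * real T / real (Suc m)"
          using ex_grid_cell[of s "real T"] by auto
        have "F \<in> moving k n" using F X by (auto simp: moving_def)
        then have "(s, F) \<in> ?C i" using i F by (auto simp: grid_cell_def)
        then show "s \<in> (\<Union>i\<le>m. fst ` ?C i)" using i(1) by force
      qed
      ultimately show ?thesis by (rule finite_subset[rotated])
    qed
  qed
qed

section \<open>Marks of time cells and the discretised path at a finite level\<close>

definition marks :: "nat \<Rightarrow> nat \<Rightarrow> colouring_map set" where
  "marks k n = Lip k {1..n} - {Id_map k {1..n}}"

text \<open>Numbering the nontrivial maps makes a cell carry a natural number, so one discrete state
  space serves all levels, and a least index singles out a map when several occur. Every index from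
  \<open>card (marks k n)\<close> on codes the identity.\<close>

definition mark :: "nat \<Rightarrow> nat \<Rightarrow> nat \<Rightarrow> colouring_map" where
  "mark k n j = (if j < card (marks k n) then from_nat_into (marks k n) j else Id_map k {1..n})"

definition marked :: "nat \<Rightarrow> nat \<Rightarrow> nat \<Rightarrow> colouring_map set" where
  "marked k n j = {F \<in> Lip k {1..}. j < card (marks k n) \<and> map_restr k n F = mark k n j}"

text \<open>The index of a jump in \<open>{a<..b}\<close>. The default value \<open>card (marks k n)\<close>, if there is
  none, is the index of the identity.\<close>

definition cell_mark :: "nat \<Rightarrow> nat \<Rightarrow> (real \<times> colouring_map) set \<Rightarrow> real \<Rightarrow> real \<Rightarrow> nat" where
  "cell_mark k n X a b =
     (LEAST j. X \<inter> {a<..b} \<times> marked k n j \<noteq> {} \<or> card (marks k n) \<le> j)"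

primrec iterate_maps :: "(nat \<Rightarrow> 's \<Rightarrow> 's) \<Rightarrow> (nat \<Rightarrow> nat) \<Rightarrow> 's \<Rightarrow> nat \<Rightarrow> 's" where
  "iterate_maps f c y 0 = y"
| "iterate_maps f c y (Suc i) = f (c i) (iterate_maps f c y i)"

text \<open>The state after \<open>i\<close> steps uses only the indices below \<open>i\<close>.
  Statements about the discretised past thus become predicates of a finite restricted
  family.\<close>

lemma iterate_maps_restrict:
  "i \<le> N \<Longrightarrow> iterate_maps f (restrict c {..<N}) y i = iterate_maps f c y i"
  by (induction i) auto

lemma iterate_maps_in:
  "(\<And>j v. v \<in> P \<Longrightarrow> f j v \<in> P) \<Longrightarrow> y \<in> P \<Longrightarrow> iterate_maps f c y i \<in> P"
  by (induction i) auto

lemma finite_marks: "finite (marks k n)"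
  unfolding marks_def using finite_Lip by blast

lemma bij_mark: "bij_betw (mark k n) {..<card (marks k n)} (marks k n)"
  using bij_betw_from_nat_into_finite[OF finite_marks]
  by (rule bij_betw_cong[THEN iffD1, rotated]) (simp add: mark_def)

lemma mark_in_Lip: "mark k n j \<in> Lip k {1..n}"
  using bij_betwE[OF bij_mark, of k n] Id_map_in_Lip unfolding mark_def marks_def by auto

lemma mark_in: "v \<in> partitions k {1..n} \<Longrightarrow> mark k n j v \<in> partitions k {1..n}"
  using Lip_in[OF mark_in_Lip] .

lemma marked_moving: "marked k n j \<subseteq> moving k n"
proof
  fix F assume F: "F \<in> marked k n j"
  then have "mark k n j \<in> marks k n" using bij_betwE[OF bij_mark] by (simp add: marked_def)
  with F show "F \<in> moving k n" by (simp add: marked_def moving_def marks_def)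
qed

lemma marked_inj: "F \<in> marked k n i \<Longrightarrow> F \<in> marked k n j \<Longrightarrow> i = j"
  using bij_betw_imp_inj_on[OF bij_mark, of k n] by (auto simp: marked_def inj_on_def)

lemma moving_imp_marked:
  assumes "1 \<le> k" "F \<in> moving k n"
  obtains j where "j < card (marks k n)" "F \<in> marked k n j" "mark k n j = map_restr k n F"
proof -
  have "map_restr k n F \<in> marks k n"
    using assms map_restr_in_Lip unfolding moving_def marks_def by auto
  then obtain j where "j < card (marks k n)" "mark k n j = map_restr k n F"
    using bij_betw_imp_surj_on[OF bij_mark, of k n] by (metis imageE lessThan_iff)
  then show ?thesis using that assms by (auto simp: marked_def moving_def)
qed

lemma cell_mark_no_jump:
  assumes "jump_times k n X \<inter> {a<..b} = {}" "0 \<le> a"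
  shows "cell_mark k n X a b = card (marks k n)"
proof -
  have "X \<inter> {a<..b} \<times> moving k n = {}"
  proof (rule equals0I)
    fix p assume "p \<in> X \<inter> {a<..b} \<times> moving k n"
    then obtain t F where "(t, F) \<in> X" "t \<in> {a<..b}" "F \<in> moving k n" by blast
    then have "t \<in> jump_times k n X \<inter> {a<..b}"
      using \<open>0 \<le> a\<close> by (auto simp: jump_times_def moving_def)
    with assms show False by blast
  qed
  then have "X \<inter> {a<..b} \<times> marked k n j = {}" for j
    using marked_moving[of k n j] by blast
  then show ?thesis unfolding cell_mark_def by (auto intro: Least_equality)
qed

text \<open>Regularity allows only one point at the time \<open>s\<close>, so exactly one box
  \<open>{a<..b} \<times> marked k n j\<close> is occupied and the least index is the true
  one.\<close>

lemma cell_mark_jump: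
  assumes k: "1 \<le> k" and reg: "regular_points k X" and X: "X \<subseteq> {0..} \<times> Lip k {1..}"
    and s: "jump_times k n X \<inter> {a<..b} = {s}" and a: "0 \<le> a"
  shows "mark k n (cell_mark k n X a b) = map_restr k n (atom_at X s)"
proof -
  have sJ: "s \<in> jump_times k n X" "a < s" "s \<le> b" using s by auto
  then obtain F where F: "(s, F) \<in> X" "atom_at X s = F" "0 < s" "map_restr k n F \<noteq> Id_map k {1..n}"
    using jump_timesE[OF reg] by blast
  have "F \<in> moving k n" using F X by (auto simp: moving_def)
  then obtain j where j: "j < card (marks k n)" "F \<in> marked k n j" "mark k n j = map_restr k n F"
    by (rule moving_imp_marked[OF k])
  have uniq: "i = j" if i: "X \<inter> {a<..b} \<times> marked k n i \<noteq> {}" for i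
  proof -
    obtain p where "p \<in> X \<inter> {a<..b} \<times> marked k n i" using i by (meson equals0I)
    then obtain u G where G: "(u, G) \<in> X" "u \<in> {a<..b}" "G \<in> marked k n i"
      by (elim IntE SigmaE) blast
    then have "map_restr k n G \<noteq> Id_map k {1..n}"
      using subsetD[OF marked_moving G(3)] by (simp add: moving_def)
    then have "u \<in> jump_times k n X" using G(1,2) a by (auto simp: jump_times_def)
    then have "u \<in> {s}" unfolding s[symmetric] using G(2) by simp
    then have "u = s" by simp
    then have "G = F" using atom_at_eq[OF reg] G(1) F(2) by simp
    then show "i = j" using marked_inj G(3) j(2) by simp
  qed
  have "cell_mark k n X a b = j"
    unfolding cell_mark_def
  proof (rule Least_equality)
    show "X \<inter> {a<..b} \<times> marked k n j \<noteq> {} \<or> card (marks k n) \<le> j"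
      using F(1) sJ j(2) by auto
    show "j \<le> i" if "X \<inter> {a<..b} \<times> marked k n i \<noteq> {} \<or> card (marks k n) \<le> i" for i
      using that uniq j(1) by auto
  qed
  then show ?thesis using j F by simp
qed

text \<open>As long as no cell contains two jumps, both dynamics do the same in each cell: nothing
  if it is free of jumps, otherwise the map of its only jump.\<close>

lemma iterate_cell_marks:
  assumes k: "1 \<le> k" and n: "1 \<le> n" and reg: "regular_points k X"
    and X: "X \<subseteq> {0..} \<times> Lip k {1..}" and y: "y \<in> partitions k {1..n}"
    and \<tau>0: "\<tau> 0 = 0" and mono: "\<And>i. \<tau> i \<le> \<tau> (Suc i)"
    and sep: "\<And>i s t. i < N \<Longrightarrow> s \<in> jump_times k n X \<inter> {\<tau> i<..\<tau> (Suc i)} \<Longrightarrow>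
      t \<in> jump_times k n X \<inter> {\<tau> i<..\<tau> (Suc i)} \<Longrightarrow> s = t"
  shows "i \<le> N \<Longrightarrow> iterate_maps (mark k n) (\<lambda>i. cell_mark k n X (\<tau> i) (\<tau> (Suc i))) y i =
    Lambda_fin k n X y (\<tau> i)"
proof (induction i)
  case 0
  then show ?case using y by (simp add: \<tau>0 Lambda_fin_0 partitions_restrict_same)
next
  case (Suc i)
  let ?y = "Lambda_fin k n X y (\<tau> i)" and ?J = "jump_times k n X \<inter> {\<tau> i<..\<tau> (Suc i)}"
  have \<tau>i: "0 \<le> \<tau> i" using lift_Suc_mono_le[of \<tau> 0 i, OF mono] \<tau>0 by simp
  have yin: "?y \<in> partitions k {1..n}"
    using y by (intro Lambda_fin_in[OF k n X]) (simp add: partitions_restrict_same)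
  have "mark k n (cell_mark k n X (\<tau> i) (\<tau> (Suc i))) ?y = Lambda_fin k n X y (\<tau> (Suc i))"
  proof (cases "?J = {}")
    case True
    then show ?thesis
      using yin by (simp add: cell_mark_no_jump[OF True \<tau>i] Lambda_fin_no_jump[OF mono True]
        mark_def Id_map_def)
  next
    case False
    then obtain s where "s \<in> ?J" by blast
    then have s: "?J = {s}" using sep[of i] Suc.prems by auto
    show ?thesis
      using cell_mark_jump[OF k reg X s \<tau>i] Lambda_fin_jump[OF reg n s] by simp
  qed
  then show ?case using Suc by simp
qed

lemma eventually_iterate_cell_marks:
  assumes k: "1 \<le> k" and n: "1 \<le> n" and reg: "regular_points k X"
    and X: "X \<subseteq> {0..} \<times> Lip k {1..}" and y: "y \<in> partitions k {1..n}"
    and \<tau>0: "\<And>m. \<tau> m 0 = 0" and mono: "\<And>m i. \<tau> m i \<le> \<tau> m (Suc i)"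
    and mesh: "\<And>m i. \<tau> m (Suc i) \<le> \<tau> m i + \<delta> m" and \<delta>: "\<delta> \<longlonglongrightarrow> 0"
    and c: "\<And>m. u \<le> \<tau> m (c m)" "\<And>m. \<tau> m (c m) \<le> u + \<delta> m"
  shows "eventually (\<lambda>m::nat. iterate_maps (mark k n)
      (\<lambda>i. cell_mark k n X (\<tau> m i) (\<tau> m (Suc i))) y (c m) = Lambda_fin k n X y u) sequentially"
proof -
  let ?J = "jump_times k n X"
  have fin: "finite (?J \<inter> {..u + 1})" by (rule finite_jump_times[OF reg n])
  obtain d where d: "0 < d" "\<And>s t. s \<in> ?J \<inter> {..u + 1} \<Longrightarrow> t \<in> ?J \<inter> {..u + 1} \<Longrightarrow> \<bar>s - t\<bar> < d \<Longrightarrow> s = t"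
    using finite_separated[OF fin] by metis
  obtain b where b: "u < b" "\<And>s. u < s \<Longrightarrow> s < b \<Longrightarrow> ?J \<inter> {u<..s} = {}"
    using eventually_no_jump_right[OF fin] by (auto simp: eventually_at_right_field)
  \<comment> \<open>The bound \<open>1\<close> keeps all cells in use below \<open>u + 1\<close>,
    the bound \<open>d\<close> puts at most one jump in each of them, and \<open>b - u\<close>
    excludes jumps between \<open>u\<close> and the grid point to which it is rounded up.\<close>
  have "eventually (\<lambda>m. \<delta> m < min d (min (b - u) 1)) sequentially"
    using \<delta> d(1) b(1) by (intro order_tendstoD(2)) auto
  then show ?thesis
  proof eventually_elim
    case (elim m)
    then have \<delta>m: "\<delta> m < d" "\<delta> m < b - u" "\<delta> m < 1" by auto
    have "iterate_maps (mark k n) (\<lambda>i. cell_mark k n X (\<tau> m i) (\<tau> m (Suc i))) y (c m) =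
      Lambda_fin k n X y (\<tau> m (c m))"
    proof (rule iterate_cell_marks[OF k n reg X y \<tau>0 mono _ order_refl])
      fix i s t assume i: "i < c m" and s: "s \<in> ?J \<inter> {\<tau> m i<..\<tau> m (Suc i)}"
        and t: "t \<in> ?J \<inter> {\<tau> m i<..\<tau> m (Suc i)}"
      have "\<tau> m (Suc i) \<le> \<tau> m (c m)"
        using lift_Suc_mono_le[of "\<tau> m" "Suc i" "c m", OF mono] i by simp
      then have le: "\<tau> m (Suc i) \<le> u + 1" using c(2)[of m] \<delta>m by simp
      show "s = t"
      proof (rule d(2))
        show "\<bar>s - t\<bar> < d" using s t mesh[of m i] \<delta>m(1) by (auto simp: abs_less_iff)
      qed (use s t le in auto)
    qed
    also have "\<dots> = Lambda_fin k n X y u"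
    proof (cases "\<tau> m (c m) = u")
      case False
      then have "u < \<tau> m (c m)" using c(1)[of m] by simp
      moreover have "\<tau> m (c m) < b" using c(2)[of m] \<delta>m by simp
      ultimately show ?thesis using b(2) c(1) by (intro Lambda_fin_no_jump) auto
    qed simp
    finally show ?case .
  qed
qed

text \<open>\<open>s\<close> has index \<open>Suc m\<close> and \<open>s + t\<close> has index
  \<open>Suc m + Suc m\<close>. Using \<open>Suc m\<close> avoids division by zero; beyond
  \<open>s + t\<close> the grid continues with the second mesh, so that cells are indexed by all
  naturals. The cases \<open>s = 0\<close> and \<open>t = 0\<close> give degenerate cells and are
  allowed; equal arguments give a uniform grid.\<close>

definition two_step_grid :: "real \<Rightarrow> real \<Rightarrow> nat \<Rightarrow> nat \<Rightarrow> real" where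
  "two_step_grid s t m i = (if i \<le> Suc m then real i * s / real (Suc m)
     else s + (real i - real (Suc m)) * t / real (Suc m))"

lemma two_step_grid_increment:
  "two_step_grid s t m (Suc i) - two_step_grid s t m i = (if i \<le> m then s else t) / real (Suc m)"
proof -
  define M where "M = real (Suc m)"
  have M: "0 < M" "M = real m + 1" by (auto simp: M_def)
  have step: "(a + 1) * x / M - a * x / M = x / M" for a x :: real
    by (simp add: diff_divide_distrib[symmetric] left_diff_distrib[symmetric])
  consider "i \<le> m" | "i = Suc m" | "Suc m < i" by linarith
  then show ?thesis
  proof cases
    case 1
    then show ?thesis using step[of "real i" s]
      by (simp add: two_step_grid_def M(2)[symmetric] add.commute[of 1])
  next
    case 2
    then show ?thesis using M
      by (simp add: two_step_grid_def M_def[symmetric])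
  next
    case 3
    have "(real i + 1 - M) * t / M - (real i - M) * t / M = t / M"
      using step[of "real i - M" t] by (simp add: algebra_simps)
    with 3 show ?thesis
      by (simp add: two_step_grid_def M(2)[symmetric] add.commute[of 1])
  qed
qed

lemma two_step_grid_mono:
  assumes "0 \<le> s" "0 \<le> t" shows "two_step_grid s t m i \<le> two_step_grid s t m (Suc i)"
proof -
  have "0 \<le> (if i \<le> m then s else t) / real (Suc m)" using assms by simp
  with two_step_grid_increment[of s t m i] show ?thesis by linarith
qed

lemma two_step_grid_0: "two_step_grid s t m 0 = 0"
  by (simp add: two_step_grid_def)

lemma two_step_grid_nonneg:
  assumes "0 \<le> s" "0 \<le> t" shows "0 \<le> two_step_grid s t m i"
  using lift_Suc_mono_le[of "two_step_grid s t m" 0 i, OF two_step_grid_mono[OF assms]] two_step_grid_0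
  by simp

lemma two_step_grid_mid: "two_step_grid s t m (Suc m) = s"
  by (simp add: two_step_grid_def)

lemma two_step_grid_end: "two_step_grid s t m (Suc m + Suc m) = s + t"
proof -
  have "real (Suc m + Suc m) - real (Suc m) = real (Suc m)" by (simp only: of_nat_add add_diff_cancel_right')
  then show ?thesis unfolding two_step_grid_def by simp
qed

text \<open>\<open>c\<close> is the index of the first grid point not before \<open>u\<close>, so it
  overshoots by at most one step. For \<open>s = 0\<close> division by zero yields
  \<open>c = 0\<close>, which is the right index since then \<open>u = 0\<close>.\<close>

lemma two_step_grid_index:
  fixes s u :: real and m :: nat
  assumes "0 \<le> u" "u \<le> s"
  defines "c \<equiv> nat \<lceil>u * real (Suc m) / s\<rceil>"
  shows "c \<le> Suc m" "u \<le> two_step_grid s t m c" "two_step_grid s t m c \<le> u + s / real (Suc m)"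
proof -
  have nn: "0 \<le> u * real (Suc m) / s" using assms by simp
  have "u * real (Suc m) / s \<le> real (Suc m)"
    using assms by (cases "s = 0") (auto simp: divide_le_eq mult_right_mono mult.commute)
  then have "\<lceil>u * real (Suc m) / s\<rceil> \<le> int (Suc m)" by (simp only: ceiling_le_iff of_int_of_nat_eq)
  then show c: "c \<le> Suc m" unfolding c_def by linarith
  have c1: "u * real (Suc m) / s \<le> real c" "real c < u * real (Suc m) / s + 1"
    using nn unfolding c_def by linarith+
  have "u \<le> real c * s / real (Suc m) \<and> real c * s / real (Suc m) \<le> u + s / real (Suc m)"
  proof (cases "s = 0")
    case False
    then have s: "0 < s" using assms by simp
    define M where "M = real (Suc m)"
    have M: "0 < M" by (simp add: M_def)
    have "u * M \<le> real c * s" "real c * s < u * M + s"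
      using c1 s unfolding M_def[symmetric] by (simp_all add: field_simps)
    then have "u \<le> real c * s / M" "real c * s / M \<le> (u * M + s) / M"
      using M by (simp_all add: pos_le_divide_eq divide_right_mono)
    then show ?thesis using M unfolding M_def[symmetric] by (simp add: add_divide_distrib)
  qed (use assms in simp)
  with c show "u \<le> two_step_grid s t m c" "two_step_grid s t m c \<le> u + s / real (Suc m)"
    by (auto simp: two_step_grid_def)
qed

section \<open>Independence and the Poisson point process\<close>

context prob_space
begin

text \<open>Dominated convergence for indicators that stabilise almost surely. It carries the exact
  identities of the grid over to the continuous-time paths.\<close>

lemma prob_tendsto_eventually_eq:
  assumes E: "\<And>m. {\<omega>\<in>space M. P m \<omega>} \<in> events" and F: "{\<omega>\<in>space M. Q \<omega>} \<in> events"
    and lim: "AE \<omega> in M. eventually (\<lambda>m. P m \<omega> \<longleftrightarrow> Q \<omega>) sequentially"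
  shows "(\<lambda>m. prob {\<omega>\<in>space M. P m \<omega>}) \<longlonglongrightarrow> prob {\<omega>\<in>space M. Q \<omega>}"
proof -
  have "(\<lambda>m. \<integral>\<omega>. indicat_real {\<omega>\<in>space M. P m \<omega>} \<omega> \<partial>M) \<longlonglongrightarrow>
      (\<integral>\<omega>. indicat_real {\<omega>\<in>space M. Q \<omega>} \<omega> \<partial>M)"
  proof (rule integral_dominated_convergence[where w = "\<lambda>_. 1"])
    show "AE \<omega> in M. (\<lambda>m. indicat_real {\<omega>\<in>space M. P m \<omega>} \<omega>) \<longlonglongrightarrow>
        indicat_real {\<omega>\<in>space M. Q \<omega>} \<omega>"
      using lim
    proof eventually_elim
      case (elim \<omega>)
      then show ?case
        by (intro tendsto_eventually) (auto simp: indicator_def elim: eventually_mono)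
    qed
  qed (use E F in \<open>auto simp: indicator_def\<close>)
  then show ?thesis using E F by simp
qed

lemma prob_sum_values:
  assumes P: "finite P" and g: "\<And>\<omega>. \<omega> \<in> space M \<Longrightarrow> E \<omega> \<Longrightarrow> g \<omega> \<in> P"
    and meas: "\<And>v. v \<in> P \<Longrightarrow> {\<omega>\<in>space M. E \<omega> \<and> g \<omega> = v} \<in> events"
  shows "prob {\<omega>\<in>space M. E \<omega>} = (\<Sum>v\<in>P. prob {\<omega>\<in>space M. E \<omega> \<and> g \<omega> = v})"
proof -
  have "{\<omega>\<in>space M. E \<omega>} = (\<Union>v\<in>P. {\<omega>\<in>space M. E \<omega> \<and> g \<omega> = v})"
    using g by auto
  then show ?thesis
    using P meas by (auto intro!: finite_measure_finite_Union simp: disjoint_family_on_def)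
qed

text \<open>A finite product of discrete countable spaces is again discrete, so an arbitrary
  predicate \<open>Q\<close> of the first \<open>N\<close> indices is measurable, and grouping the
  independent family into \<open>{..<N}\<close> and \<open>{N}\<close> gives the product
  formula.\<close>

lemma indep_past_next:
  fixes C :: "nat \<Rightarrow> 'a \<Rightarrow> nat"
  assumes ind: "indep_vars (\<lambda>_. count_space UNIV) C UNIV"
  shows "{\<omega>\<in>space M. Q (restrict (\<lambda>i. C i \<omega>) {..<N})} \<in> events" (is ?E)
    and "prob {\<omega>\<in>space M. Q (restrict (\<lambda>i. C i \<omega>) {..<N}) \<and> R (C N \<omega>)} =
      prob {\<omega>\<in>space M. Q (restrict (\<lambda>i. C i \<omega>) {..<N})} * prob {\<omega>\<in>space M. R (C N \<omega>)}" (is ?I)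
proof -
  let ?p = "\<lambda>\<omega>. restrict (\<lambda>i. C i \<omega>) {..<N}" and ?q = "\<lambda>\<omega>. restrict (\<lambda>i. C i \<omega>) {N}"
  let ?A = "PiM {..<N} (\<lambda>_. count_space (UNIV :: nat set))"
    and ?B = "PiM {N} (\<lambda>_. count_space (UNIV :: nat set))"
  have iv: "indep_var ?A ?p ?B ?q"
    using indep_var_restrict[OF ind, of "{..<N}" "{N}"] by simp
  have A: "?A = count_space (PiE {..<N} (\<lambda>_. UNIV))" "?B = count_space (PiE {N} (\<lambda>_. UNIV))"
    by (intro count_space_PiM_finite; simp)+
  let ?X = "{v \<in> PiE {..<N} (\<lambda>_. UNIV). Q v}" and ?Y = "{v \<in> PiE {N} (\<lambda>_. UNIV). R (v N)}"
  have X: "?X \<in> sets ?A" and Y: "?Y \<in> sets ?B" unfolding A by auto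
  have pX: "?p -` ?X \<inter> space M = {\<omega>\<in>space M. Q (?p \<omega>)}" by auto
  have qY: "?q -` ?Y \<inter> space M = {\<omega>\<in>space M. R (C N \<omega>)}" by auto
  show ?E using measurable_sets[OF indep_var_rv1[OF iv] X] unfolding pX .
  have "(\<lambda>\<omega>. (?p \<omega>, ?q \<omega>)) -` (?X \<times> ?Y) \<inter> space M =
      {\<omega>\<in>space M. Q (?p \<omega>) \<and> R (C N \<omega>)}" by auto
  with indep_varD[OF iv X Y] show ?I unfolding pX qY by simp
qed

lemma events_iterate_maps:
  fixes C :: "nat \<Rightarrow> 'a \<Rightarrow> nat"
  assumes ind: "indep_vars (\<lambda>_. count_space UNIV) C UNIV"
  shows "{\<omega>\<in>space M. Q (restrict (\<lambda>i. C i \<omega>) {..<N}) \<and> iterate_maps f (\<lambda>i. C i \<omega>) y (N + i) = z} \<in> events"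
proof -
  let ?c = "\<lambda>\<omega>. restrict (\<lambda>i. C i \<omega>) {..<N + i}"
  have "restrict (?c \<omega>) {..<N} = restrict (\<lambda>i. C i \<omega>) {..<N}" for \<omega>
    by (auto simp: fun_eq_iff restrict_def)
  then have "{\<omega>\<in>space M. Q (restrict (?c \<omega>) {..<N}) \<and> iterate_maps f (?c \<omega>) y (N + i) = z} =
    {\<omega>\<in>space M. Q (restrict (\<lambda>i. C i \<omega>) {..<N}) \<and> iterate_maps f (\<lambda>i. C i \<omega>) y (N + i) = z}"
    by (simp add: iterate_maps_restrict)
  moreover have "{\<omega>\<in>space M. Q (restrict (?c \<omega>) {..<N}) \<and> iterate_maps f (?c \<omega>) y (N + i) = z} \<in> events"
    by (rule indep_past_next(1)[OF ind])
  ultimately show ?thesis by simp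
qed

text \<open>Split according to the state \<open>v\<close> before the last step: that state and
  \<open>Q\<close> are determined by the first \<open>N + i\<close> indices, which are independent
  of index \<open>N + i\<close>.\<close>

lemma prob_iterate_maps_Suc:
  fixes C :: "nat \<Rightarrow> 'a \<Rightarrow> nat"
  assumes ind: "indep_vars (\<lambda>_. count_space UNIV) C UNIV"
    and P: "finite P" "\<And>j v. v \<in> P \<Longrightarrow> f j v \<in> P" "y \<in> P"
  shows "prob {\<omega>\<in>space M. Q (restrict (\<lambda>i. C i \<omega>) {..<N}) \<and> iterate_maps f (\<lambda>i. C i \<omega>) y (Suc (N + i)) = z} =
    (\<Sum>v\<in>P. prob {\<omega>\<in>space M. Q (restrict (\<lambda>i. C i \<omega>) {..<N}) \<and> iterate_maps f (\<lambda>i. C i \<omega>) y (N + i) = v} *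
      prob {\<omega>\<in>space M. f (C (N + i) \<omega>) v = z})"
proof -
  let ?q = "\<lambda>\<omega>. Q (restrict (\<lambda>i. C i \<omega>) {..<N})" and ?D = "\<lambda>\<omega> j. iterate_maps f (\<lambda>i. C i \<omega>) y j"
  let ?c = "\<lambda>\<omega>. restrict (\<lambda>i. C i \<omega>) {..<N + i}"
  let ?R = "\<lambda>v c. Q (restrict c {..<N}) \<and> iterate_maps f c y (N + i) = v"
  have c: "restrict (?c \<omega>) {..<N} = restrict (\<lambda>i. C i \<omega>) {..<N}" for \<omega>
    by (auto simp: fun_eq_iff restrict_def)
  have R: "?R v (?c \<omega>) \<longleftrightarrow> ?q \<omega> \<and> ?D \<omega> (N + i) = v" for v \<omega>
    unfolding c by (simp add: iterate_maps_restrict)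
  have eq: "{\<omega>\<in>space M. (?q \<omega> \<and> ?D \<omega> (Suc (N + i)) = z) \<and> ?D \<omega> (N + i) = v} =
      {\<omega>\<in>space M. ?R v (?c \<omega>) \<and> f (C (N + i) \<omega>) v = z}" for v
    unfolding R by auto
  have meas: "{\<omega>\<in>space M. ?R v (?c \<omega>) \<and> f (C (N + i) \<omega>) v = z} \<in> events" for v
  proof -
    have "C (N + i) \<in> M \<rightarrow>\<^sub>M count_space UNIV" using ind by (simp add: indep_vars_def)
    then have "{\<omega>\<in>space M. f (C (N + i) \<omega>) v = z} \<in> events"
      using measurable_sets[of "C (N + i)" M "count_space UNIV" "{j. f j v = z}"]
      by (simp add: vimage_def Int_def conj_commute)
    from sets.sets_Collect_conj[OF this indep_past_next(1)[OF ind, of "?R v" "N + i"]]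
    show ?thesis .
  qed
  have "prob {\<omega>\<in>space M. ?q \<omega> \<and> ?D \<omega> (Suc (N + i)) = z} =
    (\<Sum>v\<in>P. prob {\<omega>\<in>space M. (?q \<omega> \<and> ?D \<omega> (Suc (N + i)) = z) \<and> ?D \<omega> (N + i) = v})"
    using meas unfolding eq[symmetric]
    by (intro prob_sum_values P(1)) (auto intro: iterate_maps_in P)
  also have "\<dots> = (\<Sum>v\<in>P. prob {\<omega>\<in>space M. ?q \<omega> \<and> ?D \<omega> (N + i) = v} * prob {\<omega>\<in>space M. f (C (N + i) \<omega>) v = z})"
    unfolding eq by (subst indep_past_next(2)[OF ind]) (simp only: R)
  finally show ?thesis .
qed

text \<open>Induction on the number of steps after \<open>N\<close>, with one step peeled off on
  both sides. The family \<open>C'\<close> plays the restarted dynamics; it need not be independent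
  of \<open>C\<close>, since it enters only through probabilities of its own, which match those of
  \<open>C\<close> shifted by \<open>N\<close>.\<close>

lemma prob_iterate_maps_markov:
  fixes C C' :: "nat \<Rightarrow> 'a \<Rightarrow> nat"
  assumes ind: "indep_vars (\<lambda>_. count_space UNIV) C UNIV" "indep_vars (\<lambda>_. count_space UNIV) C' UNIV"
    and law: "\<And>i R. prob {\<omega>\<in>space M. R (C (N + i) \<omega>)} = prob {\<omega>\<in>space M. R (C' i \<omega>)}"
    and P: "finite P" "\<And>j v. v \<in> P \<Longrightarrow> f j v \<in> P" "y \<in> P"
  shows "prob {\<omega>\<in>space M. Q (restrict (\<lambda>i. C i \<omega>) {..<N}) \<and> iterate_maps f (\<lambda>i. C i \<omega>) y (N + i) = z} =
    (\<Sum>w\<in>P. prob {\<omega>\<in>space M. Q (restrict (\<lambda>i. C i \<omega>) {..<N}) \<and> iterate_maps f (\<lambda>i. C i \<omega>) y N = w} *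
      prob {\<omega>\<in>space M. iterate_maps f (\<lambda>i. C' i \<omega>) w i = z})"
proof (induction i arbitrary: z)
  case 0
  let ?E = "\<lambda>w. prob {\<omega>\<in>space M. Q (restrict (\<lambda>i. C i \<omega>) {..<N}) \<and> iterate_maps f (\<lambda>i. C i \<omega>) y N = w}"
  have "?E w * prob {\<omega>\<in>space M. w = z} = (if w = z then ?E z else 0)" for w
    by (auto simp: prob_space)
  moreover have "?E z = 0" if "z \<notin> P"
  proof -
    have "{\<omega>\<in>space M. Q (restrict (\<lambda>i. C i \<omega>) {..<N}) \<and> iterate_maps f (\<lambda>i. C i \<omega>) y N = z} = {}"
      using iterate_maps_in[of P f y] P that by auto
    then show ?thesis by (simp only: measure_empty)
  qed
  ultimately show ?case using P(1) by (cases "z \<in> P") (simp_all del: restrict_apply)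
next
  case (Suc i)
  let ?E = "\<lambda>i w. prob {\<omega>\<in>space M. Q (restrict (\<lambda>i. C i \<omega>) {..<N}) \<and> iterate_maps f (\<lambda>i. C i \<omega>) y (N + i) = w}"
  let ?E' = "\<lambda>i w z. prob {\<omega>\<in>space M. iterate_maps f (\<lambda>i. C' i \<omega>) w i = z}"
  let ?K = "\<lambda>v. prob {\<omega>\<in>space M. f (C' i \<omega>) v = z}"
  have E': "?E' (Suc i) w z = (\<Sum>v\<in>P. ?E' i w v * ?K v)" if "w \<in> P" for w
    using prob_iterate_maps_Suc[OF ind(2) P(1), where f = f and y = w and N = 0 and Q = "\<lambda>_. True"
        and i = i and z = z] P(2) that by simp
  have "?E (Suc i) z = (\<Sum>v\<in>P. ?E i v * ?K v)"
    using prob_iterate_maps_Suc[OF ind(1) P(1), where f = f and y = y and N = N and Q = Q and i = i and z = z]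
      P(2,3) by (simp add: law[of "\<lambda>j. f j _ = z"])
  also have "\<dots> = (\<Sum>v\<in>P. \<Sum>w\<in>P. ?E 0 w * ?E' i w v * ?K v)"
    by (simp only: Suc.IH sum_distrib_right add_0_right)
  also have "\<dots> = (\<Sum>w\<in>P. \<Sum>v\<in>P. ?E 0 w * ?E' i w v * ?K v)"
    by (rule sum.swap)
  also have "\<dots> = (\<Sum>w\<in>P. ?E 0 w * ?E' (Suc i) w z)"
    by (intro sum.cong refl) (simp only: E' sum_distrib_left mult.assoc)
  finally show ?case by (simp only: add_Suc_right add_0_right)
qed

end

section \<open>Measurability and almost sure regularity of the Poisson configuration\<close>

locale poisson_lip = prob_space M
  for M :: "'w measure" +
  fixes k :: nat and \<phi> :: "colouring_map measure" and X :: "'w \<Rightarrow> (real \<times> colouring_map) set"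
  assumes k: "1 \<le> k"
    and sets_phi: "sets \<phi> = sets (Lip_space k)"
    and phi_Id: "emeasure \<phi> {Id_map k {1..}} = 0"
    and phi_fin: "\<And>n. 1 \<le> n \<Longrightarrow>
      emeasure (image_measure k \<phi> n) (Lip k {1..n} - {Id_map k {1..n}}) < \<infinity>"
    and ppp: "poisson_point_process M (restrict_space lborel {0..} \<Otimes>\<^sub>M \<phi>) X"
begin

abbreviation "\<mu> \<equiv> restrict_space lborel {0::real..} \<Otimes>\<^sub>M \<phi>"

lemma space_phi: "space \<phi> = Lip k {1..}"
  using sets_eq_imp_space_eq[OF sets_phi] by (simp add: Lip_space_def space_measure_of_conv)

lemma sets_map_restr: "1 \<le> n \<Longrightarrow> {F \<in> Lip k {1..}. Q (map_restr k n F)} \<in> sets \<phi>"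
proof -
  assume n: "1 \<le> n"
  have "{F \<in> Lip k {1..}. Q (map_restr k n F)} =
      map_restr k n -` {F \<in> Lip k {1..n}. Q F} \<inter> Lip k {1..}"
    using map_restr_in_Lip[OF k] by auto
  moreover have "\<dots> \<in> sets (Lip_space k)"
    unfolding Lip_space_def
    by (subst sets_measure_of)
      (use n in \<open>auto intro!: sigma_sets.Basic exI[of _ n] exI[of _ "{F \<in> Lip k {1..n}. Q F}"]\<close>)
  ultimately show ?thesis using sets_phi by simp
qed

lemma moving_sets: "1 \<le> n \<Longrightarrow> moving k n \<in> sets \<phi>"
  unfolding moving_def by (rule sets_map_restr)

lemma marked_sets: "1 \<le> n \<Longrightarrow> marked k n j \<in> sets \<phi>"
  unfolding marked_def by (rule sets_map_restr[of n "\<lambda>F. j < card (marks k n) \<and> F = mark k n j"])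

lemma moving_finite: "1 \<le> n \<Longrightarrow> emeasure \<phi> (moving k n) < \<infinity>"
proof -
  assume n: "1 \<le> n"
  have "map_restr k n \<in> \<phi> \<rightarrow>\<^sub>M count_space (Lip k {1..n})"
  proof (rule measurableI)
    show "map_restr k n F \<in> space (count_space (Lip k {1..n}))" if "F \<in> space \<phi>" for F
      using map_restr_in_Lip[OF k] that by (simp add: space_phi)
    show "map_restr k n -` A \<inter> space \<phi> \<in> sets \<phi>" for A
      using sets_map_restr[OF n, of "\<lambda>F. F \<in> A"] by (simp add: space_phi vimage_def Int_def conj_commute)
  qed
  then have "emeasure (image_measure k \<phi> n) (Lip k {1..n} - {Id_map k {1..n}}) =
      emeasure \<phi> (map_restr k n -` (Lip k {1..n} - {Id_map k {1..n}}) \<inter> space \<phi>)"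
    unfolding image_measure_def by (intro emeasure_distr) auto
  also have "map_restr k n -` (Lip k {1..n} - {Id_map k {1..n}}) \<inter> space \<phi> = moving k n"
    using map_restr_in_Lip[OF k] by (auto simp: moving_def space_phi)
  finally show ?thesis using phi_fin[OF n] by simp
qed

lemma Id_sets: "{Id_map k {1..}} \<in> sets \<phi>"
proof -
  have "{Id_map k {1..}} = (\<Inter>n\<in>{1..}. {F \<in> Lip k {1..}. map_restr k n F = Id_map k {1..n}})"
  proof (intro equalityI subsetI)
    fix F assume F: "F \<in> (\<Inter>n\<in>{1..}. {F \<in> Lip k {1..}. map_restr k n F = Id_map k {1..n}})"
    then have "F \<in> {F \<in> Lip k {1..}. map_restr k 1 F = Id_map k {1..1}}" by (rule INT_D) simp
    then have "F \<in> Lip k {1..}" by simp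
    with F show "F \<in> {Id_map k {1..}}" using Lip_eq_IdI[of F k] by auto
  qed (auto simp: map_restr_Id[OF k] Id_map_in_Lip)
  also have "\<dots> \<in> sets \<phi>"
    using sets_map_restr by (intro sets.countable_INT) auto
  finally show ?thesis .
qed

text \<open>The sets \<open>moving k (Suc n)\<close> have finite mass and cover all maps but the
  identity, whose singleton is null. Sigma-finiteness is what makes the product formula for boxes
  available.\<close>

sublocale phi: sigma_finite_measure \<phi>
proof
  let ?A = "insert {Id_map k {1..}} (range (\<lambda>n. moving k (Suc n)))"
  have "\<exists>n. F \<in> moving k (Suc n)" if F: "F \<in> Lip k {1..}" "F \<noteq> Id_map k {1..}" for F
  proof -
    obtain n where "1 \<le> n" "map_restr k n F \<noteq> Id_map k {1..n}" using Lip_eq_IdI[OF F(1)] F(2) by blast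
    then show ?thesis using F by (auto simp: moving_def intro!: exI[of _ "n - 1"])
  qed
  then have "Lip k {1..} \<subseteq> \<Union>?A" by blast
  moreover have "\<Union>?A \<subseteq> Lip k {1..}" using Id_map_in_Lip by (auto simp: moving_def)
  ultimately have "\<Union>?A = space \<phi>" unfolding space_phi by blast
  moreover have "emeasure \<phi> a \<noteq> \<infinity>" if "a \<in> ?A" for a
    using that phi_Id moving_finite[of "Suc _"] by (auto simp: less_top[symmetric])
  ultimately show "\<exists>A. countable A \<and> A \<subseteq> sets \<phi> \<and> \<Union>A = space \<phi> \<and> (\<forall>a\<in>A. emeasure \<phi> a \<noteq> \<infinity>)"
    using Id_sets moving_sets[of "Suc _"] by (intro exI[of _ ?A]) auto
qed

lemma box_sets: "I \<in> sets borel \<Longrightarrow> I \<subseteq> {0..} \<Longrightarrow> S \<in> sets \<phi> \<Longrightarrow> I \<times> S \<in> sets \<mu>"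
  by (intro pair_measureI) (auto simp: sets_restrict_space_iff)

lemma emeasure_box:
  assumes "I \<in> sets borel" "I \<subseteq> {0..}" "S \<in> sets \<phi>"
  shows "emeasure \<mu> (I \<times> S) = emeasure lborel I * emeasure \<phi> S"
  using assms
  by (subst phi.emeasure_pair_measure_Times) (auto simp: sets_restrict_space_iff emeasure_restrict_space)

lemma X_subset: "\<omega> \<in> space M \<Longrightarrow> X \<omega> \<subseteq> {0..} \<times> Lip k {1..}"
  using ppp unfolding poisson_point_process_def
  by (simp add: space_pair_measure space_restrict_space space_phi)

lemma points_in_eq_0: "points_in X B \<omega> = 0 \<longleftrightarrow> X \<omega> \<inter> B = {}"
  unfolding points_in_def by (subst emeasure_count_space_eq_0) auto

lemma points_in_le_1: "points_in X B \<omega> \<le> 1 \<longleftrightarrow> (\<forall>p\<in>X \<omega> \<inter> B. \<forall>q\<in>X \<omega> \<inter> B. p = q)"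
proof (cases "finite (X \<omega> \<inter> B)")
  case True
  then have "points_in X B \<omega> \<le> 1 \<longleftrightarrow> card (X \<omega> \<inter> B) \<le> 1"
    by (simp add: points_in_def)
  also have "\<dots> \<longleftrightarrow> (\<forall>p\<in>X \<omega> \<inter> B. \<forall>q\<in>X \<omega> \<inter> B. p = q)"
    using card_le_Suc0_iff_eq[OF True] by (simp add: One_nat_def)
  finally show ?thesis .
next
  case False
  have "\<not> (\<forall>p\<in>X \<omega> \<inter> B. \<forall>q\<in>X \<omega> \<inter> B. p = q)"
  proof
    assume eq: "\<forall>p\<in>X \<omega> \<inter> B. \<forall>q\<in>X \<omega> \<inter> B. p = q"
    obtain p where "p \<in> X \<omega> \<inter> B" using False by (metis finite.emptyI ex_in_conv)
    with eq have "X \<omega> \<inter> B \<subseteq> {p}" by blast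
    with False show False using finite_subset by blast
  qed
  with False show ?thesis by (simp add: points_in_def top_unique)
qed

text \<open>The initial state is independent of exactly this sigma-field. Path events with a
  deterministic start therefore have to be placed here, not merely among the events of
  \<open>M\<close>.\<close>

definition point_algebra :: "'w measure" where
  "point_algebra = sigma (space M)
     {points_in X B -` C \<inter> space M | B C. B \<in> sets \<mu> \<and> C \<in> sets borel}"

lemma sets_point_algebra: "sets point_algebra = point_process_events M \<mu> X"
  unfolding point_algebra_def point_process_events_def by (rule sets_measure_of) auto

lemma space_point_algebra[simp]: "space point_algebra = space M"
  unfolding point_algebra_def by (rule space_measure_of) auto

lemma rv_points_in: "B \<in> sets \<mu> \<Longrightarrow> points_in X B \<in> borel_measurable M"
  using ppp unfolding poisson_point_process_def by blast

lemma subalgebra_point_algebra: "subalgebra M point_algebra"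
proof -
  have "point_process_events M \<mu> X \<subseteq> sets M"
    unfolding point_process_events_def
    using rv_points_in by (intro sets.sigma_sets_subset) auto
  then show ?thesis by (simp add: subalgebra_def sets_point_algebra)
qed

lemma point_algebra_events: "E \<in> sets point_algebra \<Longrightarrow> E \<in> events"
  using subalgebra_point_algebra unfolding subalgebra_def by blast

lemma measurable_points_in: "B \<in> sets \<mu> \<Longrightarrow> points_in X B \<in> borel_measurable point_algebra"
  by (rule measurableI) (auto simp: sets_point_algebra point_process_events_def intro!: sigma_sets.Basic)

lemma empty_events: "B \<in> sets \<mu> \<Longrightarrow> {\<omega>\<in>space M. X \<omega> \<inter> B = {}} \<in> sets point_algebra"
  using measurable_sets[OF measurable_points_in, of B "{0}"]
  by (simp add: vimage_def Int_def conj_commute points_in_eq_0[unfolded Int_def])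

lemma le_1_events: "B \<in> sets \<mu> \<Longrightarrow> {\<omega>\<in>space M. points_in X B \<omega> \<le> 1} \<in> sets point_algebra"
  using measurable_sets[OF measurable_points_in, of B "{..1}"]
  by (simp add: vimage_def Int_def conj_commute)

lemma prob_points_in:
  "B \<in> sets \<mu> \<Longrightarrow> emeasure \<mu> B < \<infinity> \<Longrightarrow>
    prob {\<omega>\<in>space M. points_in X B \<omega> = of_nat j} = measure \<mu> B ^ j / fact j * exp (- measure \<mu> B)"
  using ppp unfolding poisson_point_process_def by blast

lemma prob_empty:
  "B \<in> sets \<mu> \<Longrightarrow> emeasure \<mu> B < \<infinity> \<Longrightarrow> prob {\<omega>\<in>space M. X \<omega> \<inter> B = {}} = exp (- measure \<mu> B)"
  using prob_points_in[of B 0] by (simp add: points_in_eq_0)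

text \<open>For a Poisson variable of mean \<open>x\<close> the probability in question is
  \<open>1 - (1 + x) * exp (- x)\<close>, and \<open>exp (- x) \<ge> 1 - x\<close> bounds it by
  \<open>1 - (1 + x) * (1 - x) = x^2\<close>. The quadratic order is what makes the union bound over
  all cells vanish.\<close>

lemma prob_points_in_gt_1:
  assumes B: "B \<in> sets \<mu>" "emeasure \<mu> B < \<infinity>"
  shows "prob {\<omega>\<in>space M. \<not> points_in X B \<omega> \<le> 1} \<le> (measure \<mu> B)\<^sup>2"
proof -
  let ?x = "measure \<mu> B"
  have E: "{\<omega>\<in>space M. points_in X B \<omega> = of_nat j} \<in> events" for j :: nat
    using measurable_sets[OF rv_points_in[OF B(1)], of "{of_nat j}"]
    by (simp add: vimage_def Int_def conj_commute)
  let ?A = "\<lambda>j::nat. {\<omega>\<in>space M. points_in X B \<omega> = of_nat j}"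
  have le1: "{\<omega>\<in>space M. points_in X B \<omega> \<le> 1} \<in> events"
    by (rule point_algebra_events[OF le_1_events[OF B(1)]])
  have "prob (?A 0) + prob (?A 1) = prob (?A 0 \<union> ?A 1)"
    using E[of 0] E[of 1] by (intro finite_measure_Union[symmetric]) auto
  also have "\<dots> \<le> prob {\<omega>\<in>space M. points_in X B \<omega> \<le> 1}"
    using le1 by (intro finite_measure_mono) auto
  finally have "exp (- ?x) + ?x * exp (- ?x) \<le> prob {\<omega>\<in>space M. points_in X B \<omega> \<le> 1}"
    using prob_points_in[OF B, of 0] prob_points_in[OF B, of 1] by simp
  moreover have "prob {\<omega>\<in>space M. \<not> points_in X B \<omega> \<le> 1} = 1 - prob {\<omega>\<in>space M. points_in X B \<omega> \<le> 1}"
    using le1 by (rule prob_neg)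
  moreover have "(1 - ?x) * (1 + ?x) \<le> exp (- ?x) * (1 + ?x)"
    using exp_ge_add_one_self[of "- ?x"] by (intro mult_right_mono) auto
  ultimately show ?thesis by (simp add: algebra_simps power2_eq_square)
qed

lemma grid_cell_box:
  assumes n: "1 \<le> n"
  shows "grid_cell T m i \<times> moving k n \<in> sets \<mu>"
    and "emeasure \<mu> (grid_cell T m i \<times> moving k n) < \<infinity>"
    and "measure \<mu> (grid_cell T m i \<times> moving k n) = real T / real (Suc m) * measure \<phi> (moving k n)"
proof -
  have I: "grid_cell T m i \<in> sets borel" "grid_cell T m i \<subseteq> {0..}"
    by (auto simp: grid_cell_def intro: order_trans[rotated])
  have len: "real (Suc i) * real T / real (Suc m) - real i * real T / real (Suc m) = real T / real (Suc m)"
    by (simp add: diff_divide_distrib[symmetric] left_diff_distrib[symmetric])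
  have "real i * real T / real (Suc m) \<le> real (Suc i) * real T / real (Suc m)"
    by (intro divide_right_mono mult_right_mono) auto
  then have leb: "emeasure lborel (grid_cell T m i) = ennreal (real T / real (Suc m))"
    unfolding grid_cell_def by (subst emeasure_lborel_Ico) (simp_all only: len)
  have em: "emeasure \<mu> (grid_cell T m i \<times> moving k n) = ennreal (real T / real (Suc m)) * emeasure \<phi> (moving k n)"
    using emeasure_box[OF I moving_sets[OF n]] leb by simp
  show "grid_cell T m i \<times> moving k n \<in> sets \<mu>"
    by (rule box_sets[OF I moving_sets[OF n]])
  show "emeasure \<mu> (grid_cell T m i \<times> moving k n) < \<infinity>"
    unfolding em using moving_finite[OF n] by (simp add: ennreal_mult_less_top)
  show "measure \<mu> (grid_cell T m i \<times> moving k n) = real T / real (Suc m) * measure \<phi> (moving k n)"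
    unfolding measure_def em by (simp add: enn2real_mult)
qed

lemma regular_event: "{\<omega>\<in>space M. regular_points k (X \<omega>)} \<in> sets point_algebra"
proof -
  let ?R = "\<lambda>\<omega>. X \<omega> \<inter> {0..} \<times> {Id_map k {1..}} = {} \<and>
    (\<forall>n\<ge>1. \<forall>T. \<exists>m. \<forall>i\<le>m. points_in X (grid_cell T m i \<times> moving k n) \<omega> \<le> 1)"
  have "{\<omega>\<in>space point_algebra. \<exists>m. \<forall>i\<in>{..m}. points_in X (grid_cell T m i \<times> moving k n) \<omega> \<le> 1}
      \<in> sets point_algebra" if "1 \<le> n" for n T
    using le_1_events[OF grid_cell_box(1)[OF that]]
    by (intro sets.sets_Collect_countable_Ex sets.sets_Collect_finite_All) simp_all
  then have "{\<omega>\<in>space point_algebra. \<forall>n\<in>{1..}. \<forall>T. \<exists>m. \<forall>i\<in>{..m}.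
      points_in X (grid_cell T m i \<times> moving k n) \<omega> \<le> 1} \<in> sets point_algebra"
    by (intro sets.sets_Collect_countable_All' sets.sets_Collect_countable_All) simp_all
  then have G: "{\<omega>\<in>space point_algebra. \<forall>n\<ge>1. \<forall>T. \<exists>m. \<forall>i\<le>m.
      points_in X (grid_cell T m i \<times> moving k n) \<omega> \<le> 1} \<in> sets point_algebra"
    by (simp only: Ball_def atMost_iff atLeast_iff)
  have "{\<omega>\<in>space point_algebra. X \<omega> \<inter> {0..} \<times> {Id_map k {1..}} = {}} \<in> sets point_algebra"
    using empty_events[OF box_sets[OF _ order_refl Id_sets]] by simp
  from sets.sets_Collect_conj[OF G this]
  have "{\<omega>\<in>space point_algebra. ?R \<omega>} \<in> sets point_algebra" .
  also have "{\<omega>\<in>space point_algebra. ?R \<omega>} = {\<omega>\<in>space M. regular_points k (X \<omega>)}"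
    using regular_points_iff[OF k X_subset] by (auto simp only: space_point_algebra points_in_le_1)
  finally show ?thesis .
qed

text \<open>The identity has mass zero, so it almost surely does not occur. For a horizon
  \<open>T\<close>, the failure of every grid is contained in the failure of the grid with
  \<open>m + 1\<close> cells, whose probability is at most \<open>m + 1\<close> times a quantity of
  order \<open>1 / (m + 1)^2\<close>; this bound tends to \<open>0\<close>.\<close>

lemma AE_regular: "AE \<omega> in M. regular_points k (X \<omega>)"
proof -
  have Id: "{0..} \<times> {Id_map k {1..}} \<in> sets \<mu>"
    by (rule box_sets[OF _ order_refl Id_sets]) simp
  have "emeasure \<mu> ({0..} \<times> {Id_map k {1..}}) = 0"
    by (subst emeasure_box) (simp_all add: Id_sets phi_Id)
  then have "prob {\<omega>\<in>space M. X \<omega> \<inter> {0..} \<times> {Id_map k {1..}} = {}} = 1"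
    using prob_empty[OF Id] by (simp add: measure_def)
  then have AE_Id: "AE \<omega> in M. X \<omega> \<inter> {0..} \<times> {Id_map k {1..}} = {}"
    using prob_Collect_eq_1[OF point_algebra_events[OF empty_events[OF Id]]] by simp
  have AE_grid: "AE \<omega> in M. \<exists>m. \<forall>i\<le>m. points_in X (grid_cell T m i \<times> moving k n) \<omega> \<le> 1"
    if n: "1 \<le> n" for n T
  proof -
    let ?N = "\<lambda>m i. points_in X (grid_cell T m i \<times> moving k n)"
    \<comment> \<open>The square of the mean number of points up to time \<open>T\<close>: summing
      \<open>m + 1\<close> cell bounds \<open>c / (m + 1)^2\<close> leaves
      \<open>c / (m + 1)\<close>.\<close>
    define c where "c = (real T * measure \<phi> (moving k n))\<^sup>2"
    have ev: "{\<omega>\<in>space M. ?N m i \<omega> \<le> 1} \<in> events" for m i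
      by (rule point_algebra_events[OF le_1_events[OF grid_cell_box(1)[OF n]]])
    then have ev': "{\<omega>\<in>space M. \<not> ?N m i \<omega> \<le> 1} \<in> events" for m i
      by (rule sets.sets_Collect_neg)
    have "{\<omega>\<in>space M. \<exists>m. \<forall>i\<in>{..m}. ?N m i \<omega> \<le> 1} \<in> events"
      using ev by (intro sets.sets_Collect_countable_Ex sets.sets_Collect_finite_All) simp_all
    then have E: "{\<omega>\<in>space M. \<exists>m. \<forall>i\<le>m. ?N m i \<omega> \<le> 1} \<in> events"
      by (simp only: Ball_def atMost_iff)
    have bound: "prob {\<omega>\<in>space M. \<not> (\<exists>m. \<forall>i\<le>m. ?N m i \<omega> \<le> 1)} \<le> c / real (Suc m)" for m
    proof -
      have "prob {\<omega>\<in>space M. \<not> (\<exists>m. \<forall>i\<le>m. ?N m i \<omega> \<le> 1)} \<le>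
          prob (\<Union>i\<in>{..m}. {\<omega>\<in>space M. \<not> ?N m i \<omega> \<le> 1})"
      proof (rule finite_measure_mono)
        show "{\<omega>\<in>space M. \<not> (\<exists>m. \<forall>i\<le>m. ?N m i \<omega> \<le> 1)} \<subseteq>
            (\<Union>i\<in>{..m}. {\<omega>\<in>space M. \<not> ?N m i \<omega> \<le> 1})" by blast
        show "(\<Union>i\<in>{..m}. {\<omega>\<in>space M. \<not> ?N m i \<omega> \<le> 1}) \<in> events"
          using ev' by (intro sets.finite_UN) simp_all
      qed
      also have "\<dots> \<le> (\<Sum>i\<in>{..m}. prob {\<omega>\<in>space M. \<not> ?N m i \<omega> \<le> 1})"
        using ev' by (intro finite_measure_subadditive_finite) (simp_all add: image_subset_iff)
      also have "\<dots> \<le> (\<Sum>i\<in>{..m}. (real T / real (Suc m) * measure \<phi> (moving k n))\<^sup>2)"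
        by (intro sum_mono prob_points_in_gt_1[OF grid_cell_box(1,2)[OF n],
            unfolded grid_cell_box(3)[OF n]])
      also have "\<dots> = c / real (Suc m)"
        by (simp add: c_def power_mult_distrib power_divide power2_eq_square del: of_nat_Suc)
      finally show ?thesis .
    qed
    have "(\<lambda>m. c / real (Suc m)) \<longlonglongrightarrow> 0"
      using LIMSEQ_Suc[OF lim_const_over_n[of c]] by simp
    then have "prob {\<omega>\<in>space M. \<not> (\<exists>m. \<forall>i\<le>m. ?N m i \<omega> \<le> 1)} \<le> 0"
      using bound by (intro LIMSEQ_le_const) auto
    then have "prob {\<omega>\<in>space M. \<exists>m. \<forall>i\<le>m. ?N m i \<omega> \<le> 1} = 1"
      using prob_neg[OF E] prob_le_1[of "{\<omega>\<in>space M. \<exists>m. \<forall>i\<le>m. ?N m i \<omega> \<le> 1}"] by linarith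
    then show ?thesis using prob_Collect_eq_1[OF E] by simp
  qed
  have "AE \<omega> in M. \<forall>n\<in>{1..}. \<forall>T. \<exists>m. \<forall>i\<le>m. points_in X (grid_cell T m i \<times> moving k n) \<omega> \<le> 1"
    using AE_grid by (subst AE_ball_countable) (auto simp: AE_all_countable)
  with AE_Id AE_space show ?thesis
  proof eventually_elim
    case (elim \<omega>)
    then show ?case
      unfolding regular_points_iff[OF k X_subset[OF elim(2)]] points_in_le_1 by simp
  qed
qed

end

text \<open>The tail events of the mark, unlike the events that it equals \<open>j\<close>, say that
  a single box is empty. They are thus count events with an explicit Poisson probability.\<close>

lemma le_cell_mark_iff:
  "j \<le> cell_mark k n X a b \<longleftrightarrow>
    j \<le> card (marks k n) \<and> X \<inter> {a<..b} \<times> (\<Union>i<j. marked k n i) = {}"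
proof -
  let ?P = "\<lambda>i. X \<inter> {a<..b} \<times> marked k n i \<noteq> {} \<or> card (marks k n) \<le> i"
  have "j \<le> cell_mark k n X a b \<longleftrightarrow> (\<forall>i<j. \<not> ?P i)"
  proof
    assume "j \<le> cell_mark k n X a b"
    then show "\<forall>i<j. \<not> ?P i"
      unfolding cell_mark_def using not_less_Least[of _ ?P] by (meson order_less_le_trans)
  next
    assume "\<forall>i<j. \<not> ?P i"
    moreover have "?P (cell_mark k n X a b)"
      unfolding cell_mark_def by (rule LeastI[of ?P "card (marks k n)"]) simp
    ultimately show "j \<le> cell_mark k n X a b" by (meson not_le)
  qed
  also have "\<dots> \<longleftrightarrow> (\<forall>i<j. i < card (marks k n)) \<and> (\<forall>i<j. X \<inter> {a<..b} \<times> marked k n i = {})"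
    by (auto simp: not_le)
  also have "(\<forall>i<j. i < card (marks k n)) \<longleftrightarrow> j \<le> card (marks k n)"
    by (meson not_le order_less_irrefl order_less_le_trans)
  also have "(\<forall>i<j. X \<inter> {a<..b} \<times> marked k n i = {}) \<longleftrightarrow> X \<inter> {a<..b} \<times> (\<Union>i<j. marked k n i) = {}"
    by blast
  finally show ?thesis .
qed

lemma measurable_iterate_maps:
  fixes C :: "nat \<Rightarrow> 'a \<Rightarrow> nat"
  assumes "\<And>i. C i \<in> N \<rightarrow>\<^sub>M count_space UNIV"
  shows "(\<lambda>\<omega>. iterate_maps f (\<lambda>i. C i \<omega>) y j) \<in> N \<rightarrow>\<^sub>M count_space UNIV"
proof (induction j)
  case (Suc j)
  have "(\<lambda>\<omega>. f i (iterate_maps f (\<lambda>i. C i \<omega>) y j)) \<in> N \<rightarrow>\<^sub>M count_space UNIV" for i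
    using Suc by (rule measurable_compose) simp
  from measurable_compose_countable[OF this assms] show ?case by simp
qed simp

section \<open>Law and independence of the cell marks, and the Markov identity for a fixed
  start\<close>

context poisson_lip
begin

lemma marked_union:
  assumes n: "1 \<le> n"
  shows "(\<Union>i<j. marked k n i) \<in> sets \<phi>" "emeasure \<phi> (\<Union>i<j. marked k n i) < \<infinity>"
proof -
  show "(\<Union>i<j. marked k n i) \<in> sets \<phi>" using marked_sets[OF n] by (intro sets.finite_UN) auto
  have "(\<Union>i<j. marked k n i) \<subseteq> moving k n" using marked_moving by blast
  from emeasure_mono[OF this moving_sets[OF n]]
  show "emeasure \<phi> (\<Union>i<j. marked k n i) < \<infinity>" using moving_finite[OF n] by (rule order_le_less_trans)
qed

lemma cell_mark_event:
  assumes n: "1 \<le> n" and a: "0 \<le> a"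
  shows "{\<omega>\<in>space M. j \<le> cell_mark k n (X \<omega>) a b} \<in> sets point_algebra"
proof -
  have "{a<..b} \<times> (\<Union>i<j. marked k n i) \<in> sets \<mu>"
    using a by (intro box_sets marked_union(1)[OF n]) auto
  from empty_events[OF this] have "{\<omega>\<in>space point_algebra. j \<le> card (marks k n) \<and>
      X \<omega> \<inter> {a<..b} \<times> (\<Union>i<j. marked k n i) = {}} \<in> sets point_algebra"
    unfolding space_point_algebra[symmetric]
    by (rule sets.sets_Collect_conj[OF _ sets.sets_Collect_const])
  then show ?thesis unfolding le_cell_mark_iff space_point_algebra .
qed

lemma measurable_cell_mark:
  assumes n: "1 \<le> n" and a: "0 \<le> a"
  shows "(\<lambda>\<omega>. cell_mark k n (X \<omega>) a b) \<in> point_algebra \<rightarrow>\<^sub>M count_space UNIV"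
proof (subst measurable_count_space_eq2_countable, safe)
  fix j
  have "(\<lambda>\<omega>. cell_mark k n (X \<omega>) a b) -` {j} \<inter> space point_algebra =
      {\<omega>\<in>space M. j \<le> cell_mark k n (X \<omega>) a b} - {\<omega>\<in>space M. Suc j \<le> cell_mark k n (X \<omega>) a b}"
    by auto
  then show "(\<lambda>\<omega>. cell_mark k n (X \<omega>) a b) -` {j} \<inter> space point_algebra \<in> sets point_algebra"
    using cell_mark_event[OF n a] by simp
qed auto

lemma measurable_from_point_algebra:
  "f \<in> point_algebra \<rightarrow>\<^sub>M N \<Longrightarrow> f \<in> M \<rightarrow>\<^sub>M N"
  by (rule measurable_from_subalg[OF subalgebra_point_algebra])

lemma prob_le_cell_mark:
  assumes n: "1 \<le> n" and a: "0 \<le> a" "a \<le> b"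
  shows "prob {\<omega>\<in>space M. j \<le> cell_mark k n (X \<omega>) a b} =
    (if j \<le> card (marks k n) then exp (- ((b - a) * measure \<phi> (\<Union>i<j. marked k n i))) else 0)"
proof (cases "j \<le> card (marks k n)")
  case True
  let ?S = "\<Union>i<j. marked k n i"
  have I: "{a<..b} \<in> sets borel" "{a<..b} \<subseteq> {0..}" using a by auto
  have em: "emeasure \<mu> ({a<..b} \<times> ?S) = ennreal (b - a) * emeasure \<phi> ?S"
    using a by (subst emeasure_box[OF I marked_union(1)[OF n]]) simp
  have "prob {\<omega>\<in>space M. X \<omega> \<inter> {a<..b} \<times> ?S = {}} = exp (- measure \<mu> ({a<..b} \<times> ?S))"
    using marked_union(2)[OF n, of j]
    by (intro prob_empty box_sets[OF I marked_union(1)[OF n]]) (simp add: em ennreal_mult_less_top)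
  also have "measure \<mu> ({a<..b} \<times> ?S) = (b - a) * measure \<phi> ?S"
    unfolding measure_def em using a by (simp add: enn2real_mult)
  finally show ?thesis using True by (simp add: le_cell_mark_iff)
next
  case False
  then show ?thesis by (simp add: le_cell_mark_iff)
qed

text \<open>Point probabilities are differences of tail probabilities, and by
  \<open>prob_le_cell_mark\<close> those depend on the cell through \<open>b - a\<close>
  only.\<close>

lemma cell_mark_law:
  assumes n: "1 \<le> n" and "0 \<le> a" "a \<le> b" "0 \<le> a'" "a' \<le> b'" "b - a = b' - a'"
  shows "prob {\<omega>\<in>space M. R (cell_mark k n (X \<omega>) a b)} = prob {\<omega>\<in>space M. R (cell_mark k n (X \<omega>) a' b')}"
proof -
  have sum: "prob {\<omega>\<in>space M. R (cell_mark k n (X \<omega>) a b)} =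
    (\<Sum>j\<le>card (marks k n). if R j then prob {\<omega>\<in>space M. j \<le> cell_mark k n (X \<omega>) a b} -
       prob {\<omega>\<in>space M. Suc j \<le> cell_mark k n (X \<omega>) a b} else 0)"
    if ab: "0 \<le> a" "a \<le> b" for a b
  proof -
    let ?C = "\<lambda>\<omega>. cell_mark k n (X \<omega>) a b"
    note C = measurable_from_point_algebra[OF measurable_cell_mark[OF n ab(1), of b]]
    have ev: "{\<omega>\<in>space M. S (?C \<omega>)} \<in> events" for S
      using measurable_sets[OF C, of "{j. S j}"] by (simp add: vimage_def Int_def conj_commute)
    have "prob {\<omega>\<in>space M. R (?C \<omega>)} = (\<Sum>j\<in>{..card (marks k n)}. prob {\<omega>\<in>space M. R (?C \<omega>) \<and> ?C \<omega> = j})"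
    proof (rule prob_sum_values)
      show "?C \<omega> \<in> {..card (marks k n)}" for \<omega>
        using le_cell_mark_iff[of "Suc (card (marks k n))" k n "X \<omega>" a b] by simp
      show "{\<omega>\<in>space M. R (?C \<omega>) \<and> ?C \<omega> = j} \<in> events" for j
        by (rule ev)
    qed simp
    also have "\<dots> = (\<Sum>j\<in>{..card (marks k n)}. if R j then prob {\<omega>\<in>space M. j \<le> ?C \<omega>} -
       prob {\<omega>\<in>space M. Suc j \<le> ?C \<omega>} else 0)"
    proof (intro sum.cong refl)
      fix j
      have "prob {\<omega>\<in>space M. ?C \<omega> = j} = prob ({\<omega>\<in>space M. j \<le> ?C \<omega>} - {\<omega>\<in>space M. Suc j \<le> ?C \<omega>})"
        by (rule arg_cong[where f = prob]) auto
      also have "\<dots> = prob {\<omega>\<in>space M. j \<le> ?C \<omega>} - prob {\<omega>\<in>space M. Suc j \<le> ?C \<omega>}"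
        by (intro finite_measure_Diff ev) auto
      finally have eq: "prob {\<omega>\<in>space M. ?C \<omega> = j} =
        prob {\<omega>\<in>space M. j \<le> ?C \<omega>} - prob {\<omega>\<in>space M. Suc j \<le> ?C \<omega>}" .
      have "{\<omega>\<in>space M. R (?C \<omega>) \<and> ?C \<omega> = j} = (if R j then {\<omega>\<in>space M. ?C \<omega> = j} else {})"
        by auto
      then show "prob {\<omega>\<in>space M. R (?C \<omega>) \<and> ?C \<omega> = j} =
        (if R j then prob {\<omega>\<in>space M. j \<le> ?C \<omega>} - prob {\<omega>\<in>space M. Suc j \<le> ?C \<omega>} else 0)"
        using eq by simp
    qed
    finally show ?thesis by simp
  qed
  show ?thesis
    unfolding sum[OF assms(2,3)] sum[OF assms(4,5)]
    using assms by (simp only: prob_le_cell_mark)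
qed

lemma indep_cell_marks:
  assumes n: "1 \<le> n" and \<tau>0: "0 \<le> \<tau> 0" and mono: "\<And>i. \<tau> i \<le> \<tau> (Suc i)"
  shows "indep_vars (\<lambda>_. count_space UNIV) (\<lambda>i \<omega>. cell_mark k n (X \<omega>) (\<tau> i) (\<tau> (Suc i))) UNIV"
proof -
  \<comment> \<open>The Poisson property gives independence along one sequence of disjoint sets, so
    the boxes (cell \<open>i\<close>, map index \<open>j\<close>) are coded into a single sequence.
    \<open>K i\<close> collects the codes of cell \<open>i\<close>, and \<open>Y i\<close> rebuilds
    its mark from the counts there.\<close>
  define B where "B = (\<lambda>p. case prod_decode p of (i, j) \<Rightarrow> {\<tau> i<..\<tau> (Suc i)} \<times> marked k n j)"
  define K where "K = (\<lambda>i. range (\<lambda>j. prod_encode (i, j)))"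
  define Y where "Y = (\<lambda>i v. LEAST j. v (prod_encode (i, j)) \<noteq> (0::ennreal) \<or> card (marks k n) \<le> j)"
  have \<tau>: "0 \<le> \<tau> i" for i
    using lift_Suc_mono_le[of \<tau> 0 i, OF mono] \<tau>0 by simp
  have B_sets: "range B \<subseteq> sets \<mu>"
  proof safe
    fix p
    obtain i j where p: "prod_decode p = (i, j)" by fastforce
    have "{\<tau> i<..\<tau> (Suc i)} \<subseteq> {0..}" using \<tau>[of i] by auto
    then show "B p \<in> sets \<mu>"
      unfolding B_def p using box_sets marked_sets[OF n] by simp
  qed
  have B_disj: "disjoint_family B"
    unfolding disjoint_family_on_def
  proof (intro ballI impI)
    fix p q :: nat assume "p \<noteq> q"
    obtain i j where p: "prod_decode p = (i, j)" by fastforce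
    obtain i' j' where q: "prod_decode q = (i', j')" by fastforce
    have ij: "(i, j) \<noteq> (i', j')" using \<open>p \<noteq> q\<close> p q by (metis prod_decode_inverse)
    have cells: "{\<tau> i<..\<tau> (Suc i)} \<inter> {\<tau> i'<..\<tau> (Suc i')} = {}" if "i < i'" for i i'
      using lift_Suc_mono_le[of \<tau> "Suc i" i', OF mono] that by auto
    show "B p \<inter> B q = {}"
    proof (cases "i = i'")
      case True
      then have "marked k n j \<inter> marked k n j' = {}" using marked_inj ij by blast
      then show ?thesis unfolding B_def p q by auto
    next
      case False
      then have "{\<tau> i<..\<tau> (Suc i)} \<inter> {\<tau> i'<..\<tau> (Suc i')} = {}"
        using cells[of i i'] cells[of i' i] by (metis Int_commute nat_neq_iff)
      then show ?thesis unfolding B_def p q by auto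
    qed
  qed
  have "indep_vars (\<lambda>_. borel) (\<lambda>p. points_in X (B p)) UNIV"
    using ppp B_sets B_disj unfolding poisson_point_process_def by blast
  then have "indep_vars (\<lambda>i. PiM (K i) (\<lambda>_. borel))
      (\<lambda>i \<omega>. restrict (\<lambda>p. points_in X (B p) \<omega>) (K i)) UNIV"
  proof (rule indep_vars_restrict)
    show "disjoint_family_on K UNIV"
      by (auto simp: disjoint_family_on_def K_def)
  qed simp
  then have "indep_vars (\<lambda>_. count_space UNIV)
      (\<lambda>i \<omega>. Y i (restrict (\<lambda>p. points_in X (B p) \<omega>) (K i))) UNIV"
  proof (rule indep_vars_compose2)
    fix i
    have [measurable]: "(\<lambda>v. v (prod_encode (i, j))) \<in> PiM (K i) (\<lambda>_. borel) \<rightarrow>\<^sub>M (borel :: ennreal measure)" for j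
      by (rule measurable_component_singleton) (simp add: K_def)
    show "Y i \<in> PiM (K i) (\<lambda>_. borel) \<rightarrow>\<^sub>M count_space UNIV"
      unfolding Y_def by measurable
  qed
  moreover have "Y i (restrict (\<lambda>p. points_in X (B p) \<omega>) (K i)) = cell_mark k n (X \<omega>) (\<tau> i) (\<tau> (Suc i))" for i \<omega>
  proof -
    have "prod_encode (i, j) \<in> K i" for j by (simp add: K_def)
    then show ?thesis
      by (simp add: Y_def cell_mark_def points_in_eq_0 B_def)
  qed
  ultimately show ?thesis by simp
qed

lemma eventually_approx:
  assumes n: "1 \<le> n" and y: "y \<in> partitions k {1..n}"
    and \<omega>: "\<omega> \<in> space M" "regular_points k (X \<omega>)"
    and s: "0 \<le> s" and t: "0 \<le> t"
    and c: "\<And>m. u \<le> two_step_grid s t m (c m)" "\<And>m. two_step_grid s t m (c m) \<le> u + max s t / real (Suc m)"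
  shows "eventually (\<lambda>m. iterate_maps (mark k n)
      (\<lambda>i. cell_mark k n (X \<omega>) (two_step_grid s t m i) (two_step_grid s t m (Suc i))) y (c m) =
      Lambda_fin k n (X \<omega>) y u) sequentially"
proof (rule eventually_iterate_cell_marks[OF k n \<omega>(2) X_subset[OF \<omega>(1)] y, where \<delta> = "\<lambda>m. max s t / real (Suc m)"])
  show "two_step_grid s t m 0 = 0" for m by (rule two_step_grid_0)
  show "two_step_grid s t m i \<le> two_step_grid s t m (Suc i)" for m i
    by (rule two_step_grid_mono[OF s t])
  show "two_step_grid s t m (Suc i) \<le> two_step_grid s t m i + max s t / real (Suc m)" for m i
  proof -
    have "(if i \<le> m then s else t) / real (Suc m) \<le> max s t / real (Suc m)"
      by (intro divide_right_mono) auto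
    with two_step_grid_increment[of s t m i] show ?thesis by linarith
  qed
  show "(\<lambda>m. max s t / real (Suc m)) \<longlonglongrightarrow> 0"
    using LIMSEQ_Suc[OF lim_const_over_n[of "max s t"]] by simp
qed (fact c)+

text \<open>On regular configurations the path has value \<open>z\<close> exactly if the discretised
  paths eventually do, and these are functions of cell marks; on the others the path is constant.
  Countable operations then stay inside \<open>point_algebra\<close>.\<close>

lemma Lambda_fin_event:
  assumes n: "1 \<le> n" and y: "y \<in> partitions k {1..n}" and u: "0 \<le> u"
  shows "{\<omega>\<in>space M. Lambda_fin k n (X \<omega>) y u = z} \<in> sets point_algebra"
proof -
  \<comment> \<open>With second increment \<open>0\<close> the grid reaches \<open>u\<close> exactly
    at index \<open>Suc m\<close>.\<close>
  let ?D = "\<lambda>m \<omega>. iterate_maps (mark k n)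
      (\<lambda>i. cell_mark k n (X \<omega>) (two_step_grid u 0 m i) (two_step_grid u 0 m (Suc i))) y (Suc m)"
  let ?r = "\<lambda>\<omega>. regular_points k (X \<omega>)"
  have D: "{\<omega>\<in>space point_algebra. ?D m \<omega> = z} \<in> sets point_algebra" for m
  proof -
    have "(\<lambda>\<omega>. ?D m \<omega>) \<in> point_algebra \<rightarrow>\<^sub>M count_space UNIV"
      by (intro measurable_iterate_maps measurable_cell_mark[OF n] two_step_grid_nonneg u order_refl)
    from measurable_sets[OF this, of "{z}"] show ?thesis
      by (simp add: vimage_def Int_def conj_commute)
  qed
  have r: "{\<omega>\<in>space point_algebra. ?r \<omega>} \<in> sets point_algebra"
    using regular_event by simp
  have "Lambda_fin k n (X \<omega>) y u = z \<longleftrightarrow> (?r \<omega> \<and> (\<exists>m0. \<forall>m\<in>{m0..}. ?D m \<omega> = z)) \<or> (\<not> ?r \<omega> \<and> y = z)"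
    if "\<omega> \<in> space M" for \<omega>
  proof (cases "?r \<omega>")
    case True
    have ev: "eventually (\<lambda>m. ?D m \<omega> = Lambda_fin k n (X \<omega>) y u) sequentially"
      using u by (intro eventually_approx[OF n y that True]) (simp_all only: two_step_grid_mid, auto)
    have "Lambda_fin k n (X \<omega>) y u = z \<longleftrightarrow> eventually (\<lambda>m. ?D m \<omega> = z) sequentially"
    proof
      assume "eventually (\<lambda>m. ?D m \<omega> = z) sequentially"
      with ev have "eventually (\<lambda>m::nat. Lambda_fin k n (X \<omega>) y u = z) sequentially"
        by eventually_elim simp
      then show "Lambda_fin k n (X \<omega>) y u = z" by simp
    qed (use ev in simp)
    then show ?thesis using True by (simp only: eventually_sequentially Ball_def atLeast_iff simp_thms)
  next
    case False
    then show ?thesis using y by (simp add: Lambda_fin_irregular partitions_restrict_same)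
  qed
  then have "{\<omega>\<in>space M. Lambda_fin k n (X \<omega>) y u = z} =
    {\<omega>\<in>space point_algebra. (?r \<omega> \<and> (\<exists>m0. \<forall>m\<in>{m0..}. ?D m \<omega> = z)) \<or> (\<not> ?r \<omega> \<and> y = z)}"
    unfolding space_point_algebra by blast
  also have "\<dots> \<in> sets point_algebra"
    by (intro sets.sets_Collect_disj sets.sets_Collect_conj sets.sets_Collect_neg
        sets.sets_Collect_const sets.sets_Collect_countable_Ex sets.sets_Collect_countable_Ball r D)
  finally show ?thesis .
qed

lemma Lambda_fin_past_event:
  assumes n: "1 \<le> n" and y: "y \<in> partitions k {1..n}" and U: "finite U" "U \<subseteq> {0..}" and v: "0 \<le> v"
  shows "{\<omega>\<in>space M. (\<forall>u\<in>U. Lambda_fin k n (X \<omega>) y u \<in> B u) \<and> Lambda_fin k n (X \<omega>) y v = z} \<in> sets point_algebra"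
proof -
  let ?P = "partitions k {1..n}"
  have mem: "Lambda_fin k n (X \<omega>) y u \<in> ?P" if "\<omega> \<in> space M" for \<omega> u
    using y by (intro Lambda_fin_in[OF k n X_subset[OF that]]) (simp add: partitions_restrict_same)
  have "{\<omega>\<in>space point_algebra. Lambda_fin k n (X \<omega>) y u \<in> B u} \<in> sets point_algebra" if "u \<in> U" for u
  proof -
    have "{\<omega>\<in>space point_algebra. \<exists>b\<in>B u \<inter> ?P. Lambda_fin k n (X \<omega>) y u = b} \<in> sets point_algebra"
      using Lambda_fin_event[OF n y, of u] U(2) that finite_partitions
      by (intro sets.sets_Collect_finite_Ex) auto
    moreover have "{\<omega>\<in>space point_algebra. \<exists>b\<in>B u \<inter> ?P. Lambda_fin k n (X \<omega>) y u = b} =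
        {\<omega>\<in>space point_algebra. Lambda_fin k n (X \<omega>) y u \<in> B u}"
      using mem by auto
    ultimately show ?thesis by simp
  qed
  then have "{\<omega>\<in>space point_algebra. \<forall>u\<in>U. Lambda_fin k n (X \<omega>) y u \<in> B u} \<in> sets point_algebra"
    using U(1) by (intro sets.sets_Collect_finite_All) auto
  moreover have "{\<omega>\<in>space point_algebra. Lambda_fin k n (X \<omega>) y v = z} \<in> sets point_algebra"
    using Lambda_fin_event[OF n y v] by simp
  ultimately have "{\<omega>\<in>space point_algebra. (\<forall>u\<in>U. Lambda_fin k n (X \<omega>) y u \<in> B u) \<and>
      Lambda_fin k n (X \<omega>) y v = z} \<in> sets point_algebra"
    by (intro sets.sets_Collect_conj)
  then show ?thesis by simp
qed

lemma Lambda_fin_markov_const: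
  assumes n: "1 \<le> n" and y: "y \<in> partitions k {1..n}" and s: "0 \<le> s" and t: "0 \<le> t"
    and U: "finite U" "U \<subseteq> {0..s}"
  shows "prob {\<omega>\<in>space M. (\<forall>u\<in>U. Lambda_fin k n (X \<omega>) y u \<in> B u) \<and> Lambda_fin k n (X \<omega>) y (s + t) = z} =
    (\<Sum>w\<in>partitions k {1..n}.
      prob {\<omega>\<in>space M. (\<forall>u\<in>U. Lambda_fin k n (X \<omega>) y u \<in> B u) \<and> Lambda_fin k n (X \<omega>) y s = w} *
      prob {\<omega>\<in>space M. Lambda_fin k n (X \<omega>) w t = z})"
proof -
  let ?P = "partitions k {1..n}"
  define C where "C = (\<lambda>m i \<omega>. cell_mark k n (X \<omega>) (two_step_grid s t m i) (two_step_grid s t m (Suc i)))"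
  \<comment> \<open>The restarted dynamics: a uniform grid from time \<open>0\<close> whose cells
    have the same length as those of \<open>C\<close> after \<open>s\<close>, hence marks of the
    same law.\<close>
  define C' where "C' = (\<lambda>m i \<omega>. cell_mark k n (X \<omega>) (two_step_grid t t m i) (two_step_grid t t m (Suc i)))"
  define c where "c = (\<lambda>m u. nat \<lceil>u * real (Suc m) / s\<rceil>)"
  define D where "D = (\<lambda>m \<omega>. iterate_maps (mark k n) (\<lambda>i. C m i \<omega>) y)"
  define D' where "D' = (\<lambda>m w \<omega>. iterate_maps (mark k n) (\<lambda>i. C' m i \<omega>) w)"
  define Q where "Q = (\<lambda>m v. \<forall>u\<in>U. iterate_maps (mark k n) v y (c m u) \<in> B u)"
  have U0: "U \<subseteq> {0..}" using U(2) by auto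
  have c: "c m u \<le> Suc m" "u \<le> two_step_grid s t m (c m u)"
      "two_step_grid s t m (c m u) \<le> u + max s t / real (Suc m)" if "u \<in> U" for m u
  proof -
    have u: "0 \<le> u" "u \<le> s" using U that by auto
    have "s / real (Suc m) \<le> max s t / real (Suc m)" by (intro divide_right_mono) auto
    with two_step_grid_index(1)[OF u, of m] two_step_grid_index(2,3)[OF u, where m = m and t = t] show
      "c m u \<le> Suc m" "u \<le> two_step_grid s t m (c m u)"
      "two_step_grid s t m (c m u) \<le> u + max s t / real (Suc m)"
      unfolding c_def by (auto intro: order_trans)
  qed
  \<comment> \<open>Rounding up a time of \<open>U\<close> never passes \<open>s\<close>, as
    \<open>c m u \<le> Suc m\<close>, so the discretised past is a predicate of the first
    \<open>Suc m\<close> marks.\<close>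
  have QD: "Q m (restrict (\<lambda>i. C m i \<omega>) {..<Suc m}) \<longleftrightarrow> (\<forall>u\<in>U. D m \<omega> (c m u) \<in> B u)" for m \<omega>
    unfolding Q_def D_def using c(1) by (simp add: iterate_maps_restrict)
  have ind: "indep_vars (\<lambda>_. count_space UNIV) (C m) UNIV" for m
    unfolding C_def using s t
    by (intro indep_cell_marks[OF n] two_step_grid_mono) (simp add: two_step_grid_0)
  have ind': "indep_vars (\<lambda>_. count_space UNIV) (C' m) UNIV" for m
    unfolding C'_def using t
    by (intro indep_cell_marks[OF n] two_step_grid_mono) (simp add: two_step_grid_0)
  have markov: "prob {\<omega>\<in>space M. (\<forall>u\<in>U. D m \<omega> (c m u) \<in> B u) \<and> D m \<omega> (Suc m + Suc m) = z} =
    (\<Sum>w\<in>?P. prob {\<omega>\<in>space M. (\<forall>u\<in>U. D m \<omega> (c m u) \<in> B u) \<and> D m \<omega> (Suc m) = w} *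
      prob {\<omega>\<in>space M. D' m w \<omega> (Suc m) = z})" for m
  proof -
    have "prob {\<omega>\<in>space M. R (C m (Suc m + i) \<omega>)} = prob {\<omega>\<in>space M. R (C' m i \<omega>)}" for i R
      unfolding C_def C'_def
    proof (intro cell_mark_law[OF n] two_step_grid_nonneg two_step_grid_mono s t)
      show "two_step_grid s t m (Suc (Suc m + i)) - two_step_grid s t m (Suc m + i) =
        two_step_grid t t m (Suc i) - two_step_grid t t m i"
        unfolding two_step_grid_increment by simp
    qed
    note step = prob_iterate_maps_markov[where f = "mark k n", OF ind ind' this finite_partitions mark_in y,
        where Q = "Q m" and i = "Suc m" and z = z, unfolded QD, unfolded D_def]
    show ?thesis unfolding D_def D'_def by (rule step)
  qed
  have appr: "eventually (\<lambda>m. D m \<omega> (d m) = Lambda_fin k n (X \<omega>) y u) sequentially"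
    if "\<omega> \<in> space M" "regular_points k (X \<omega>)" "\<And>m. u \<le> two_step_grid s t m (d m)"
      "\<And>m. two_step_grid s t m (d m) \<le> u + max s t / real (Suc m)" for \<omega> u d
    unfolding D_def C_def using that by (intro eventually_approx[OF n y] s t)
  have past: "eventually (\<lambda>m. \<forall>u\<in>U. D m \<omega> (c m u) = Lambda_fin k n (X \<omega>) y u) sequentially"
    if "\<omega> \<in> space M" "regular_points k (X \<omega>)" for \<omega>
    using U(1) c(2,3) by (intro eventually_ball_finite ballI appr that)
  have D_events: "{\<omega>\<in>space M. (\<forall>u\<in>U. D m \<omega> (c m u) \<in> B u) \<and> D m \<omega> (Suc m + i) = w} \<in> events" for m i w
    unfolding QD[symmetric] unfolding D_def by (rule events_iterate_maps[OF ind])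
  \<comment> \<open>Used twice: \<open>i m = 0\<close> gives the time \<open>s\<close>, and
    \<open>i m = Suc m\<close> gives \<open>s + t\<close>.\<close>
  have lim: "(\<lambda>m. prob {\<omega>\<in>space M. (\<forall>u\<in>U. D m \<omega> (c m u) \<in> B u) \<and> D m \<omega> (Suc m + i m) = w}) \<longlonglongrightarrow>
      prob {\<omega>\<in>space M. (\<forall>u\<in>U. Lambda_fin k n (X \<omega>) y u \<in> B u) \<and> Lambda_fin k n (X \<omega>) y v = w}"
    if i: "\<And>m. two_step_grid s t m (Suc m + i m) = v" and v: "0 \<le> v" for i v w
  proof (rule prob_tendsto_eventually_eq)
    show "{\<omega>\<in>space M. (\<forall>u\<in>U. D m \<omega> (c m u) \<in> B u) \<and> D m \<omega> (Suc m + i m) = w} \<in> events" for m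
      by (rule D_events)
    show "{\<omega>\<in>space M. (\<forall>u\<in>U. Lambda_fin k n (X \<omega>) y u \<in> B u) \<and> Lambda_fin k n (X \<omega>) y v = w} \<in> events"
      by (intro point_algebra_events Lambda_fin_past_event n y U(1) U0 v)
    show "AE \<omega> in M. eventually (\<lambda>m.
        ((\<forall>u\<in>U. D m \<omega> (c m u) \<in> B u) \<and> D m \<omega> (Suc m + i m) = w) \<longleftrightarrow>
        ((\<forall>u\<in>U. Lambda_fin k n (X \<omega>) y u \<in> B u) \<and> Lambda_fin k n (X \<omega>) y v = w)) sequentially"
      using AE_regular AE_space
    proof eventually_elim
      case (elim \<omega>)
      have "eventually (\<lambda>m. D m \<omega> (Suc m + i m) = Lambda_fin k n (X \<omega>) y v) sequentially"
        using elim s by (intro appr) (simp_all only: i, auto)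
      with past[OF elim(2,1)] show ?case
        by eventually_elim simp
    qed
  qed
  have lim': "(\<lambda>m. prob {\<omega>\<in>space M. D' m w \<omega> (Suc m) = z}) \<longlonglongrightarrow>
      prob {\<omega>\<in>space M. Lambda_fin k n (X \<omega>) w t = z}" if w: "w \<in> ?P" for w
  proof (rule prob_tendsto_eventually_eq)
    show "{\<omega>\<in>space M. D' m w \<omega> (Suc m) = z} \<in> events" for m
      using events_iterate_maps[OF ind'[of m], of "\<lambda>_. True" 0 "mark k n" w "Suc m" z]
      unfolding D'_def by simp
    show "{\<omega>\<in>space M. Lambda_fin k n (X \<omega>) w t = z} \<in> events"
      by (intro point_algebra_events Lambda_fin_event n w t)
    show "AE \<omega> in M. eventually (\<lambda>m. D' m w \<omega> (Suc m) = z \<longleftrightarrow> Lambda_fin k n (X \<omega>) w t = z) sequentially"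
      using AE_regular AE_space
    proof eventually_elim
      case (elim \<omega>)
      have "eventually (\<lambda>m. D' m w \<omega> (Suc m) = Lambda_fin k n (X \<omega>) w t) sequentially"
        unfolding D'_def C'_def using elim t
        by (intro eventually_approx[OF n w]) (simp_all only: two_step_grid_mid, auto)
      then show ?case by eventually_elim simp
    qed
  qed
  have "(\<lambda>m. prob {\<omega>\<in>space M. (\<forall>u\<in>U. D m \<omega> (c m u) \<in> B u) \<and> D m \<omega> (Suc m + Suc m) = z}) \<longlonglongrightarrow>
    (\<Sum>w\<in>?P. prob {\<omega>\<in>space M. (\<forall>u\<in>U. Lambda_fin k n (X \<omega>) y u \<in> B u) \<and> Lambda_fin k n (X \<omega>) y s = w} *
      prob {\<omega>\<in>space M. Lambda_fin k n (X \<omega>) w t = z})"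
    unfolding markov
    by (intro tendsto_sum tendsto_mult lim' lim[of "\<lambda>_. 0" s, unfolded add_0_right, OF two_step_grid_mid s])
  moreover have "(\<lambda>m. prob {\<omega>\<in>space M. (\<forall>u\<in>U. D m \<omega> (c m u) \<in> B u) \<and> D m \<omega> (Suc m + Suc m) = z}) \<longlonglongrightarrow>
     prob {\<omega>\<in>space M. (\<forall>u\<in>U. Lambda_fin k n (X \<omega>) y u \<in> B u) \<and> Lambda_fin k n (X \<omega>) y (s + t) = z}"
    by (rule lim[of Suc "s + t", OF two_step_grid_end]) (use s t in simp)
  ultimately show ?thesis by (rule LIMSEQ_unique[rotated])
qed

end

section \<open>The Markov property\<close>

text \<open>A diagonal gluing: the colour of \<open>i\<close> is read off at level \<open>i\<close>,
  the smallest one containing it. By consistency every higher level gives the same colour.\<close>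

definition Lambda_inf :: "nat \<Rightarrow> (real \<times> colouring_map) set \<Rightarrow> colouring \<Rightarrow> real \<Rightarrow> colouring" where
  "Lambda_inf k X l t = (\<lambda>i\<in>{1..}. Lambda_fin k i X l t i)"

lemma restrict_Lambda_inf:
  assumes k: "1 \<le> k" and X: "X \<subseteq> T \<times> Lip k {1..}" and l: "l \<in> partitions k {1..}" and n: "1 \<le> n"
  shows "restrict (Lambda_inf k X l t) {1..n} = Lambda_fin k n X l t"
proof
  fix i
  have l': "restrict l {1..n} \<in> partitions k {1..n}"
    using restrict_in_partitions[OF l] by auto
  show "restrict (Lambda_inf k X l t) {1..n} i = Lambda_fin k n X l t i"
  proof (cases "i \<in> {1..n}")
    case True
    then have "restrict (Lambda_fin k n X l t) {1..i} i = Lambda_fin k i X l t i"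
      using Lambda_fin_mono[OF k _ _ X l', of i t] by simp
    with True show ?thesis by (simp add: Lambda_inf_def)
  next
    case False
    then show ?thesis
      using Lambda_fin_in[OF k n X l', of t] by (auto simp: partitions_def PiE_iff extensional_def)
  qed
qed

lemma Lambda_inf_in:
  assumes k: "1 \<le> k" and X: "X \<subseteq> T \<times> Lip k {1..}" and l: "l \<in> partitions k {1..}"
  shows "Lambda_inf k X l t \<in> partitions k {1..}"
proof -
  have "Lambda_fin k i X l t i \<in> {1..k}" if "1 \<le> i" for i
  proof -
    have "restrict l {1..i} \<in> partitions k {1..i}" using restrict_in_partitions[OF l] by auto
    from Lambda_fin_in[OF k that X this, of t] that show ?thesis
      by (auto simp: partitions_def PiE_iff)
  qed
  then show ?thesis by (auto simp: partitions_def Lambda_inf_def PiE_iff)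
qed

definition cylinders :: "nat \<Rightarrow> colouring set set" where
  "cylinders k = {(\<lambda>l. restrict l {1..n}) -` B \<inter> partitions k {1..} | n B.
     1 \<le> n \<and> B \<subseteq> partitions k {1..n}}"

lemma cylinder_iff:
  "A \<in> cylinders k \<longleftrightarrow> (\<exists>n\<ge>1. \<exists>Q. A = {l \<in> partitions k {1..}. Q (restrict l {1..n})})"
proof
  assume "A \<in> cylinders k"
  then obtain n B where "1 \<le> n" "A = (\<lambda>l. restrict l {1..n}) -` B \<inter> partitions k {1..}"
    unfolding cylinders_def by blast
  then show "\<exists>n\<ge>1. \<exists>Q. A = {l \<in> partitions k {1..}. Q (restrict l {1..n})}"
    by (intro exI[of _ n] conjI exI[of _ "\<lambda>l. l \<in> B"]) auto
next
  assume "\<exists>n\<ge>1. \<exists>Q. A = {l \<in> partitions k {1..}. Q (restrict l {1..n})}"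
  then obtain n Q where n: "1 \<le> n" and A: "A = {l \<in> partitions k {1..}. Q (restrict l {1..n})}" by blast
  have "restrict l {1..n} \<in> partitions k {1..n}" if "l \<in> partitions k {1..}" for l
    using restrict_in_partitions[OF that] by auto
  then have "A = (\<lambda>l. restrict l {1..n}) -` {l \<in> partitions k {1..n}. Q l} \<inter> partitions k {1..}"
    unfolding A by auto
  with n show "A \<in> cylinders k"
    unfolding cylinders_def by (intro CollectI exI[of _ n] exI[of _ "{l \<in> partitions k {1..n}. Q l}"]) auto
qed

lemma restrict_restrict_le: "m \<le> n \<Longrightarrow> restrict (restrict l {1..n}) {1..m} = restrict l {1..m::nat}"
  by (simp add: restrict_restrict Int_absorb1)

text \<open>Both conditions can be read off from the restriction to the larger of the two
  levels.\<close>

lemma cylinders_Int_stable: "Int_stable (cylinders k)"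
  unfolding Int_stable_def
proof (intro ballI)
  fix A B assume "A \<in> cylinders k" "B \<in> cylinders k"
  then obtain m n Q R where mn: "1 \<le> m" "1 \<le> n" and
    A: "A = {l \<in> partitions k {1..}. Q (restrict l {1..m})}" and
    B: "B = {l \<in> partitions k {1..}. R (restrict l {1..n})}"
    unfolding cylinder_iff by blast
  let ?N = "max m n"
  have "A \<inter> B = {l \<in> partitions k {1..}. Q (restrict (restrict l {1..?N}) {1..m}) \<and>
      R (restrict (restrict l {1..?N}) {1..n})}"
    unfolding A B by (subst (1 2) restrict_restrict_le) auto
  moreover have "1 \<le> ?N" using mn by simp
  ultimately show "A \<inter> B \<in> cylinders k"
    unfolding cylinder_iff
    by (intro exI[of _ ?N] conjI exI[of _ "\<lambda>v. Q (restrict v {1..m}) \<and> R (restrict v {1..n})"])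
qed

lemma cylinders_subset: "cylinders k \<subseteq> Pow (partitions k {1..})"
  unfolding cylinders_def by auto

lemma space_partition_space: "space (partition_space k) = partitions k {1..}"
  unfolding partition_space_def by (rule space_measure_of) auto

lemma sets_partition_space: "sets (partition_space k) = sigma_sets (partitions k {1..}) (cylinders k)"
  unfolding partition_space_def cylinders_def by (rule sets_measure_of) auto

lemma space_in_cylinders: "partitions k {1..} \<in> cylinders k"
  unfolding cylinder_iff by (intro exI[of _ 1] conjI exI[of _ "\<lambda>_. True"]) auto

lemma measurable_restrict_partition:
  assumes "1 \<le> n"
  shows "(\<lambda>l. restrict l {1..n}) \<in> partition_space k \<rightarrow>\<^sub>M count_space (partitions k {1..n})"
proof (rule measurableI)
  show "restrict l {1..n} \<in> space (count_space (partitions k {1..n}))"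
    if "l \<in> space (partition_space k)" for l
    using that restrict_in_partitions[of l k "{1..}" "{1..n}"] by (auto simp: space_partition_space)
  show "(\<lambda>l. restrict l {1..n}) -` B \<inter> space (partition_space k) \<in> sets (partition_space k)"
    if "B \<in> sets (count_space (partitions k {1..n}))" for B
    unfolding sets_partition_space space_partition_space
    using that assms by (intro sigma_sets.Basic) (auto simp: cylinders_def)
qed

section \<open>Random initial states and the Markov property at finite and infinite level\<close>

context poisson_lip
begin

text \<open>Level \<open>n\<close> has finitely many states, so independence from the points only
  needs to be required for singletons. Constants qualify, which lets the same lemmas serve the
  kernel and the process itself.\<close>

definition independent_start :: "nat \<Rightarrow> ('w \<Rightarrow> colouring) \<Rightarrow> bool" where
  "independent_start n \<kappa> \<longleftrightarrow> (\<forall>\<omega>\<in>space M. \<kappa> \<omega> \<in> partitions k {1..n}) \<and>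
     (\<forall>y\<in>partitions k {1..n}. {\<omega>\<in>space M. \<kappa> \<omega> = y} \<in> events \<and>
       (\<forall>E\<in>sets point_algebra. prob ({\<omega>\<in>space M. \<kappa> \<omega> = y} \<inter> E) = prob {\<omega>\<in>space M. \<kappa> \<omega> = y} * prob E))"

lemma independent_start_const: "y \<in> partitions k {1..n} \<Longrightarrow> independent_start n (\<lambda>_. y)"
proof -
  have "{\<omega>\<in>space M. y = y'} = (if y = y' then space M else {})" for y' :: colouring by auto
  moreover have "space M \<inter> E = E" if "E \<in> sets point_algebra" for E
    using sets.sets_into_space[OF that] by auto
  ultimately show "y \<in> partitions k {1..n} \<Longrightarrow> ?thesis"
    unfolding independent_start_def by (simp add: prob_space)
qed

text \<open>Split according to the initial state. On \<open>\<kappa> \<omega> = y\<close> the path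
  is the one started at the constant \<open>y\<close>, whose events lie in
  \<open>point_algebra\<close> and are thus independent of the start.\<close>

lemma Lambda_fin_start:
  assumes n: "1 \<le> n" and \<kappa>: "independent_start n \<kappa>" and U: "finite U" "U \<subseteq> {0..}" and v: "0 \<le> v"
  shows "{\<omega>\<in>space M. (\<forall>u\<in>U. Lambda_fin k n (X \<omega>) (\<kappa> \<omega>) u \<in> B u) \<and> Lambda_fin k n (X \<omega>) (\<kappa> \<omega>) v = z} \<in> events"
      (is "?F \<in> _")
    and "prob {\<omega>\<in>space M. (\<forall>u\<in>U. Lambda_fin k n (X \<omega>) (\<kappa> \<omega>) u \<in> B u) \<and> Lambda_fin k n (X \<omega>) (\<kappa> \<omega>) v = z} =
      (\<Sum>y\<in>partitions k {1..n}. prob {\<omega>\<in>space M. \<kappa> \<omega> = y} *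
        prob {\<omega>\<in>space M. (\<forall>u\<in>U. Lambda_fin k n (X \<omega>) y u \<in> B u) \<and> Lambda_fin k n (X \<omega>) y v = z})"
proof -
  let ?P = "partitions k {1..n}"
  let ?E = "\<lambda>y. {\<omega>\<in>space M. (\<forall>u\<in>U. Lambda_fin k n (X \<omega>) y u \<in> B u) \<and> Lambda_fin k n (X \<omega>) y v = z}"
  have E: "?E y \<in> sets point_algebra" if "y \<in> ?P" for y
    by (rule Lambda_fin_past_event[OF n that U v])
  have eq: "{\<omega>\<in>space M. ((\<forall>u\<in>U. Lambda_fin k n (X \<omega>) (\<kappa> \<omega>) u \<in> B u) \<and> Lambda_fin k n (X \<omega>) (\<kappa> \<omega>) v = z) \<and>
      \<kappa> \<omega> = y} = {\<omega>\<in>space M. \<kappa> \<omega> = y} \<inter> ?E y" for y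
    by auto
  have ev: "{\<omega>\<in>space M. \<kappa> \<omega> = y} \<inter> ?E y \<in> events" if "y \<in> ?P" for y
    using \<kappa> that point_algebra_events[OF E[OF that]] unfolding independent_start_def by blast
  have "?F = (\<Union>y\<in>?P. {\<omega>\<in>space M. \<kappa> \<omega> = y} \<inter> ?E y)"
    unfolding eq[symmetric] using \<kappa> unfolding independent_start_def by blast
  also have "\<dots> \<in> events" using ev finite_partitions by (intro sets.finite_UN) auto
  finally show "?F \<in> events" .
  have "prob ?F = (\<Sum>y\<in>?P. prob ({\<omega>\<in>space M. \<kappa> \<omega> = y} \<inter> ?E y))"
    unfolding eq[symmetric]
  proof (rule prob_sum_values[OF finite_partitions])
    show "\<kappa> \<omega> \<in> ?P" if "\<omega> \<in> space M" for \<omega> using \<kappa> that unfolding independent_start_def by blast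
  qed (unfold eq, rule ev)
  also have "\<dots> = (\<Sum>y\<in>?P. prob {\<omega>\<in>space M. \<kappa> \<omega> = y} * prob (?E y))"
    using \<kappa> E unfolding independent_start_def by (intro sum.cong refl) blast
  finally show "prob ?F = \<dots>" .
qed

lemma Lambda_fin_markov_prob:
  fixes B :: "real \<Rightarrow> colouring set"
  assumes n: "1 \<le> n" and \<kappa>: "independent_start n \<kappa>" and s: "0 \<le> s" and t: "0 \<le> t"
    and U: "finite U" "U \<subseteq> {0..s}"
  defines "F \<equiv> \<lambda>v z. {\<omega>\<in>space M. (\<forall>u\<in>U. Lambda_fin k n (X \<omega>) (\<kappa> \<omega>) u \<in> B u) \<and> Lambda_fin k n (X \<omega>) (\<kappa> \<omega>) v = z}"
  shows "prob (F (s + t) z) =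
    (\<Sum>w\<in>partitions k {1..n}. prob (F s w) * prob {\<omega>\<in>space M. Lambda_fin k n (X \<omega>) w t = z})"
proof -
  let ?P = "partitions k {1..n}"
  let ?E = "\<lambda>v z y. prob {\<omega>\<in>space M. (\<forall>u\<in>U. Lambda_fin k n (X \<omega>) y u \<in> B u) \<and> Lambda_fin k n (X \<omega>) y v = z}"
  let ?K = "\<lambda>y. prob {\<omega>\<in>space M. \<kappa> \<omega> = y}"
  let ?q = "\<lambda>w. prob {\<omega>\<in>space M. Lambda_fin k n (X \<omega>) w t = z}"
  have U0: "U \<subseteq> {0..}" using U(2) by auto
  have F: "prob (F v z) = (\<Sum>y\<in>?P. ?K y * ?E v z y)" if "0 \<le> v" for v z
    unfolding F_def by (rule Lambda_fin_start(2)[OF n \<kappa> U(1) U0 that])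
  have "prob (F (s + t) z) = (\<Sum>y\<in>?P. ?K y * (\<Sum>w\<in>?P. ?E s w y * ?q w))"
    using s t by (simp only: F add_nonneg_nonneg Lambda_fin_markov_const[OF n _ s t U] cong: sum.cong)
  also have "\<dots> = (\<Sum>y\<in>?P. \<Sum>w\<in>?P. ?K y * ?E s w y * ?q w)"
    by (simp only: sum_distrib_left mult.assoc)
  also have "\<dots> = (\<Sum>w\<in>?P. \<Sum>y\<in>?P. ?K y * ?E s w y * ?q w)"
    by (rule sum.swap)
  also have "\<dots> = (\<Sum>w\<in>?P. prob (F s w) * ?q w)"
    by (simp only: F[OF s] sum_distrib_right)
  finally show ?thesis .
qed

lemma Lambda_fin_in_partitions:
  "1 \<le> n \<Longrightarrow> \<omega> \<in> space M \<Longrightarrow> y \<in> partitions k {1..n} \<Longrightarrow> Lambda_fin k n (X \<omega>) y t \<in> partitions k {1..n}"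
  using Lambda_fin_in[OF k _ X_subset] by (simp add: partitions_restrict_same)

text \<open>Summing \<open>Lambda_fin_markov_prob\<close> over the final states in \<open>A\<close>
  and rewriting the sum over the states at time \<open>s\<close> as an integral gives the form
  required by \<open>markov_processI\<close>.\<close>

lemma Lambda_fin_markov:
  assumes n: "1 \<le> n" and \<kappa>: "independent_start n \<kappa>" and s: "0 \<le> s" and t: "0 \<le> t"
    and U: "finite U" "U \<subseteq> {0..s}"
  shows "emeasure M {\<omega>\<in>space M. (\<forall>u\<in>U. Lambda_fin k n (X \<omega>) (\<kappa> \<omega>) u \<in> B u) \<and> Lambda_fin k n (X \<omega>) (\<kappa> \<omega>) (s + t) \<in> A} =
    (\<integral>\<^sup>+\<omega>. indicator {\<omega>\<in>space M. \<forall>u\<in>U. Lambda_fin k n (X \<omega>) (\<kappa> \<omega>) u \<in> B u} \<omega> *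
       emeasure M {\<omega>'\<in>space M. Lambda_fin k n (X \<omega>') (Lambda_fin k n (X \<omega>) (\<kappa> \<omega>) s) t \<in> A} \<partial>M)"
proof -
  let ?P = "partitions k {1..n}"
  let ?L = "\<lambda>\<omega>. Lambda_fin k n (X \<omega>) (\<kappa> \<omega>)"
  let ?F = "\<lambda>v z. {\<omega>\<in>space M. (\<forall>u\<in>U. ?L \<omega> u \<in> B u) \<and> ?L \<omega> v = z}"
  let ?Q = "\<lambda>w. {\<omega>\<in>space M. Lambda_fin k n (X \<omega>) w t \<in> A}"
  have U0: "U \<subseteq> {0..}" using U(2) by auto
  have \<kappa>P: "\<kappa> \<omega> \<in> ?P" if "\<omega> \<in> space M" for \<omega>
    using \<kappa> that unfolding independent_start_def by blast
  have LP: "?L \<omega> v \<in> ?P" if "\<omega> \<in> space M" for \<omega> v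
    using Lambda_fin_in_partitions[OF n that \<kappa>P[OF that]] .
  have F: "?F v z \<in> events" if "0 \<le> v" for v z
    by (rule Lambda_fin_start(1)[OF n \<kappa> U(1) U0 that])
  have q_ev: "{\<omega>\<in>space M. Lambda_fin k n (X \<omega>) w t = z} \<in> events" if "w \<in> ?P" for w z
    by (rule point_algebra_events[OF Lambda_fin_event[OF n that t]])
  have finA: "finite (A \<inter> ?P)" using finite_partitions by blast
  have Q: "prob (?Q w) = (\<Sum>z\<in>A \<inter> ?P. prob {\<omega>\<in>space M. Lambda_fin k n (X \<omega>) w t = z})"
    if w: "w \<in> ?P" for w
  proof -
    have eq: "{\<omega>\<in>space M. Lambda_fin k n (X \<omega>) w t \<in> A \<and> Lambda_fin k n (X \<omega>) w t = z} =
        {\<omega>\<in>space M. Lambda_fin k n (X \<omega>) w t = z}" if "z \<in> A \<inter> ?P" for z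
      using that by auto
    show ?thesis
      by (subst prob_sum_values[OF finA, where g = "\<lambda>\<omega>. Lambda_fin k n (X \<omega>) w t"])
        (use Lambda_fin_in_partitions[OF n _ w] in \<open>auto simp: eq intro!: q_ev w\<close>)
  qed
  have eq: "{\<omega>\<in>space M. ((\<forall>u\<in>U. ?L \<omega> u \<in> B u) \<and> ?L \<omega> (s + t) \<in> A) \<and> ?L \<omega> (s + t) = z} = ?F (s + t) z"
    if "z \<in> A \<inter> ?P" for z
    using that by auto
  have st: "0 \<le> s + t" using s t by simp
  have "prob {\<omega>\<in>space M. (\<forall>u\<in>U. ?L \<omega> u \<in> B u) \<and> ?L \<omega> (s + t) \<in> A} =
      (\<Sum>z\<in>A \<inter> ?P. prob {\<omega>\<in>space M. ((\<forall>u\<in>U. ?L \<omega> u \<in> B u) \<and> ?L \<omega> (s + t) \<in> A) \<and> ?L \<omega> (s + t) = z})"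
  proof (rule prob_sum_values[OF finA])
    show "{\<omega>\<in>space M. ((\<forall>u\<in>U. ?L \<omega> u \<in> B u) \<and> ?L \<omega> (s + t) \<in> A) \<and> ?L \<omega> (s + t) = z} \<in> events"
      if "z \<in> A \<inter> ?P" for z
      unfolding eq[OF that] by (rule F[OF st])
  qed (use LP in blast)
  also have "\<dots> = (\<Sum>z\<in>A \<inter> ?P. prob (?F (s + t) z))"
    by (intro sum.cong refl arg_cong[where f = prob] eq)
  also have "\<dots> = (\<Sum>z\<in>A \<inter> ?P. \<Sum>w\<in>?P. prob (?F s w) * prob {\<omega>\<in>space M. Lambda_fin k n (X \<omega>) w t = z})"
    by (intro sum.cong refl Lambda_fin_markov_prob[OF n \<kappa> s t U])
  also have "\<dots> = (\<Sum>w\<in>?P. prob (?F s w) * prob (?Q w))"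
    by (subst sum.swap) (simp add: Q sum_distrib_left)
  finally have "emeasure M {\<omega>\<in>space M. (\<forall>u\<in>U. ?L \<omega> u \<in> B u) \<and> ?L \<omega> (s + t) \<in> A} =
      ennreal (\<Sum>w\<in>?P. prob (?F s w) * prob (?Q w))"
    by (simp add: emeasure_eq_measure)
  also have "\<dots> = (\<Sum>w\<in>?P. emeasure M (?F s w) * emeasure M (?Q w))"
    by (simp add: emeasure_eq_measure ennreal_mult[symmetric] sum_ennreal)
  also have "\<dots> = (\<Sum>w\<in>?P. \<integral>\<^sup>+\<omega>. emeasure M (?Q w) * indicator (?F s w) \<omega> \<partial>M)"
    using F[OF s] by (intro sum.cong refl) (subst nn_integral_cmult_indicator, simp_all add: mult.commute)
  also have "\<dots> = (\<integral>\<^sup>+\<omega>. (\<Sum>w\<in>?P. emeasure M (?Q w) * indicator (?F s w) \<omega>) \<partial>M)"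
    using F[OF s] by (intro nn_integral_sum[symmetric] borel_measurable_times_ennreal
        borel_measurable_indicator borel_measurable_const)
  also have "\<dots> = (\<integral>\<^sup>+\<omega>. indicator {\<omega>\<in>space M. \<forall>u\<in>U. ?L \<omega> u \<in> B u} \<omega> * emeasure M (?Q (?L \<omega> s)) \<partial>M)"
  proof (rule nn_integral_cong)
    fix \<omega> assume \<omega>: "\<omega> \<in> space M"
    have "(\<Sum>w\<in>?P. emeasure M (?Q w) * indicator (?F s w) \<omega>) =
      (\<Sum>w\<in>?P. if w = ?L \<omega> s then indicator {\<omega>\<in>space M. \<forall>u\<in>U. ?L \<omega> u \<in> B u} \<omega> * emeasure M (?Q (?L \<omega> s)) else 0)"
      using \<omega> by (intro sum.cong refl) (auto simp: indicator_def)
    then show "(\<Sum>w\<in>?P. emeasure M (?Q w) * indicator (?F s w) \<omega>) =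
      indicator {\<omega>\<in>space M. \<forall>u\<in>U. ?L \<omega> u \<in> B u} \<omega> * emeasure M (?Q (?L \<omega> s))"
      using LP[OF \<omega>] finite_partitions by simp
  qed
  finally show ?thesis .
qed

lemma measurable_Lambda_fin:
  assumes n: "1 \<le> n" and \<kappa>: "independent_start n \<kappa>" and t: "0 \<le> t"
  shows "(\<lambda>\<omega>. Lambda_fin k n (X \<omega>) (\<kappa> \<omega>) t) \<in> M \<rightarrow>\<^sub>M count_space (partitions k {1..n})"
proof (subst measurable_count_space_eq2[OF finite_partitions], intro conjI ballI)
  show "(\<lambda>\<omega>. Lambda_fin k n (X \<omega>) (\<kappa> \<omega>) t) \<in> space M \<rightarrow> partitions k {1..n}"
    using \<kappa> Lambda_fin_in_partitions[OF n] unfolding independent_start_def by auto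
  show "(\<lambda>\<omega>. Lambda_fin k n (X \<omega>) (\<kappa> \<omega>) t) -` {z} \<inter> space M \<in> events" for z
    using Lambda_fin_start(1)[OF n \<kappa> _ _ t, of "{}" "\<lambda>_. {}" z]
    by (simp add: vimage_def Int_def conj_commute)
qed

text \<open>\<open>Y\<close> only has to agree with the path at nonnegative times and on the space
  of outcomes, so the lemma covers both the finite-level processes and the restrictions of the glued
  process.\<close>

lemma markov_process_fin:
  assumes n: "1 \<le> n" and \<kappa>: "independent_start n \<kappa>"
    and Y: "\<And>t \<omega>. 0 \<le> t \<Longrightarrow> \<omega> \<in> space M \<Longrightarrow> Y t \<omega> = Lambda_fin k n (X \<omega>) (\<kappa> \<omega>) t"
  shows "markov_process M (count_space (partitions k {1..n})) Y"
proof (rule markov_processI[where G = "Pow (partitions k {1..n})"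
      and Z = "\<lambda>t y \<omega>. Lambda_fin k n (X \<omega>) y t"])
  let ?S = "count_space (partitions k {1..n})"
  show "sets ?S = sigma_sets (space ?S) (Pow (partitions k {1..n}))"
    by (simp add: sigma_algebra.sigma_sets_eq[OF sigma_algebra_Pow])
  show "Int_stable (Pow (partitions k {1..n}))" by (auto simp: Int_stable_def)
  show "(\<lambda>\<omega>. Lambda_fin k n (X \<omega>) y t) \<in> M \<rightarrow>\<^sub>M ?S" if "0 \<le> t" "y \<in> space ?S" for t y
    using measurable_Lambda_fin[OF n independent_start_const that(1)] that by simp
  show "Lambda_fin k n (X \<omega>) y 0 = y" if "y \<in> space ?S" for y \<omega>
    using that by (simp add: Lambda_fin_0 partitions_restrict_same)
  show "emeasure M {\<omega>\<in>space M. Lambda_fin k n (X \<omega>) y (s + t) \<in> A} =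
      (\<integral>\<^sup>+\<omega>. emeasure M {\<omega>'\<in>space M. Lambda_fin k n (X \<omega>') (Lambda_fin k n (X \<omega>) y s) t \<in> A} \<partial>M)"
    if "0 \<le> s" "0 \<le> t" "y \<in> space ?S" for s t y A
  proof -
    \<comment> \<open>The flow identity of the kernel is the Markov identity for a constant start
      without conditions on the past.\<close>
    have "independent_start n (\<lambda>_. y)" using that by (intro independent_start_const) simp
    from Lambda_fin_markov[OF n this that(1,2), of "{}" "\<lambda>_. {}" A] show ?thesis
      by (auto intro!: nn_integral_cong)
  qed
  show "Y t \<in> M \<rightarrow>\<^sub>M ?S" if "0 \<le> t" for t
    using measurable_Lambda_fin[OF n \<kappa> that] Y[OF that] by (simp cong: measurable_cong)
  show "emeasure M {\<omega>\<in>space M. (\<forall>u\<in>U. Y u \<omega> \<in> B u) \<and> Y (s + t) \<omega> \<in> A} =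
      (\<integral>\<^sup>+\<omega>. indicator {\<omega>\<in>space M. \<forall>u\<in>U. Y u \<omega> \<in> B u} \<omega> *
         emeasure M {\<omega>'\<in>space M. Lambda_fin k n (X \<omega>') (Y s \<omega>) t \<in> A} \<partial>M)"
    if s: "0 \<le> s" and t: "0 \<le> t" and U: "finite U" "U \<subseteq> {0..s}" for s t U B A
  proof -
    let ?L = "\<lambda>\<omega>. Lambda_fin k n (X \<omega>) (\<kappa> \<omega>)"
    have YU: "(\<forall>u\<in>U. Y u \<omega> \<in> B u) \<longleftrightarrow> (\<forall>u\<in>U. ?L \<omega> u \<in> B u)" if "\<omega> \<in> space M" for \<omega>
      using U(2) Y that by (intro ball_cong refl) auto
    have "{\<omega>\<in>space M. (\<forall>u\<in>U. Y u \<omega> \<in> B u) \<and> Y (s + t) \<omega> \<in> A} =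
        {\<omega>\<in>space M. (\<forall>u\<in>U. ?L \<omega> u \<in> B u) \<and> ?L \<omega> (s + t) \<in> A}"
      using YU Y[of "s + t"] s t by auto
    moreover have "{\<omega>\<in>space M. \<forall>u\<in>U. Y u \<omega> \<in> B u} = {\<omega>\<in>space M. \<forall>u\<in>U. ?L \<omega> u \<in> B u}"
      using YU by auto
    ultimately show ?thesis
      using Lambda_fin_markov[OF n \<kappa> s t U, of B A] Y[OF s] by (simp cong: nn_integral_cong)
  qed
qed auto

lemma markov_process_inf:
  assumes l0: "\<And>\<omega>. \<omega> \<in> space M \<Longrightarrow> l0 \<omega> \<in> partitions k {1..}"
    and \<kappa>: "\<And>n. 1 \<le> n \<Longrightarrow> independent_start n (\<lambda>\<omega>. restrict (l0 \<omega>) {1..n})"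
  shows "markov_process M (partition_space k) (\<lambda>t \<omega>. Lambda_inf k (X \<omega>) (l0 \<omega>) t)"
proof (rule markov_processI[where G = "cylinders k" and Z = "\<lambda>t y \<omega>. Lambda_inf k (X \<omega>) y t"])
  let ?S = "partition_space k" and ?P = "partitions k {1..}"
  have const: "independent_start n (\<lambda>_. restrict y {1..n})" if "y \<in> ?P" for y n
    using restrict_in_partitions[OF that, of "{1..n}"] by (intro independent_start_const) auto
  have restr: "restrict (Lambda_inf k (X \<omega>) l t) {1..n} = Lambda_fin k n (X \<omega>) (restrict l {1..n}) t"
    if "1 \<le> n" "\<omega> \<in> space M" "l \<in> ?P" for \<omega> l t n
    using restrict_Lambda_inf[OF k X_subset[OF that(2)] that(3,1)] by (simp only: Lambda_fin_restrict)
  have inP: "Lambda_inf k (X \<omega>) l t \<in> ?P" if "\<omega> \<in> space M" "l \<in> ?P" for \<omega> l t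
    using Lambda_inf_in[OF k X_subset[OF that(1)] that(2)] .

  have meas: "(\<lambda>\<omega>. Lambda_inf k (X \<omega>) (l \<omega>) t) \<in> M \<rightarrow>\<^sub>M ?S"
    if t: "0 \<le> t" and l: "\<And>\<omega>. \<omega> \<in> space M \<Longrightarrow> l \<omega> \<in> ?P"
      and \<kappa>: "\<And>n. 1 \<le> n \<Longrightarrow> independent_start n (\<lambda>\<omega>. restrict (l \<omega>) {1..n})" for t l
  proof (rule measurable_sigma_sets[OF sets_partition_space cylinders_subset])
    show "(\<lambda>\<omega>. Lambda_inf k (X \<omega>) (l \<omega>) t) \<in> space M \<rightarrow> ?P"
      using inP l by auto
    fix A assume "A \<in> cylinders k"
    then obtain n Q where n: "1 \<le> n" and A: "A = {l \<in> ?P. Q (restrict l {1..n})}"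
      unfolding cylinder_iff by blast
    have "(\<lambda>\<omega>. Lambda_inf k (X \<omega>) (l \<omega>) t) -` A \<inter> space M =
        (\<lambda>\<omega>. Lambda_fin k n (X \<omega>) (restrict (l \<omega>) {1..n}) t) -` {v \<in> partitions k {1..n}. Q v} \<inter> space M"
    proof -
      have "Lambda_inf k (X \<omega>) (l \<omega>) t \<in> A \<longleftrightarrow>
          Lambda_fin k n (X \<omega>) (restrict (l \<omega>) {1..n}) t \<in> {v \<in> partitions k {1..n}. Q v}"
        if "\<omega> \<in> space M" for \<omega>
      proof -
        have "restrict (l \<omega>) {1..n} \<in> partitions k {1..n}"
          using restrict_in_partitions[OF l[OF that], of "{1..n}"] by auto
        then show ?thesis
          unfolding A mem_Collect_eq restr[OF n that l[OF that]]
          using Lambda_fin_in_partitions[OF n that] inP[OF that l[OF that]] by blast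
      qed
      then show ?thesis by blast
    qed
    also have "\<dots> \<in> sets M"
      by (rule measurable_sets[OF measurable_Lambda_fin[OF n \<kappa>[OF n] t]]) auto
    finally show "(\<lambda>\<omega>. Lambda_inf k (X \<omega>) (l \<omega>) t) -` A \<inter> space M \<in> sets M" .
  qed

  have markov: "emeasure M {\<omega>\<in>space M. (\<forall>u\<in>U. Lambda_inf k (X \<omega>) (l \<omega>) u \<in> B u) \<and> Lambda_inf k (X \<omega>) (l \<omega>) (s + t) \<in> A} =
      (\<integral>\<^sup>+\<omega>. indicator {\<omega>\<in>space M. \<forall>u\<in>U. Lambda_inf k (X \<omega>) (l \<omega>) u \<in> B u} \<omega> *
         emeasure M {\<omega>'\<in>space M. Lambda_inf k (X \<omega>') (Lambda_inf k (X \<omega>) (l \<omega>) s) t \<in> A} \<partial>M)"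
    if s: "0 \<le> s" and t: "0 \<le> t" and U: "finite U" "U \<subseteq> {0..s}"
      and B: "\<And>u. u \<in> U \<Longrightarrow> B u \<in> cylinders k" and A: "A \<in> cylinders k"
      and l: "\<And>\<omega>. \<omega> \<in> space M \<Longrightarrow> l \<omega> \<in> ?P"
      and \<kappa>: "\<And>n. 1 \<le> n \<Longrightarrow> independent_start n (\<lambda>\<omega>. restrict (l \<omega>) {1..n})" for s t U B A l
  proof -
    obtain a R where a: "1 \<le> a" and A: "A = {l \<in> ?P. R (restrict l {1..a})}"
      using A unfolding cylinder_iff by blast
    have "\<forall>u\<in>U. \<exists>b Q. 1 \<le> b \<and> B u = {l \<in> ?P. Q (restrict l {1..b})}"
      using B unfolding cylinder_iff by blast
    then obtain b Q where b: "\<And>u. u \<in> U \<Longrightarrow> 1 \<le> b u"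
      and B: "\<And>u. u \<in> U \<Longrightarrow> B u = {l \<in> ?P. Q u (restrict l {1..b u})}"
      by metis
    \<comment> \<open>One level that sees all cylinders involved; the claim then reduces to the
      Markov identity at level \<open>N\<close>.\<close>
    define N where "N = Max (insert a (b ` U))"
    have aN: "a \<le> N" and bN: "\<And>u. u \<in> U \<Longrightarrow> b u \<le> N"
      unfolding N_def using U(1) by (auto intro: Max_ge)
    have N: "1 \<le> N" using a aN by simp
    define B' where "B' = (\<lambda>u. {v :: colouring. Q u (restrict v {1..b u})})"
    define A' where "A' = {v :: colouring. R (restrict v {1..a})}"
    let ?L = "\<lambda>\<omega>. Lambda_fin k N (X \<omega>) (restrict (l \<omega>) {1..N})"
    have inA: "y \<in> A \<longleftrightarrow> restrict y {1..N} \<in> A'" if "y \<in> ?P" for y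
      using that by (simp only: A A'_def mem_Collect_eq restrict_restrict_le[OF aN] simp_thms)
    have inB: "y \<in> B u \<longleftrightarrow> restrict y {1..N} \<in> B' u" if "y \<in> ?P" "u \<in> U" for y u
      using that by (simp only: B B'_def mem_Collect_eq restrict_restrict_le[OF bN] simp_thms)
    have LB: "Lambda_inf k (X \<omega>) (l \<omega>) u \<in> B u \<longleftrightarrow> ?L \<omega> u \<in> B' u" if "\<omega> \<in> space M" "u \<in> U" for \<omega> u
      unfolding inB[OF inP[OF that(1) l[OF that(1)]] that(2)] restr[OF N that(1) l[OF that(1)]] ..
    have LA: "Lambda_inf k (X \<omega>) y v \<in> A \<longleftrightarrow> Lambda_fin k N (X \<omega>) (restrict y {1..N}) v \<in> A'"
      if "\<omega> \<in> space M" "y \<in> ?P" for \<omega> y v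
      unfolding inA[OF inP[OF that]] restr[OF N that] ..
    have events_eq: "{\<omega>\<in>space M. (\<forall>u\<in>U. Lambda_inf k (X \<omega>) (l \<omega>) u \<in> B u) \<and> Lambda_inf k (X \<omega>) (l \<omega>) (s + t) \<in> A} =
        {\<omega>\<in>space M. (\<forall>u\<in>U. ?L \<omega> u \<in> B' u) \<and> ?L \<omega> (s + t) \<in> A'}"
      using LB LA[OF _ l] by auto
    have "emeasure M {\<omega>\<in>space M. (\<forall>u\<in>U. Lambda_inf k (X \<omega>) (l \<omega>) u \<in> B u) \<and> Lambda_inf k (X \<omega>) (l \<omega>) (s + t) \<in> A} =
      (\<integral>\<^sup>+\<omega>. indicator {\<omega>\<in>space M. \<forall>u\<in>U. ?L \<omega> u \<in> B' u} \<omega> *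
         emeasure M {\<omega>'\<in>space M. Lambda_fin k N (X \<omega>') (?L \<omega> s) t \<in> A'} \<partial>M)"
      unfolding events_eq by (rule Lambda_fin_markov[OF N \<kappa>[OF N] s t U])
    also have "\<dots> = (\<integral>\<^sup>+\<omega>. indicator {\<omega>\<in>space M. \<forall>u\<in>U. Lambda_inf k (X \<omega>) (l \<omega>) u \<in> B u} \<omega> *
         emeasure M {\<omega>'\<in>space M. Lambda_inf k (X \<omega>') (Lambda_inf k (X \<omega>) (l \<omega>) s) t \<in> A} \<partial>M)"
    proof (rule nn_integral_cong)
      fix \<omega> assume \<omega>: "\<omega> \<in> space M"
      have "{\<omega>'\<in>space M. Lambda_inf k (X \<omega>') (Lambda_inf k (X \<omega>) (l \<omega>) s) t \<in> A} =
          {\<omega>'\<in>space M. Lambda_fin k N (X \<omega>') (?L \<omega> s) t \<in> A'}"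
        using LA[OF _ inP[OF \<omega> l[OF \<omega>]]] restr[OF N \<omega> l[OF \<omega>]] by auto
      moreover have "indicator {\<omega>\<in>space M. \<forall>u\<in>U. Lambda_inf k (X \<omega>) (l \<omega>) u \<in> B u} \<omega> =
          (indicator {\<omega>\<in>space M. \<forall>u\<in>U. ?L \<omega> u \<in> B' u} \<omega> :: ennreal)"
        using LB[OF \<omega>] \<omega> by (auto simp: indicator_def)
      ultimately show "indicator {\<omega>\<in>space M. \<forall>u\<in>U. ?L \<omega> u \<in> B' u} \<omega> *
         emeasure M {\<omega>'\<in>space M. Lambda_fin k N (X \<omega>') (?L \<omega> s) t \<in> A'} =
         indicator {\<omega>\<in>space M. \<forall>u\<in>U. Lambda_inf k (X \<omega>) (l \<omega>) u \<in> B u} \<omega> *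
         emeasure M {\<omega>'\<in>space M. Lambda_inf k (X \<omega>') (Lambda_inf k (X \<omega>) (l \<omega>) s) t \<in> A}"
        by simp
    qed
    finally show ?thesis .
  qed

  show "sets ?S = sigma_sets (space ?S) (cylinders k)"
    unfolding space_partition_space by (rule sets_partition_space)
  show "Int_stable (cylinders k)" by (rule cylinders_Int_stable)
  show "cylinders k \<subseteq> Pow (space ?S)" unfolding space_partition_space by (rule cylinders_subset)
  show "space ?S \<in> cylinders k" unfolding space_partition_space by (rule space_in_cylinders)
  show "(\<lambda>\<omega>. Lambda_inf k (X \<omega>) y t) \<in> M \<rightarrow>\<^sub>M ?S" if "0 \<le> t" "y \<in> space ?S" for t y
    using that by (intro meas const) (simp_all add: space_partition_space)
  show "(\<lambda>\<omega>. Lambda_inf k (X \<omega>) (l0 \<omega>) t) \<in> M \<rightarrow>\<^sub>M ?S" if "0 \<le> t" for t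
    by (rule meas[OF that l0 \<kappa>])
  \<comment> \<open>For a cylinder at level \<open>n\<close> the probability depends on
    \<open>y\<close> through its restriction to \<open>[n]\<close> only, so it is a function on a
    discrete space composed with a measurable restriction.\<close>
  show "(\<lambda>y. emeasure M {\<omega>\<in>space M. Lambda_inf k (X \<omega>) y t \<in> A}) \<in> borel_measurable ?S"
    if "0 \<le> t" and cyl: "A \<in> cylinders k" for t A
  proof -
    obtain n Q where n: "1 \<le> n" and A: "A = {l \<in> ?P. Q (restrict l {1..n})}"
      using cyl unfolding cylinder_iff by blast
    let ?f = "\<lambda>v. emeasure M {\<omega>\<in>space M. Q (Lambda_fin k n (X \<omega>) v t)}"
    have "(\<lambda>y. ?f (restrict y {1..n})) \<in> borel_measurable ?S"
      using measurable_restrict_partition[OF n] by (rule measurable_compose) simp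
    moreover have "?f (restrict y {1..n}) = emeasure M {\<omega>\<in>space M. Lambda_inf k (X \<omega>) y t \<in> A}"
      if "y \<in> space ?S" for y
    proof -
      have y: "y \<in> ?P" using that by (simp add: space_partition_space)
      have "Q (Lambda_fin k n (X \<omega>) (restrict y {1..n}) t) \<longleftrightarrow> Lambda_inf k (X \<omega>) y t \<in> A"
        if "\<omega> \<in> space M" for \<omega>
        unfolding A mem_Collect_eq restr[OF n that y] using inP[OF that y] by blast
      then have "{\<omega>\<in>space M. Q (Lambda_fin k n (X \<omega>) (restrict y {1..n}) t)} =
          {\<omega>\<in>space M. Lambda_inf k (X \<omega>) y t \<in> A}" by blast
      then show ?thesis by simp
    qed
    ultimately show ?thesis by (simp cong: measurable_cong)
  qed
  show "Lambda_inf k (X \<omega>) y 0 = y" if "y \<in> space ?S" "\<omega> \<in> space M" for y \<omega>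
  proof -
    have y: "y \<in> ?P" using that(1) by (simp add: space_partition_space)
    show ?thesis
      by (rule partitions_eqI[OF inP[OF that(2) y] y])
        (simp only: restrict_Lambda_inf[OF k X_subset[OF that(2)] y] Lambda_fin_0)
  qed
  show "emeasure M {\<omega>\<in>space M. Lambda_inf k (X \<omega>) y (s + t) \<in> A} =
      (\<integral>\<^sup>+\<omega>. emeasure M {\<omega>'\<in>space M. Lambda_inf k (X \<omega>') (Lambda_inf k (X \<omega>) y s) t \<in> A} \<partial>M)"
    if "0 \<le> s" "0 \<le> t" "y \<in> space ?S" "A \<in> cylinders k" for s t y A
  proof -
    have y: "y \<in> ?P" using that(3) by (simp add: space_partition_space)
    from markov[OF that(1,2) _ _ _ that(4) y const[OF y], of "{}" "\<lambda>_. {}"] show ?thesis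
      by (auto intro!: nn_integral_cong)
  qed
  show "emeasure M {\<omega>\<in>space M. (\<forall>u\<in>U. Lambda_inf k (X \<omega>) (l0 \<omega>) u \<in> B u) \<and> Lambda_inf k (X \<omega>) (l0 \<omega>) (s + t) \<in> A} =
      (\<integral>\<^sup>+\<omega>. indicator {\<omega>\<in>space M. \<forall>u\<in>U. Lambda_inf k (X \<omega>) (l0 \<omega>) u \<in> B u} \<omega> *
         emeasure M {\<omega>'\<in>space M. Lambda_inf k (X \<omega>') (Lambda_inf k (X \<omega>) (l0 \<omega>) s) t \<in> A} \<partial>M)"
    if "0 \<le> s" "0 \<le> t" "finite U" "U \<subseteq> {0..s}" "\<And>u. u \<in> U \<Longrightarrow> B u \<in> cylinders k" "A \<in> cylinders k"
    for s t U B A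
    by (rule markov[OF that l0 \<kappa>])
qed

end

text \<open>Regularity and the jump rule are almost sure statements, and uniqueness at finite level
  is among cadlag solutions. Cadlag paths and the gluing hold for every outcome, since irregular
  configurations carry constant paths, which are also consistent.\<close>

theorem proposition3p1:
  fixes k :: nat
    and \<phi> :: "colouring_map measure"
    and M :: "'w measure"
    and X :: "'w \<Rightarrow> (real \<times> colouring_map) set"
    and l0 :: "'w \<Rightarrow> colouring"
  defines "\<mu> \<equiv> restrict_space lborel {0..} \<Otimes>\<^sub>M \<phi>"
    and "\<Lambda> \<equiv> \<lambda>n t \<omega>. Lambda_fin k n (X \<omega>) (l0 \<omega>) t"
  assumes k: "1 \<le> k"
    and sets_phi: "sets \<phi> = sets (Lip_space k)"
    and phi_Id: "emeasure \<phi> {Id_map k {1..}} = 0"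
    and phi_fin: "\<And>n. 1 \<le> n \<Longrightarrow>
      emeasure (image_measure k \<phi> n) (Lip k {1..n} - {Id_map k {1..n}}) < \<infinity>"
    and M: "prob_space M"
    and X: "poisson_point_process M \<mu> X"
    and l0: "l0 \<in> M \<rightarrow>\<^sub>M partition_space k"
    and indep: "prob_space.indep_set M
      {l0 -` A \<inter> space M | A. A \<in> sets (partition_space k)} (point_process_events M \<mu> X)"
  shows "(AE \<omega> in M. regular_points k (X \<omega>) \<and>
      (\<forall>n\<ge>1. jump_rule k n (X \<omega>) (l0 \<omega>) (\<lambda>t. \<Lambda> n t \<omega>) \<and>
         (\<forall>y. cadlag (partitions k {1..n}) y \<and> jump_rule k n (X \<omega>) (l0 \<omega>) y \<longrightarrow>
            (\<forall>t\<ge>0. y t = \<Lambda> n t \<omega>)))) \<and>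
    (\<forall>n\<ge>1. finite (partitions k {1..n}) \<and>
      (\<forall>\<omega>\<in>space M. cadlag (partitions k {1..n}) (\<lambda>t. \<Lambda> n t \<omega>)) \<and>
      markov_process M (count_space (partitions k {1..n})) (\<Lambda> n)) \<and>
    (\<exists>L. consistent_markov_process M k L \<and>
      (\<forall>\<omega>\<in>space M. determines k (\<lambda>n t. \<Lambda> n t \<omega>) (\<lambda>t. L t \<omega>) \<and>
         (\<forall>x. determines k (\<lambda>n t. \<Lambda> n t \<omega>) x \<longrightarrow> (\<forall>t\<ge>0. x t = L t \<omega>))))"
proof -
  interpret poisson_lip M k \<phi> X
    by (intro poisson_lip.intro poisson_lip_axioms.intro M k sets_phi phi_Id phi_fin X[unfolded \<mu>_def])
  have l0_in: "l0 \<omega> \<in> partitions k {1..}" if "\<omega> \<in> space M" for \<omega>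
    using measurable_space[OF l0 that] by (simp add: space_partition_space)
  have l0_restr: "restrict (l0 \<omega>) {1..n} \<in> partitions k {1..n}" if "\<omega> \<in> space M" for \<omega> n
    using restrict_in_partitions[OF l0_in[OF that], of "{1..n}"] by auto
  have start: "independent_start n (\<lambda>\<omega>. restrict (l0 \<omega>) {1..n})" if n: "1 \<le> n" for n
    unfolding independent_start_def
  proof (intro conjI ballI l0_restr)
    fix y assume "y \<in> partitions k {1..n}"
    then have A: "(\<lambda>l. restrict l {1..n}) -` {y} \<inter> space (partition_space k) \<in> sets (partition_space k)"
      using measurable_sets[OF measurable_restrict_partition[OF n]] by simp
    \<comment> \<open>Written as a preimage under \<open>l0\<close> of a measurable cylinder, the
      event falls under the independence hypothesis on the initial state.\<close>
    have eq: "{\<omega>\<in>space M. restrict (l0 \<omega>) {1..n} = y} =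
        l0 -` ((\<lambda>l. restrict l {1..n}) -` {y} \<inter> space (partition_space k)) \<inter> space M"
      using measurable_space[OF l0] by blast
    show "{\<omega>\<in>space M. restrict (l0 \<omega>) {1..n} = y} \<in> sets M"
      unfolding eq by (rule measurable_sets[OF l0 A])
    show "prob ({\<omega>\<in>space M. restrict (l0 \<omega>) {1..n} = y} \<inter> E) =
        prob {\<omega>\<in>space M. restrict (l0 \<omega>) {1..n} = y} * prob E" if "E \<in> sets point_algebra" for E
    proof (rule indep_setD[OF indep])
      show "{\<omega>\<in>space M. restrict (l0 \<omega>) {1..n} = y} \<in> {l0 -` A \<inter> space M | A. A \<in> sets (partition_space k)}"
        unfolding eq using A by blast
      show "E \<in> point_process_events M \<mu> X"
        using that unfolding sets_point_algebra \<mu>_def .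
    qed
  qed
  have cadlag: "cadlag (partitions k {1..n}) (\<lambda>t. \<Lambda> n t \<omega>)" if "1 \<le> n" "\<omega> \<in> space M" for n \<omega>
    unfolding \<Lambda>_def using cadlag_Lambda_fin[OF k that(1) X_subset[OF that(2)] l0_restr[OF that(2)]] .
  have \<Lambda>_eq: "\<Lambda> n t \<omega> = Lambda_fin k n (X \<omega>) (restrict (l0 \<omega>) {1..n}) t" for n t \<omega>
    unfolding \<Lambda>_def Lambda_fin_restrict ..
  define L where "L = (\<lambda>t \<omega>. Lambda_inf k (X \<omega>) (l0 \<omega>) t)"
  have restr_L: "restrict (L t \<omega>) {1..n} = \<Lambda> n t \<omega>" if "1 \<le> n" "\<omega> \<in> space M" for n t \<omega>
    unfolding L_def \<Lambda>_def by (rule restrict_Lambda_inf[OF k X_subset[OF that(2)] l0_in[OF that(2)] that(1)])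
  have L_in: "L t \<omega> \<in> partitions k {1..}" if "\<omega> \<in> space M" for t \<omega>
    unfolding L_def by (rule Lambda_inf_in[OF k X_subset[OF that] l0_in[OF that]])

  have "AE \<omega> in M. regular_points k (X \<omega>) \<and>
      (\<forall>n\<ge>1. jump_rule k n (X \<omega>) (l0 \<omega>) (\<lambda>t. \<Lambda> n t \<omega>) \<and>
         (\<forall>y. cadlag (partitions k {1..n}) y \<and> jump_rule k n (X \<omega>) (l0 \<omega>) y \<longrightarrow>
            (\<forall>t\<ge>0. y t = \<Lambda> n t \<omega>)))"
    using AE_regular AE_space
  proof eventually_elim
    case (elim \<omega>)
    have rule: "jump_rule k n (X \<omega>) (l0 \<omega>) (\<lambda>t. \<Lambda> n t \<omega>)" if "1 \<le> n" for n
      unfolding \<Lambda>_def by (rule jump_rule_Lambda_fin[OF k that X_subset[OF elim(2)] l0_restr[OF elim(2)] elim(1)])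
    with elim show ?case
      using jump_rule_unique[OF _ _ cadlag[OF _ elim(2)] rule] by blast
  qed
  moreover have "\<forall>n\<ge>1. finite (partitions k {1..n}) \<and>
      (\<forall>\<omega>\<in>space M. cadlag (partitions k {1..n}) (\<lambda>t. \<Lambda> n t \<omega>)) \<and>
      markov_process M (count_space (partitions k {1..n})) (\<Lambda> n)"
    using finite_partitions cadlag markov_process_fin[OF _ start] \<Lambda>_eq by blast
  moreover have "consistent_markov_process M k L"
    unfolding consistent_markov_process_def
  proof (intro conjI allI impI)
    show "markov_process M (partition_space k) L"
      unfolding L_def by (rule markov_process_inf[OF l0_in start])
    show "markov_process M (count_space (partitions k {1..n})) (\<lambda>t \<omega>. restrict (L t \<omega>) {1..n})"
      if n: "1 \<le> n" for n
      by (rule markov_process_fin[OF n start[OF n]]) (simp only: restr_L[OF n] \<Lambda>_eq)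
  qed
  moreover have "determines k (\<lambda>n t. \<Lambda> n t \<omega>) (\<lambda>t. L t \<omega>)" if "\<omega> \<in> space M" for \<omega>
    unfolding determines_def using L_in[OF that] restr_L[OF _ that] by blast
  moreover have "x t = L t \<omega>"
    if "\<omega> \<in> space M" "determines k (\<lambda>n t. \<Lambda> n t \<omega>) x" "0 \<le> t" for \<omega> x t
  proof (rule partitions_eqI)
    show "restrict (x t) {1..n} = restrict (L t \<omega>) {1..n}" if "1 \<le> n" for n
      using \<open>determines k (\<lambda>n t. \<Lambda> n t \<omega>) x\<close> \<open>0 \<le> t\<close> that
      unfolding determines_def restr_L[OF that \<open>\<omega> \<in> space M\<close>] by blast
  qed (use that L_in[OF that(1)] in \<open>auto simp: determines_def\<close>)
  ultimately show ?thesis by blast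
qed

end
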